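(* Let $p(x,y)=xy-\sum_{s=0}^4 q_sx^s$ with $q_i\in\mathbb R$, $q_0\ne0$, $q_4=1$, and let $\mathcal Z(p)=\{(x,y)\in\mathbb R^2:p(x,y)=0\}$. Let $n\ge1$ and let $\beta=(\beta_{i,j})_{i,j\in\mathbb Z_+,\ i+j\le 2n}$ be a real sequence with $\beta_{0,0}>0$ satisfying $\beta_{i,j}=\sum_{s=0}^4q_s\beta_{i-1+s,j-1}$ for all $i,j\ge1$ with $i+j\le 2n-2$. Use the notation of the context (the sequence $\gamma(\underline t)$, the matrices $C$, $F_1(t_1)$, $F_2(\underline t)$, $A_{\gamma(\underline t)}$, and the expressions $\Phi$, $\Psi$), and, when $C\succ0$ and $d(\mathbf t_1)=\det F_1(\mathbf t_1)$ has a real zero, let $(t_1)_-\le(t_1)_+$ denote the real zeros of $d$. Suppose that it is not the case that $C\succ0$, $d$ has a real zero, and there exists a triple $\underline t=(t_1,t_2,t_3)\in\mathbb R^3$ with $t_1\in((t_1)_-,(t_1)_+)$, $t_3>\Phi(t_1,t_2)$ and $\gamma_{-2n}(\underline t)>\Psi(\underline t)$. Then $\beta$ admits a $\mathcal Z(p)$-representing measure if and only if one of the following holds: (i) $C\succeq0$, $C\not\succ0$, and a relation $\sum_{i=i_1}^{i_2}a_iT^i=\mathbf 0$ satisfied in $C$ propagates through $A_{\gamma(\underline t)}$ for some $\underline t\in\mathbb R^3$, which is uniquely determined by the propagated relations. (ii) $C\succ0$, $d$ has a real zero, and, with $t_1=(t_1)_-$, the relation $\sum_{i=i_1}^{i_2}a_iT^i=\mathbf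 0$ satisfied in $F_1((t_1)_-)$ propagates through $A_{\gamma(\underline t)}$ for some $(t_2,t_3)\in\mathbb R^2$, which is uniquely determined by the propagated relations. (iii) $C\succ0$, $d$ has a real zero, and, with $t_1=(t_1)_+$, the relation $\sum_{i=i_1}^{i_2}a_iT^i=\mathbf 0$ satisfied in $F_1((t_1)_+)$ propagates through $A_{\gamma(\underline t)}$ for some $(t_2,t_3)\in\mathbb R^2$, which is uniquely determined by the propagated relations. (iv) $C\succ0$, $d$ has a real zero, and there exist $t_1\in((t_1)_-,(t_1)_+)$ and $t_2\in\mathbb R$ such that, with $t_3=\Phi(t_1,t_2)$, the relation $\sum_{i=i_1}^{i_2}a_iT^i=\mathbf 0$ satisfied in $F_2(\underline t)$ propagates through $A_{\gamma(\underline t)}$. (v) $C\succ0$, $d$ has a real zero, and there exist $t_1\in((t_1)_-,(t_1)_+)$, $t_2\in\mathbb R$ and $t_3>\Phi(t_1,t_2)$ such that $\gamma_{-2n}(\underline t)=\Psi(\underline t)$ and in the relation $\sum_{i=i_1}^{i_2}a_iT^i=\mathbf 0$ satisfied in $A_{\gamma(\underline t)}$ one has $i_1=-n$ and $i_2=3n$.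
   Context: A $\mathcal Z(p)$-representing measure for $\beta$ is a positive Borel measure $\mu$ on $\mathbb R^2$ with $\operatorname{supp}\mu\subseteq\mathcal Z(p)$ and $\beta_{i,j}=\int x^iy^j\,d\mu$ for all $i,j\in\mathbb Z_+$, $i+j\le 2n$. $\succeq0$ and $\succ0$ mean positive semidefinite and positive definite. Coefficients: for $j\ge0$ the numbers $q_{j,t}$, $-j\le t\le 3j$, are defined by $\big(\sum_{s=0}^4q_sx^{s-1}\big)^j=\sum_{t=-j}^{3j}q_{j,t}x^t$. Construction of $\gamma(\underline t)=(\gamma_{-2n},\dots,\gamma_{6n})$ for $\underline t=(t_1,t_2,t_3)\in\mathbb R^3$: let $\gamma_{6n-3}=t_1$, $\gamma_{6n-1}=t_2$, $\gamma_{6n}=t_3$. Set $\gamma_i=\beta_{i,0}$ for $0\le i\le2n$. For $k=1,\dots,2n-2$ successively set $$\gamma_{-k}=\frac1{q_0^k}\Big(\beta_{0,k}-\sum_{t=-k+1}^{3k}q_{k,t}\gamma_t\Big),$$ $$\gamma_{2n+2k-1}=\beta_{2n-k-1,k}-\sum_{t=-k}^{3k-1}q_{k,t}\gamma_{t+2n-k-1},\qquad \gamma_{2n+2k}=\beta_{2n-k,k}-\sum_{t=-k}^{3k-1}q_{k,t}\gamma_{t+2n-k}.$$ Then set $$\gamma_{-2n+1}=\gamma_{-2n+1}(t_1)=\frac1{q_0^{2n-1}}\Big(\beta_{0,2n-1}-\sum_{t=-2n+2}^{6n-3}q_{2n-1,t}\gamma_t\Big),$$ $$\gamma_{6n-2}=\gamma_{6n-2}(t_1)=\beta_{1,2n-1}-\sum_{t=-2n+1}^{6n-4}q_{2n-1,t}\gamma_{t+1},$$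 $$\gamma_{-2n}=\gamma_{-2n}(\underline t)=\frac1{q_0^{2n}}\Big(\beta_{0,2n}-\sum_{t=-2n+1}^{6n}q_{2n,t}\gamma_t\Big).$$ All $\gamma_s$ with $-2n+2\le s\le 6n-4$ are determined by $\beta$ alone. Matrices: $A_{\gamma(\underline t)}$ is the Hankel matrix with rows and columns labelled $T^{-n},T^{-n+1},\dots,T^{3n}$ and with entry $\gamma_{i+j}$ in row $T^i$ and column $T^j$. Principal submatrices: $C$ is the one on $T^{-n+1},\dots,T^{3n-2}$ (independent of $\underline t$); $F_1(t_1)$ is the one on $T^{-n+1},\dots,T^{3n-1}$ (it depends only on $t_1$); $F_2(\underline t)$ is the one on $T^{-n+1},\dots,T^{3n}$. When $C\succ0$, $d(\mathbf t_1)=\det F_1(\mathbf t_1)$ is a quadratic polynomial in $\mathbf t_1$ with negative leading coefficient. Expressions (used when $C\succ0$ and $t_1\in((t_1)_-,(t_1)_+)$): let $c_1=(\gamma_{2n},\dots,\gamma_{6n-4},t_1)^T$, $w_1=\gamma_{6n-2}(t_1)-c_1^TC^{-1}c_1$, $v=(\gamma_{2n+1},\dots,\gamma_{6n-4},t_1,\gamma_{6n-2}(t_1))^T$, $$\Phi(t_1,t_2)=v^T\Big(C^{-1}+\frac1{w_1}C^{-1}c_1c_1^TC^{-1}\Big)v-\frac{2t_2}{w_1}v^TC^{-1}c_1+\frac{t_2^2}{w_1};$$ and let $B=F_1(t_1)$, $c_2=(\gamma_{2n+1},\dots,\gamma_{6n-4},t_1,\gamma_{6n-2}(t_1),t_2)^T$,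 $w_2=t_3-c_2^TB^{-1}c_2$, $z_2=(\gamma_{-2n+1}(t_1),\gamma_{-2n+2},\dots,\gamma_{2n-1})^T$, $$\Psi(\underline t)=z_2^T\Big(B^{-1}+\frac1{w_2}B^{-1}c_2c_2^TB^{-1}\Big)z_2-\frac{2\gamma_{2n}}{w_2}z_2^TB^{-1}c_2+\frac{\gamma_{2n}^2}{w_2}.$$ (For $n=1$ the lists $\gamma_{2n},\dots,\gamma_{6n-4}$ and $\gamma_{2n+1},\dots,\gamma_{6n-4}$ are read as the single entry $\gamma_2$ and the empty list.) Relations: a relation $\sum_{i=i_1}^{i_2}a_iT^i=\mathbf 0$ with $a_i\in\mathbb R$, $-n\le i_1<i_2\le3n$, $a_{i_1}\ne0$, $a_{i_2}\neq0$, is satisfied in a principal submatrix of $A_{\gamma(\underline t)}$ if all labels $T^{i}$, $i_1\le i\le i_2$, are among its column labels and the corresponding linear combination of its columns is zero. Such a relation propagates through $A_{\gamma(\underline t)}$ if it is a column relation of $A_{\gamma(\underline t)}$ and in addition $$\sum_{i=i_1}^{i_2}a_iT^{i-j}=\mathbf 0\ \ (j=1,\dots,n+i_1),\qquad \sum_{i=i_1}^{i_2}a_iT^{i+j}=\mathbf 0\ \ (j=1,\dots,3n-i_2)$$ are column relations of $A_{\gamma(\underline t)}$; these are the propagated relations. In (ii)–(v) the relation referred to is unique up to a nonzero scalar multiple. *)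

theory Defs
  imports
    "HOL-Analysis.Analysis"
    "HOL-Computational_Algebra.Formal_Laurent_Series"
    "Jordan_Normal_Form.Determinant"
    "Jordan_Normal_Form.Gauss_Jordan_Elimination"
begin

definition curve :: "(nat \<Rightarrow> real) \<Rightarrow> (real \<times> real) set" where
  "curve q = {(x, y). x * y - (\<Sum>s=0..4. q s * x ^ s) = 0}"

definition measure_support :: "'a::topological_space measure \<Rightarrow> 'a set" where
  "measure_support M = {x. \<forall>U. open U \<and> x \<in> U \<longrightarrow> emeasure M U > 0}"

text \<open>Integrability is required explicitly because the Bochner integral of a non-integrable
  function is 0 by convention. Only the values \<open>\<beta> i j\<close> with \<open>i + j \<le> 2 * n\<close> matter.\<close>

definition representing_measure ::
    "(nat \<Rightarrow> real) \<Rightarrow> nat \<Rightarrow> (nat \<Rightarrow> nat \<Rightarrow> real) \<Rightarrow> (real \<times> real) measure \<Rightarrow> bool" where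
  "representing_measure q n \<beta> M \<longleftrightarrow>
     sets M = sets borel \<and> measure_support M \<subseteq> curve q \<and>
     (\<forall>i j. i + j \<le> 2 * n \<longrightarrow>
        integrable M (\<lambda>(x, y). x ^ i * y ^ j) \<and>
        \<beta> i j = integral\<^sup>L M (\<lambda>(x, y). x ^ i * y ^ j))"

definition qcoeff :: "(nat \<Rightarrow> real) \<Rightarrow> nat \<Rightarrow> int \<Rightarrow> real" where
  "qcoeff q j t = fls_nth ((\<Sum>s=0..4. fls_const (q s) * fls_X_intpow (int s - 1)) ^ j) t"

text \<open>Sequences are functions on all integers, built by successive assignments; entries not yet
  assigned are 0 and are never read. The construction is split according to the dependence on
  the parameters: \<open>gamma0\<close> holds the entries of index \<open>-2n+2,\<dots>,6n-4\<close>, which depend on \<open>\<beta>\<close> alone,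
  \<open>gamma1\<close> adds those depending on \<open>t1\<close> only (indices \<open>-2n+1\<close>, \<open>6n-3\<close>, \<open>6n-2\<close>), and
  \<open>gamma\<close> is the full sequence.\<close>

definition gamma_init :: "(nat \<Rightarrow> nat \<Rightarrow> real) \<Rightarrow> nat \<Rightarrow> int \<Rightarrow> real" where
  "gamma_init \<beta> n i = (if 0 \<le> i \<and> i \<le> 2 * int n then \<beta> (nat i) 0 else 0)"

definition gamma_step ::
    "(nat \<Rightarrow> real) \<Rightarrow> (nat \<Rightarrow> nat \<Rightarrow> real) \<Rightarrow> nat \<Rightarrow> nat \<Rightarrow> (int \<Rightarrow> real) \<Rightarrow> int \<Rightarrow> real" where
  "gamma_step q \<beta> n k g =
    (let g1 = g(- int k :=
           1 / q 0 ^ k * (\<beta> 0 k - (\<Sum>t = - int k + 1..3 * int k. qcoeff q k t * g t)));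
         g2 = g1(2 * int n + 2 * int k - 1 :=
           \<beta> (2 * n - k - 1) k
             - (\<Sum>t = - int k..3 * int k - 1. qcoeff q k t * g1 (t + 2 * int n - int k - 1)));
         g3 = g2(2 * int n + 2 * int k :=
           \<beta> (2 * n - k) k
             - (\<Sum>t = - int k..3 * int k - 1. qcoeff q k t * g2 (t + 2 * int n - int k)))
     in g3)"

definition gamma0 :: "(nat \<Rightarrow> real) \<Rightarrow> (nat \<Rightarrow> nat \<Rightarrow> real) \<Rightarrow> nat \<Rightarrow> int \<Rightarrow> real" where
  "gamma0 q \<beta> n = fold (gamma_step q \<beta> n) [1..<2 * n - 1] (gamma_init \<beta> n)"

definition gamma1 ::
    "(nat \<Rightarrow> real) \<Rightarrow> (nat \<Rightarrow> nat \<Rightarrow> real) \<Rightarrow> nat \<Rightarrow> real \<Rightarrow> int \<Rightarrow> real" where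
  "gamma1 q \<beta> n t1 =
    (let g = (gamma0 q \<beta> n)(6 * int n - 3 := t1);
         g1 = g(- 2 * int n + 1 :=
           1 / q 0 ^ (2 * n - 1) * (\<beta> 0 (2 * n - 1)
             - (\<Sum>t = - 2 * int n + 2..6 * int n - 3. qcoeff q (2 * n - 1) t * g t)));
         g2 = g1(6 * int n - 2 :=
           \<beta> 1 (2 * n - 1)
             - (\<Sum>t = - 2 * int n + 1..6 * int n - 4. qcoeff q (2 * n - 1) t * g1 (t + 1)))
     in g2)"

definition gamma ::
    "(nat \<Rightarrow> real) \<Rightarrow> (nat \<Rightarrow> nat \<Rightarrow> real) \<Rightarrow> nat \<Rightarrow> real \<Rightarrow> real \<Rightarrow> real \<Rightarrow> int \<Rightarrow> real" where
  "gamma q \<beta> n t1 t2 t3 =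
    (let g = (gamma1 q \<beta> n t1)(6 * int n - 1 := t2, 6 * int n := t3)
     in g(- 2 * int n :=
           1 / q 0 ^ (2 * n) * (\<beta> 0 (2 * n)
             - (\<Sum>t = - 2 * int n + 1..6 * int n. qcoeff q (2 * n) t * g t))))"

lemma gamma1_eq_gamma0:
  "- 2 * int n + 2 \<le> i \<Longrightarrow> i \<le> 6 * int n - 4 \<Longrightarrow> gamma1 q \<beta> n t1 i = gamma0 q \<beta> n i"
  by (simp add: gamma1_def Let_def)

lemma gamma_eq_gamma1:
  "- 2 * int n + 1 \<le> i \<Longrightarrow> i \<le> 6 * int n - 2 \<Longrightarrow> gamma q \<beta> n t1 t2 t3 i = gamma1 q \<beta> n t1 i"
  by (simp add: gamma_def Let_def)

text \<open>\<open>hankel g lo hi\<close> has its rows and columns labelled \<open>lo,\<dots>,hi\<close>; label \<open>i\<close> is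
  the matrix index \<open>i - lo\<close>.\<close>

definition hankel :: "(int \<Rightarrow> real) \<Rightarrow> int \<Rightarrow> int \<Rightarrow> real mat" where
  "hankel g lo hi = Matrix.mat (nat (hi - lo + 1)) (nat (hi - lo + 1))
     (\<lambda>(r, c). g ((lo + int r) + (lo + int c)))"

definition seg :: "(int \<Rightarrow> real) \<Rightarrow> int \<Rightarrow> int \<Rightarrow> real Matrix.vec" where
  "seg g lo hi = Matrix.vec (nat (hi - lo + 1)) (\<lambda>k. g (lo + int k))"

definition pos_semidef :: "real mat \<Rightarrow> bool" where
  "pos_semidef M \<longleftrightarrow> square_mat M \<and> transpose_mat M = M \<and>
     (\<forall>x \<in> carrier_vec (dim_row M). scalar_prod x (M *\<^sub>v x) \<ge> 0)"

definition pos_def :: "real mat \<Rightarrow> bool" where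
  "pos_def M \<longleftrightarrow> square_mat M \<and> transpose_mat M = M \<and>
     (\<forall>x \<in> carrier_vec (dim_row M). x \<noteq> 0\<^sub>v (dim_row M) \<longrightarrow> scalar_prod x (M *\<^sub>v x) > 0)"

definition C_mat :: "(nat \<Rightarrow> real) \<Rightarrow> (nat \<Rightarrow> nat \<Rightarrow> real) \<Rightarrow> nat \<Rightarrow> real mat" where
  "C_mat q \<beta> n = hankel (gamma0 q \<beta> n) (- int n + 1) (3 * int n - 2)"

definition F1_mat :: "(nat \<Rightarrow> real) \<Rightarrow> (nat \<Rightarrow> nat \<Rightarrow> real) \<Rightarrow> nat \<Rightarrow> real \<Rightarrow> real mat" where
  "F1_mat q \<beta> n t1 = hankel (gamma1 q \<beta> n t1) (- int n + 1) (3 * int n - 1)"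

lemma C_mat_eq:
  "C_mat q \<beta> n = hankel (gamma q \<beta> n t1 t2 t3) (- int n + 1) (3 * int n - 2)"
  by (rule eq_matI) (auto simp: C_mat_def hankel_def gamma_eq_gamma1 gamma1_eq_gamma0)

lemma F1_mat_eq:
  "F1_mat q \<beta> n t1 = hankel (gamma q \<beta> n t1 t2 t3) (- int n + 1) (3 * int n - 1)"
  by (rule eq_matI) (auto simp: F1_mat_def hankel_def gamma_eq_gamma1)

definition d :: "(nat \<Rightarrow> real) \<Rightarrow> (nat \<Rightarrow> nat \<Rightarrow> real) \<Rightarrow> nat \<Rightarrow> real \<Rightarrow> real" where
  "d q \<beta> n t1 = Determinant.det (F1_mat q \<beta> n t1)"

text \<open>The smallest and largest real zero of \<open>d\<close>. These are only used when \<open>C_mat\<close> is positive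
  definite, so that \<open>d\<close> is quadratic, and \<open>d\<close> has a real zero.\<close>

definition t1_minus :: "(nat \<Rightarrow> real) \<Rightarrow> (nat \<Rightarrow> nat \<Rightarrow> real) \<Rightarrow> nat \<Rightarrow> real" where
  "t1_minus q \<beta> n = Min {t. d q \<beta> n t = 0}"

definition t1_plus :: "(nat \<Rightarrow> real) \<Rightarrow> (nat \<Rightarrow> nat \<Rightarrow> real) \<Rightarrow> nat \<Rightarrow> real" where
  "t1_plus q \<beta> n = Max {t. d q \<beta> n t = 0}"

definition outer_prod :: "real Matrix.vec \<Rightarrow> real Matrix.vec \<Rightarrow> real mat" where
  "outer_prod u v =
     Matrix.mat (dim_vec u) (dim_vec v) (\<lambda>(i, j). vec_index u i * vec_index v j)"

text \<open>The common shape of \<open>Phi\<close> and \<open>Psi\<close>: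
  \<open>v\<^sup>T (M\<^sup>-\<^sup>1 + 1/w M\<^sup>-\<^sup>1 c c\<^sup>T M\<^sup>-\<^sup>1) v - 2s/w v\<^sup>T M\<^sup>-\<^sup>1 c + s\<^sup>2/w\<close>.\<close>

definition bordered_form ::
    "real mat \<Rightarrow> real Matrix.vec \<Rightarrow> real \<Rightarrow> real Matrix.vec \<Rightarrow> real \<Rightarrow> real" where
  "bordered_form M c w v s =
    (let Mi = the (mat_inverse M)
     in scalar_prod v ((Mi + (1 / w) \<cdot>\<^sub>m (Mi * outer_prod c c * Mi)) *\<^sub>v v)
        - 2 * s / w * scalar_prod v (Mi *\<^sub>v c) + s\<^sup>2 / w)"

definition Phi ::
    "(nat \<Rightarrow> real) \<Rightarrow> (nat \<Rightarrow> nat \<Rightarrow> real) \<Rightarrow> nat \<Rightarrow> real \<Rightarrow> real \<Rightarrow> real" where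
  "Phi q \<beta> n t1 t2 =
    (let g = gamma1 q \<beta> n t1; C = C_mat q \<beta> n;
         c1 = seg g (2 * int n) (6 * int n - 3);
         w1 = g (6 * int n - 2) - scalar_prod c1 (the (mat_inverse C) *\<^sub>v c1);
         v = seg g (2 * int n + 1) (6 * int n - 2)
     in bordered_form C c1 w1 v t2)"

definition Psi ::
    "(nat \<Rightarrow> real) \<Rightarrow> (nat \<Rightarrow> nat \<Rightarrow> real) \<Rightarrow> nat \<Rightarrow> real \<Rightarrow> real \<Rightarrow> real \<Rightarrow> real" where
  "Psi q \<beta> n t1 t2 t3 =
    (let g = gamma q \<beta> n t1 t2 t3; B = F1_mat q \<beta> n t1;
         c2 = seg g (2 * int n + 1) (6 * int n - 1);
         w2 = t3 - scalar_prod c2 (the (mat_inverse B) *\<^sub>v c2);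
         z2 = seg g (- 2 * int n + 1) (2 * int n - 1)
     in bordered_form B c2 w2 z2 (g (2 * int n)))"

text \<open>A relation \<open>\<Sum>i=i1..i2. a i * T^i = 0\<close> is given by \<open>i1\<close>, \<open>i2\<close> and the coefficient function
  \<open>a\<close>, whose values outside \<open>{i1..i2}\<close> are ignored. Multiplying a matrix with columns
  \<open>lo,\<dots>,hi\<close> by \<open>rel_vec lo hi i1 i2 a\<close> forms the corresponding linear combination of columns.\<close>

definition rel_vec :: "int \<Rightarrow> int \<Rightarrow> int \<Rightarrow> int \<Rightarrow> (int \<Rightarrow> real) \<Rightarrow> real Matrix.vec" where
  "rel_vec lo hi i1 i2 a = Matrix.vec (nat (hi - lo + 1))
     (\<lambda>k. if i1 \<le> lo + int k \<and> lo + int k \<le> i2 then a (lo + int k) else 0)"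

definition satisfied ::
    "(int \<Rightarrow> real) \<Rightarrow> int \<Rightarrow> int \<Rightarrow> int \<Rightarrow> int \<Rightarrow> (int \<Rightarrow> real) \<Rightarrow> bool" where
  "satisfied g lo hi i1 i2 a \<longleftrightarrow>
     lo \<le> i1 \<and> i1 < i2 \<and> i2 \<le> hi \<and> a i1 \<noteq> 0 \<and> a i2 \<noteq> 0 \<and>
     hankel g lo hi *\<^sub>v rel_vec lo hi i1 i2 a = 0\<^sub>v (nat (hi - lo + 1))"

definition propagates ::
    "nat \<Rightarrow> (int \<Rightarrow> real) \<Rightarrow> int \<Rightarrow> int \<Rightarrow> (int \<Rightarrow> real) \<Rightarrow> bool" where
  "propagates n g i1 i2 a \<longleftrightarrow>
     satisfied g (- int n) (3 * int n) i1 i2 a \<and>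
     (\<forall>j \<in> {1..int n + i1}.
        satisfied g (- int n) (3 * int n) (i1 - j) (i2 - j) (\<lambda>i. a (i + j))) \<and>
     (\<forall>j \<in> {1..3 * int n - i2}.
        satisfied g (- int n) (3 * int n) (i1 + j) (i2 + j) (\<lambda>i. a (i - j)))"

end

theory Submission
  imports Defs "HOL-Computational_Algebra.Fundamental_Theorem_Algebra"
begin

text \<open>On the curve \<open>x \<noteq> 0\<close> and \<open>y\<close> is a Laurent polynomial in \<open>x\<close>, so a representing measure for \<open>\<beta>\<close>
  is a measure on the punctured line whose moments of order \<open>-2n,\<dots>,6n\<close> are the entries of
  \<open>\<gamma>(t)\<close> for some \<open>t\<close>. The Hankel matrix of such a moment sequence is positive semidefinite, and
  a kernel vector is a Laurent polynomial vanishing almost everywhere, hence a relation that propagates.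
  Bordering \<open>C\<close> to \<open>F\<^sub>1\<close>, \<open>F\<^sub>2\<close> and \<open>A\<close> one label at a time, Schur complements locate the first
  singular matrix, which gives the five cases. Conversely, a propagated relation of length \<open>D\<close>, together with
  positivity of \<open>D\<close> consecutive rows and columns, yields a finitely atomic measure by Gauss
  quadrature; its atoms are nonzero because the lowest coefficient of the relation is.\<close>

section \<open>Moments along the curve\<close>

text \<open>The equations of degree at most 2n leave three of the 8n+1 entries free: solved in
  triangular order, lowest entries through \<open>q 0 \<noteq> 0\<close> and highest through
  \<open>q 4 = 1\<close>, they determine all the others. The same order proves uniqueness, so the
  moments of any representing measure are some \<open>gamma\<close>. Two obstacles shape the rest.
  Only x^i y^j of degree at most 2n is known to be integrable, so integrability of x^k for k from
  -2n to 6n has to come from the growth of y along the curve, of order 1/x at 0 and x^3 at infinity.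
  And the form on a window may be merely semidefinite, as with C in (i); its null vectors are then
  turned into shorter relations until the form is definite. The cases fit because of sizes: a
  relation inside F_1 has length at most 4n-2, the number of labels of C, and one inside F_2 at most
  4n-1, the number of labels of F_1. So positivity of the smaller matrix already covers a full
  window. The excluded situation is that of a positive definite A, which has no column
  relation.\<close>

lemma qcoeff_0: "qcoeff q 0 t = (if t = 0 then 1 else 0)"
  by (simp add: qcoeff_def)

lemma qcoeff_Suc:
  "qcoeff q (Suc j) t = (\<Sum>s=0..4. q s * qcoeff q j (t - int s + 1))"
  unfolding qcoeff_def power_Suc sum_distrib_right fls_nth_sum
proof (rule sum.cong[OF refl])
  fix s :: nat
  let ?B = "(\<Sum>s=0..4. fls_const (q s) * fls_X_intpow (int s - 1)) ^ j"
  have "fls_const (q s) * fls_X_intpow (int s - 1) * ?B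
      = fls_const (q s) * (fls_X_intpow (int s - 1) * ?B)"
    by (simp only: mult.assoc)
  also have "fls_nth \<dots> t = q s * fls_nth ?B (t - int s + 1)"
    unfolding fls_X_intpow_times_conv_shift by (simp add: algebra_simps)
  finally show "fls_nth (fls_const (q s) * fls_X_intpow (int s - 1) * ?B) t
      = q s * fls_nth ?B (t - int s + 1)" .
qed

lemma qcoeff_eq_0: "t < - int j \<or> t > 3 * int j \<Longrightarrow> qcoeff q j t = 0"
proof (induction j arbitrary: t)
  case (Suc j)
  have "qcoeff q j (t - int s + 1) = 0" if "s \<le> 4" for s
    using Suc.prems that by (intro Suc.IH) auto
  then show ?case
    by (simp add: qcoeff_Suc)
qed (auto simp: qcoeff_0)

lemma sum_0_4: "(\<Sum>s=0..4::nat. f s) = f 0 + f 1 + f 2 + f 3 + (f 4 :: real)"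
  by (simp add: numeral_eq_Suc sum.atLeast0_atMost_Suc)

lemma qcoeff_lowest: "qcoeff q j (- int j) = q 0 ^ j"
proof (induction j)
  case (Suc j)
  have "- int (Suc j) - int 0 + 1 = - int j"
    by simp
  with Suc show ?case
    by (simp only: qcoeff_Suc sum_0_4) (simp add: qcoeff_eq_0)
qed (simp add: qcoeff_0)

lemma qcoeff_highest: "qcoeff q j (3 * int j) = q 4 ^ j"
proof (induction j)
  case (Suc j)
  have "3 * int (Suc j) - int 4 + 1 = 3 * int j"
    by simp
  with Suc show ?case
    by (simp only: qcoeff_Suc sum_0_4) (simp add: qcoeff_eq_0)
qed (simp add: qcoeff_0)

text \<open>If \<open>g\<close> is the moment sequence of a measure on \<open>x \<noteq> 0\<close>, this is the integral of
  \<open>x\<^sup>i y\<^sup>j\<close> along the curve \<open>y = \<Sum>s. q s * x\<^sup>s\<^sup>-\<^sup>1\<close>.\<close>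

definition curve_moment :: "(nat \<Rightarrow> real) \<Rightarrow> (int \<Rightarrow> real) \<Rightarrow> int \<Rightarrow> nat \<Rightarrow> real" where
  "curve_moment q g i j = (\<Sum>t=- int j..3 * int j. qcoeff q j t * g (t + i))"

lemma curve_moment_0 [simp]: "curve_moment q g i 0 = g i"
  by (simp add: curve_moment_def qcoeff_0)

lemma curve_moment_superset:
  assumes "a \<le> - int j" "3 * int j \<le> b"
  shows "curve_moment q g i j = (\<Sum>t=a..b. qcoeff q j t * g (t + i))"
  unfolding curve_moment_def
  by (rule sum.mono_neutral_left) (use assms in \<open>auto intro: qcoeff_eq_0\<close>)

text \<open>Replacing one factor y by its Laurent polynomial turns x^i y^(j+1) into a combination of
  x^(i-1+s) y^j. The hypothesis on \<open>\<beta>\<close> has the same shape, so the two sides can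
  be compared by induction on j.\<close>

lemma curve_moment_Suc:
  "curve_moment q g i (Suc j) = (\<Sum>s=0..4. q s * curve_moment q g (i - 1 + int s) j)"
proof -
  let ?S = "{- int (Suc j)..3 * int (Suc j)}"
  have *: "(\<Sum>t\<in>?S. qcoeff q j (t - int s + 1) * g (t + i)) = curve_moment q g (i - 1 + int s) j"
    if "s \<le> 4" for s
  proof -
    have "(\<Sum>t\<in>?S. qcoeff q j (t - int s + 1) * g (t + i))
        = (\<Sum>t=- int (Suc j) - int s + 1..3 * int (Suc j) - int s + 1.
             qcoeff q j t * g (t + (i - 1 + int s)))"
      by (rule sum.reindex_bij_witness[where j = "\<lambda>t. t - int s + 1" and i = "\<lambda>t. t + int s - 1"])
         auto
    also have "\<dots> = curve_moment q g (i - 1 + int s) j"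
      by (rule curve_moment_superset[symmetric]) (use that in auto)
    finally show ?thesis .
  qed
  have "curve_moment q g i (Suc j)
      = (\<Sum>t\<in>?S. \<Sum>s=0..4. q s * (qcoeff q j (t - int s + 1) * g (t + i)))"
    by (simp add: curve_moment_def qcoeff_Suc sum_distrib_right mult.assoc)
  also have "\<dots> = (\<Sum>s=0..4. q s * (\<Sum>t\<in>?S. qcoeff q j (t - int s + 1) * g (t + i)))"
    by (subst sum.swap) (simp add: sum_distrib_left)
  also have "\<dots> = (\<Sum>s=0..4. q s * curve_moment q g (i - 1 + int s) j)"
    by (intro sum.cong refl arg_cong2[where f = "(*)"] *) simp
  finally show ?thesis .
qed

lemma curve_moment_cong:
  assumes "\<And>k. i - int j \<le> k \<Longrightarrow> k \<le> i + 3 * int j \<Longrightarrow> f k = g k"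
  shows "curve_moment q f i j = curve_moment q g i j"
  unfolding curve_moment_def by (rule sum.cong) (auto simp: assms)

text \<open>The extreme coefficients \<open>q 0 ^ j\<close> and \<open>q 4 ^ j\<close> are units, so
  a moment equation can be solved for the lowest or the highest entry of its window i-j..i+3j. The
  construction of \<open>gamma\<close> consists of such solutions.\<close>

lemma curve_moment_split_lowest:
  "curve_moment q g i j
     = q 0 ^ j * g (i - int j) + (\<Sum>t=- int j + 1..3 * int j. qcoeff q j t * g (t + i))"
proof -
  have "{- int j..3 * int j} = insert (- int j) {- int j + 1..3 * int j}" by auto
  then show ?thesis by (simp add: curve_moment_def qcoeff_lowest add.commute)
qed

lemma curve_moment_split_highest:
  "curve_moment q g i j
     = q 4 ^ j * g (i + 3 * int j) + (\<Sum>t=- int j..3 * int j - 1. qcoeff q j t * g (t + i))"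
proof -
  have "{- int j..3 * int j} = insert (3 * int j) {- int j..3 * int j - 1}" by auto
  then show ?thesis by (simp add: curve_moment_def qcoeff_highest add.commute)
qed

section \<open>Existence and uniqueness of the sequence with given moments along the curve\<close>

lemma curve_moment_upd_lowest:
  assumes "q 0 \<noteq> 0"
    and "x = 1 / q 0 ^ k * (b - (\<Sum>t=- int k + 1..3 * int k. qcoeff q k t * g t))"
  shows "curve_moment q (g(- int k := x)) 0 k = b"
  using assms by (simp add: curve_moment_split_lowest)

lemma curve_moment_upd_highest:
  assumes "q 4 = 1" and "m = i + 3 * int k"
    and "x = b - (\<Sum>t=- int k..3 * int k - 1. qcoeff q k t * g (t + i))"
  shows "curve_moment q (g(m := x)) i k = b"
  using assms by (simp add: curve_moment_split_highest)

lemma curve_moment_upd_other: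
  assumes "m < i - int j \<or> i + 3 * int j < m"
  shows "curve_moment q (g(m := x)) i j = curve_moment q g i j"
  by (rule curve_moment_cong) (use assms in auto)

text \<open>Each of the three assignments solves one equation for an extreme entry. A later
  assignment lies outside the windows of the earlier equations; for the first one this needs 3k <
  2n+2k-1, which is where \<open>k \<le> 2 * n - 2\<close> enters.\<close>

lemma gamma_step_moments:
  fixes k n :: nat and q :: "nat \<Rightarrow> real" and \<beta> :: "nat \<Rightarrow> nat \<Rightarrow> real" and g :: "int \<Rightarrow> real"
  assumes q0: "q 0 \<noteq> 0" and q4: "q 4 = 1" and k: "1 \<le> k" "k \<le> 2 * n - 2"
  defines "h \<equiv> gamma_step q \<beta> n k g"
  shows "curve_moment q h 0 k = \<beta> 0 k"
    and "curve_moment q h (2 * int n - int k - 1) k = \<beta> (2 * n - k - 1) k"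
    and "curve_moment q h (2 * int n - int k) k = \<beta> (2 * n - k) k"
    and "\<And>i. - int k < i \<Longrightarrow> i \<le> 2 * int n + 2 * (int k - 1) \<Longrightarrow> h i = g i"
proof -
  define g1 where "g1 = g(- int k :=
           1 / q 0 ^ k * (\<beta> 0 k - (\<Sum>t = - int k + 1..3 * int k. qcoeff q k t * g t)))"
  define g2 where "g2 = g1(2 * int n + 2 * int k - 1 :=
           \<beta> (2 * n - k - 1) k
             - (\<Sum>t = - int k..3 * int k - 1. qcoeff q k t * g1 (t + 2 * int n - int k - 1)))"
  define g3 where "g3 = g2(2 * int n + 2 * int k :=
           \<beta> (2 * n - k) k
             - (\<Sum>t = - int k..3 * int k - 1. qcoeff q k t * g2 (t + 2 * int n - int k)))"
  have h: "h = g3"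
    by (simp only: h_def gamma_step_def g1_def g2_def g3_def Let_def)
  have 1: "curve_moment q g1 0 k = \<beta> 0 k"
    unfolding g1_def by (rule curve_moment_upd_lowest) (simp_all add: q0)
  have 2: "curve_moment q g2 (2 * int n - int k - 1) k = \<beta> (2 * n - k - 1) k"
    unfolding g2_def by (rule curve_moment_upd_highest[where i = "2 * int n - int k - 1"]) (simp_all add: q4 algebra_simps)
  have 3: "curve_moment q g3 (2 * int n - int k) k = \<beta> (2 * n - k) k"
    unfolding g3_def by (rule curve_moment_upd_highest[where i = "2 * int n - int k"]) (simp_all add: q4 algebra_simps)
  show "curve_moment q h 0 k = \<beta> 0 k"
    unfolding h 1[symmetric] g3_def g2_def
    by (subst curve_moment_upd_other, use k in linarith)+ simp
  show "curve_moment q h (2 * int n - int k - 1) k = \<beta> (2 * n - k - 1) k"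
    unfolding h 2[symmetric] g3_def
    by (subst curve_moment_upd_other) (use k in auto)
  show "curve_moment q h (2 * int n - int k) k = \<beta> (2 * n - k) k"
    using 3 h by simp
  show "h i = g i" if "- int k < i" "i \<le> 2 * int n + 2 * (int k - 1)" for i
    using that by (auto simp: h g1_def g2_def g3_def)
qed

lemma gamma0_moments_upto:
  fixes m n :: nat and q :: "nat \<Rightarrow> real" and \<beta> :: "nat \<Rightarrow> nat \<Rightarrow> real"
  assumes q0: "q 0 \<noteq> 0" and q4: "q 4 = 1" and n: "n \<ge> 1" and m: "m \<le> 2 * n - 2"
  defines "G \<equiv> fold (gamma_step q \<beta> n) [1..<Suc m] (gamma_init \<beta> n)"
  shows "(\<forall>i \<le> 2 * n. G (int i) = \<beta> i 0) \<and>
    (\<forall>k. 1 \<le> k \<and> k \<le> m \<longrightarrow>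
       curve_moment q G 0 k = \<beta> 0 k \<and>
       curve_moment q G (2 * int n - int k - 1) k = \<beta> (2 * n - k - 1) k \<and>
       curve_moment q G (2 * int n - int k) k = \<beta> (2 * n - k) k)"
  using m unfolding G_def
proof (induction m)
  case 0
  then show ?case by (auto simp: gamma_init_def)
next
  case (Suc m)
  define G where "G = fold (gamma_step q \<beta> n) [1..<Suc m] (gamma_init \<beta> n)"
  define H where "H = gamma_step q \<beta> n (Suc m) G"
  have eq: "fold (gamma_step q \<beta> n) [1..<Suc (Suc m)] (gamma_init \<beta> n) = H"
    by (simp add: H_def G_def)
  have IH: "\<And>i. i \<le> 2 * n \<Longrightarrow> G (int i) = \<beta> i 0"
    "\<And>k. 1 \<le> k \<Longrightarrow> k \<le> m \<Longrightarrow> curve_moment q G 0 k = \<beta> 0 k"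
    "\<And>k. 1 \<le> k \<Longrightarrow> k \<le> m \<Longrightarrow>
       curve_moment q G (2 * int n - int k - 1) k = \<beta> (2 * n - k - 1) k"
    "\<And>k. 1 \<le> k \<Longrightarrow> k \<le> m \<Longrightarrow> curve_moment q G (2 * int n - int k) k = \<beta> (2 * n - k) k"
    using Suc unfolding G_def by auto
  have "1 \<le> Suc m" by simp
  note step = gamma_step_moments[OF q0 q4 this Suc.prems, where \<beta> = \<beta> and g = G, folded H_def]
  have same: "H i = G i" if "- int m \<le> i" "i \<le> 2 * int n + 2 * int m" for i
    using that by (intro step(4)) auto
  \<comment> \<open>For k up to m the windows of all three equations lie in -m..2n+2m, which the new
    step leaves untouched.\<close>
  have cm: "curve_moment q H i k = curve_moment q G i k"
    if "- int m \<le> i - int k" "i + 3 * int k \<le> 2 * int n + 2 * int m" for i k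
    by (rule curve_moment_cong) (use that in \<open>auto intro: same\<close>)
  have "curve_moment q H 0 k = \<beta> 0 k \<and>
       curve_moment q H (2 * int n - int k - 1) k = \<beta> (2 * n - k - 1) k \<and>
       curve_moment q H (2 * int n - int k) k = \<beta> (2 * n - k) k" if "1 \<le> k" "k \<le> Suc m" for k
  proof (cases "k = Suc m")
    case True
    then show ?thesis using step(1-3) by simp
  next
    case False
    then have k: "1 \<le> k" "k \<le> m" using that by auto
    then show ?thesis
      using Suc.prems IH(2-4)[of k] by (subst (1 2 3) cm) auto
  qed
  moreover have "H (int i) = \<beta> i 0" if "i \<le> 2 * n" for i
    using that IH(1)[OF that] by (subst same) auto
  ultimately show ?case unfolding eq by blast
qed

text \<open>These equations hold by assignment, whatever the parameters: the two axes, and the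
  degrees 2n-1 and 2n. They are exactly the exponents that the recurrence of \<open>\<beta>\<close>
  does not reach.\<close>

lemma gamma_boundary_moments:
  fixes n :: nat and q :: "nat \<Rightarrow> real" and \<beta> :: "nat \<Rightarrow> nat \<Rightarrow> real" and t1 t2 t3 :: real
  assumes q0: "q 0 \<noteq> 0" and q4: "q 4 = 1" and n: "n \<ge> 1"
  defines "G \<equiv> gamma q \<beta> n t1 t2 t3"
  shows "\<And>i. i \<le> 2 * n \<Longrightarrow> G (int i) = \<beta> i 0"
    and "\<And>k. 1 \<le> k \<Longrightarrow> k \<le> 2 * n \<Longrightarrow> curve_moment q G 0 k = \<beta> 0 k"
    and "\<And>k. 1 \<le> k \<Longrightarrow> k \<le> 2 * n - 2 \<Longrightarrow>
       curve_moment q G (2 * int n - int k - 1) k = \<beta> (2 * n - k - 1) k"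
    and "\<And>k. 1 \<le> k \<Longrightarrow> k \<le> 2 * n - 1 \<Longrightarrow>
       curve_moment q G (2 * int n - int k) k = \<beta> (2 * n - k) k"
proof -
  define G0 where "G0 = gamma0 q \<beta> n"
  have eq0: "G0 = fold (gamma_step q \<beta> n) [1..<Suc (2 * n - 2)] (gamma_init \<beta> n)"
  proof -
    have "2 * n - 1 = Suc (2 * n - 2)" using n by simp
    then show ?thesis by (simp only: G0_def gamma0_def)
  qed
  note G0 = gamma0_moments_upto[OF q0 q4 n order_refl, where \<beta> = \<beta>, folded eq0]
  define g where "g = G0(6 * int n - 3 := t1)"
  define g1 where "g1 = g(- 2 * int n + 1 :=
           1 / q 0 ^ (2 * n - 1) * (\<beta> 0 (2 * n - 1)
             - (\<Sum>t = - 2 * int n + 2..6 * int n - 3. qcoeff q (2 * n - 1) t * g t)))"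
  define g2 where "g2 = g1(6 * int n - 2 :=
           \<beta> 1 (2 * n - 1)
             - (\<Sum>t = - 2 * int n + 1..6 * int n - 4. qcoeff q (2 * n - 1) t * g1 (t + 1)))"
  \<comment> \<open>The entries 6n-1 and 6n occur only in the window of the equation for
    \<open>\<beta> 0 (2 * n)\<close>, which is afterwards solved for the entry -2n. This is why
    \<open>t2\<close> and \<open>t3\<close> stay free.\<close>
  define g3 where "g3 = g2(6 * int n - 1 := t2, 6 * int n := t3)"
  define g4 where "g4 = g3(- 2 * int n :=
           1 / q 0 ^ (2 * n) * (\<beta> 0 (2 * n)
             - (\<Sum>t = - 2 * int n + 1..6 * int n. qcoeff q (2 * n) t * g3 t)))"
  have G: "G = g4"
    by (simp add: G_def gamma_def gamma1_def Let_def g_def g1_def g2_def g3_def g4_def G0_def)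
  have int1: "int (2 * n - 1) = 2 * int n - 1" using n by (simp add: of_nat_diff)
  have 1: "curve_moment q g1 0 (2 * n - 1) = \<beta> 0 (2 * n - 1)"
  proof -
    have *: "- 2 * int n + 1 = - int (2 * n - 1)" using int1 by simp
    have **: "- 2 * int n + 2 = - int (2 * n - 1) + 1" "6 * int n - 3 = 3 * int (2 * n - 1)"
      using int1 by simp_all
    show ?thesis
      unfolding g1_def * **
      by (rule curve_moment_upd_lowest) (simp_all add: q0)
  qed
  have 2: "curve_moment q g2 1 (2 * n - 1) = \<beta> 1 (2 * n - 1)"
    unfolding g2_def
    by (rule curve_moment_upd_highest[where i = 1]) (use q4 in \<open>simp_all only: int1, simp_all add: algebra_simps\<close>)
  have 3: "curve_moment q g4 0 (2 * n) = \<beta> 0 (2 * n)"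
  proof -
    have *: "- 2 * int n = - int (2 * n)" by simp
    show ?thesis
      unfolding g4_def *
      by (rule curve_moment_upd_lowest) (simp_all add: q0)
  qed
  have same: "G i = G0 i" if "- 2 * int n + 2 \<le> i" "i \<le> 6 * int n - 4" for i
    using that by (simp add: G g_def g1_def g2_def g3_def g4_def)
  have same1: "G i = g1 i" if "- 2 * int n + 1 \<le> i" "i \<le> 6 * int n - 3" for i
    using that by (simp add: G g2_def g3_def g4_def)
  have same2: "G i = g2 i" if "- 2 * int n + 1 \<le> i" "i \<le> 6 * int n - 2" for i
    using that by (simp add: G g3_def g4_def)
  have cm: "curve_moment q G i k = curve_moment q G0 i k"
    if "- 2 * int n + 2 \<le> i - int k" "i + 3 * int k \<le> 6 * int n - 4" for i k
    by (rule curve_moment_cong) (use that in \<open>auto intro: same\<close>)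
  show init: "G (int i) = \<beta> i 0" if "i \<le> 2 * n" for i
  proof (cases "n = 1")
    case True
    then have "G0 = gamma_init \<beta> n" by (simp add: eq0)
    moreover have "G (int i) = G0 (int i)"
      using that True by (simp add: G g_def g1_def g2_def g3_def g4_def)
    ultimately show ?thesis using that by (simp add: gamma_init_def)
  next
    case False
    then show ?thesis using that n G0 by (subst same) auto
  qed
  show "curve_moment q G 0 k = \<beta> 0 k" if k: "1 \<le> k" "k \<le> 2 * n" for k
  proof -
    consider "k \<le> 2 * n - 2" | "k = 2 * n - 1" | "k = 2 * n" using k by linarith
    then show ?thesis
    proof cases
      case 1
      then show ?thesis using G0 k n by (subst cm) auto
    next
      case 2
      have "curve_moment q G 0 k = curve_moment q g1 0 k"
        by (rule curve_moment_cong) (use 2 int1 in \<open>auto intro!: same1\<close>)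
      then show ?thesis using 1 2 by simp
    next
      case 3
      then show ?thesis using \<open>curve_moment q g4 0 (2 * n) = _\<close> G by simp
    qed
  qed
  show "curve_moment q G (2 * int n - int k - 1) k = \<beta> (2 * n - k - 1) k"
    if k: "1 \<le> k" "k \<le> 2 * n - 2" for k
    using k G0 n by (subst cm) auto
  show "curve_moment q G (2 * int n - int k) k = \<beta> (2 * n - k) k"
    if k: "1 \<le> k" "k \<le> 2 * n - 1" for k
  proof (cases "k = 2 * n - 1")
    case True
    have "curve_moment q G 1 k = curve_moment q g2 1 k"
      by (rule curve_moment_cong) (use True int1 in \<open>auto intro!: same2\<close>)
    then show ?thesis using 2 True n int1 by simp
  next
    case False
    then show ?thesis using k G0 n by (subst cm) auto
  qed
qed

text \<open>Away from the axes and below degree 2n-1, the recurrence of \<open>\<beta>\<close> and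
  \<open>curve_moment_Suc\<close> are the same recurrence, so induction on j fills in what the
  assignments leave open.\<close>

lemma gamma_moments:
  fixes n :: nat
  assumes q0: "q 0 \<noteq> 0" and q4: "q 4 = 1" and n: "n \<ge> 1"
    and beta_rec: "\<And>i j. i \<ge> 1 \<Longrightarrow> j \<ge> 1 \<Longrightarrow> i + j \<le> 2 * n - 2 \<Longrightarrow>
          \<beta> i j = (\<Sum>s=0..4. q s * \<beta> (i - 1 + s) (j - 1))"
    and "i + j \<le> 2 * n"
  shows "curve_moment q (gamma q \<beta> n t1 t2 t3) (int i) j = \<beta> i j"
  using \<open>i + j \<le> 2 * n\<close>
proof (induction j arbitrary: i)
  case 0
  then show ?case using gamma_boundary_moments(1)[OF q0 q4 n] by simp
next
  case (Suc j)
  note B = gamma_boundary_moments[OF q0 q4 n]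
  consider "i = 0" | "i \<ge> 1" "i + Suc j = 2 * n - 1" | "i \<ge> 1" "i + Suc j = 2 * n"
    | "i \<ge> 1" "i + Suc j \<le> 2 * n - 2"
    using Suc.prems by linarith
  then show ?case
  proof cases
    case 1
    then show ?thesis using Suc.prems B(2)[of "Suc j"] by simp
  next
    case 2
    then have "int i = 2 * int n - int (Suc j) - 1" "i = 2 * n - Suc j - 1" by auto
    moreover have "1 \<le> Suc j" "Suc j \<le> 2 * n - 2" using 2 by auto
    note B(3)[OF this, of \<beta> t1 t2 t3]
    ultimately show ?thesis by metis
  next
    case 3
    then have "int i = 2 * int n - int (Suc j)" "i = 2 * n - Suc j" by auto
    then show ?thesis using 3 B(4)[of "Suc j"] by simp
  next
    case 4
    have "curve_moment q (gamma q \<beta> n t1 t2 t3) (int i - 1 + int s) j = \<beta> (i - 1 + s) j"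
      if "s \<le> 4" for s
    proof -
      have "int i - 1 + int s = int (i - 1 + s)" using 4 by simp
      then show ?thesis using Suc.IH[of "i - 1 + s"] 4 that by (simp only:)
    qed
    then show ?thesis
      using beta_rec[of i "Suc j"] 4 by (simp add: curve_moment_Suc)
  qed
qed

text \<open>The homogeneous version of the construction. In the order in which \<open>gamma\<close>
  is built, every entry is the extreme one of an equation whose other entries are already known to
  vanish, and its coefficient is a unit.\<close>

lemma curve_moment_kernel_trivial:
  fixes n :: nat and h :: "int \<Rightarrow> real"
  assumes q0: "q 0 \<noteq> 0" and q4: "q 4 = 1" and n: "n \<ge> 1"
    and zero: "\<And>i j. i + j \<le> 2 * n \<Longrightarrow> curve_moment q h (int i) j = 0"
    and params: "h (6 * int n - 3) = 0" "h (6 * int n - 1) = 0" "h (6 * int n) = 0"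
    and k: "- 2 * int n \<le> k" "k \<le> 6 * int n"
  shows "h k = 0"
proof -
  have low: "h (- int j) = 0" if "j \<le> 2 * n" "\<And>t. - int j < t \<Longrightarrow> t \<le> 3 * int j \<Longrightarrow> h t = 0" for j
    using zero[of 0 j] that q0 by (simp add: curve_moment_split_lowest sum.neutral)
  have high: "h (int i + 3 * int j) = 0"
    if "i + j \<le> 2 * n" "\<And>t. int i - int j \<le> t \<Longrightarrow> t < int i + 3 * int j \<Longrightarrow> h t = 0" for i j
    using zero[of i j] that q4 by (simp add: curve_moment_split_highest sum.neutral)
  have base: "h t = 0" if "0 \<le> t" "t \<le> 2 * int n" for t
    using zero[of "nat t" 0] that by simp
  have main: "\<forall>t. - int m \<le> t \<and> t \<le> 2 * int n + 2 * int m \<longrightarrow> h t = 0" if "m \<le> 2 * n - 2" for m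
    using that
  proof (induction m)
    case 0
    then show ?case using base by simp
  next
    case (Suc m)
    then have IH: "\<And>t. - int m \<le> t \<Longrightarrow> t \<le> 2 * int n + 2 * int m \<Longrightarrow> h t = 0" by simp
    have 1: "h (- int (Suc m)) = 0"
      by (rule low) (use Suc.prems in \<open>auto intro!: IH\<close>)
    then have IH1: "h t = 0" if "- int m - 1 \<le> t" "t \<le> 2 * int n + 2 * int m" for t
      using that IH[of t] by (cases "t = - int (Suc m)") auto
    have "h (int (2 * n - Suc m - 1) + 3 * int (Suc m)) = 0"
      by (rule high) (use Suc.prems in \<open>auto intro!: IH1\<close>)
    then have 2: "h (2 * int n + 2 * int m + 1) = 0"
      using Suc.prems by (simp add: of_nat_diff algebra_simps)
    then have IH2: "h t = 0" if "- int m - 1 \<le> t" "t \<le> 2 * int n + 2 * int m + 1" for t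
      using that IH1[of t] by (cases "t = 2 * int n + 2 * int m + 1") auto
    have "h (int (2 * n - Suc m) + 3 * int (Suc m)) = 0"
      by (rule high) (use Suc.prems in \<open>auto intro!: IH2\<close>)
    then have 3: "h (2 * int n + 2 * int m + 2) = 0"
      using Suc.prems by (simp add: of_nat_diff algebra_simps)
    show ?case
    proof (intro allI impI)
      fix t assume "- int (Suc m) \<le> t \<and> t \<le> 2 * int n + 2 * int (Suc m)"
      then show "h t = 0"
        using IH2[of t] 3 by (cases "t = 2 * int n + 2 * int m + 2") auto
    qed
  qed
  have m: "h t = 0" if "- 2 * int n + 2 \<le> t" "t \<le> 6 * int n - 3" for t
    using that main[of "2 * n - 2"] n params(1) by (cases "t = 6 * int n - 3") auto
  have "h (- int (2 * n - 1)) = 0"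
    by (rule low) (use n in \<open>auto intro!: m\<close>)
  then have "h (- 2 * int n + 1) = 0" using n by (simp add: of_nat_diff)
  then have m1: "h t = 0" if "- 2 * int n + 1 \<le> t" "t \<le> 6 * int n - 3" for t
    using that m[of t] by (cases "t = - 2 * int n + 1") auto
  have "h (int 1 + 3 * int (2 * n - 1)) = 0"
    by (rule high) (use n in \<open>auto intro!: m1\<close>)
  then have "h (6 * int n - 2) = 0" using n by (simp add: of_nat_diff)
  then have m2: "h t = 0" if "- 2 * int n + 1 \<le> t" "t \<le> 6 * int n" for t
    using that m1[of t] params
    by (cases "t = 6 * int n - 2"; cases "t = 6 * int n - 1"; cases "t = 6 * int n") auto
  have "h (- int (2 * n)) = 0"
    by (rule low) (use n in \<open>auto intro!: m2\<close>)
  then show ?thesis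
    using k m2[of k] by (cases "k = - 2 * int n") auto
qed

text \<open>The difference of two solutions of the moment equations that agree in the three free
  places lies in the trivial kernel. For the moments of a measure this recovers the whole sequence
  from three of them.\<close>

lemma gamma_unique:
  fixes n :: nat
  assumes q0: "q 0 \<noteq> 0" and q4: "q 4 = 1" and n: "n \<ge> 1"
    and beta_rec: "\<And>i j. i \<ge> 1 \<Longrightarrow> j \<ge> 1 \<Longrightarrow> i + j \<le> 2 * n - 2 \<Longrightarrow>
          \<beta> i j = (\<Sum>s=0..4. q s * \<beta> (i - 1 + s) (j - 1))"
    and m: "\<And>i j. i + j \<le> 2 * n \<Longrightarrow> curve_moment q m (int i) j = \<beta> i j"
    and k: "- 2 * int n \<le> k" "k \<le> 6 * int n"
  shows "gamma q \<beta> n (m (6 * int n - 3)) (m (6 * int n - 1)) (m (6 * int n)) k = m k"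
proof -
  let ?G = "gamma q \<beta> n (m (6 * int n - 3)) (m (6 * int n - 1)) (m (6 * int n))"
  have "?G k - m k = 0"
  proof (rule curve_moment_kernel_trivial[OF q0 q4 n, where h = "\<lambda>k. ?G k - m k"])
    show "curve_moment q (\<lambda>k. ?G k - m k) (int i) j = 0" if "i + j \<le> 2 * n" for i j
    proof -
      have "curve_moment q (\<lambda>k. ?G k - m k) (int i) j
          = curve_moment q ?G (int i) j - curve_moment q m (int i) j"
        by (simp add: curve_moment_def algebra_simps sum_subtractf)
      then show ?thesis
        using m[OF that] gamma_moments[where \<beta> = \<beta>, OF q0 q4 n beta_rec that] by simp
    qed
  qed (use k n in \<open>auto simp: gamma_def gamma1_def Let_def\<close>)
  then show ?thesis by simp
qed

section \<open>Quadratic forms and bordering\<close>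

text \<open>Forms are indexed by sets of labels instead of matrix positions, so that a label can be
  added at either end and a block cut out without shifting indices. Symmetry is not built in and is
  assumed where it is needed.\<close>

definition bil :: "('a \<Rightarrow> 'a \<Rightarrow> real) \<Rightarrow> 'a set \<Rightarrow> ('a \<Rightarrow> real) \<Rightarrow> ('a \<Rightarrow> real) \<Rightarrow> real" where
  "bil h S a b = (\<Sum>i\<in>S. a i * (\<Sum>j\<in>S. h i j * b j))"

definition psd_on :: "('a \<Rightarrow> 'a \<Rightarrow> real) \<Rightarrow> 'a set \<Rightarrow> bool" where
  "psd_on h S \<longleftrightarrow> (\<forall>a. bil h S a a \<ge> 0)"

definition pd_on :: "('a \<Rightarrow> 'a \<Rightarrow> real) \<Rightarrow> 'a set \<Rightarrow> bool" where
  "pd_on h S \<longleftrightarrow> (\<forall>a. (\<exists>i\<in>S. a i \<noteq> 0) \<longrightarrow> bil h S a a > 0)"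

lemma bil_cong:
  assumes "\<And>i. i \<in> S \<Longrightarrow> a i = a' i" "\<And>i. i \<in> S \<Longrightarrow> b i = b' i"
    and "\<And>i j. i \<in> S \<Longrightarrow> j \<in> S \<Longrightarrow> h i j = h' i j"
  shows "bil h S a b = bil h' S a' b'"
  unfolding bil_def by (intro sum.cong refl arg_cong2[where f = "(*)"]) (use assms in auto)

lemma bil_sym:
  assumes "\<And>i j. h i j = h j i"
  shows "bil h S a b = bil h S b a"
proof -
  have "bil h S a b = (\<Sum>i\<in>S. \<Sum>j\<in>S. a i * (h i j * b j))"
    by (simp add: bil_def sum_distrib_left)
  also have "\<dots> = (\<Sum>j\<in>S. \<Sum>i\<in>S. a i * (h i j * b j))" by (rule sum.swap)
  also have "\<dots> = bil h S b a"
    unfolding bil_def sum_distrib_left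
    by (intro sum.cong refl) (metis assms mult.commute mult.left_commute)
  finally show ?thesis .
qed

lemma bil_add_left: "bil h S (\<lambda>i. a i + b i) c = bil h S a c + bil h S b c"
  by (simp add: bil_def distrib_right sum.distrib)

lemma bil_scale_left: "bil h S (\<lambda>i. t * a i) c = t * bil h S a c"
  by (simp add: bil_def sum_distrib_left mult.assoc)

lemma bil_add_right: "bil h S a (\<lambda>i. b i + c i) = bil h S a b + bil h S a c"
  by (simp add: bil_def distrib_left sum.distrib)

lemma bil_scale_right: "bil h S a (\<lambda>i. t * b i) = t * bil h S a b"
  by (simp add: bil_def sum_distrib_left mult.left_commute)

lemma bil_mono_neutral:
  assumes "finite T" "S \<subseteq> T" "\<And>i. i \<in> T - S \<Longrightarrow> a i = 0" "\<And>i. i \<in> T - S \<Longrightarrow> b i = 0"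
  shows "bil h T a b = bil h S a b"
proof -
  have "(\<Sum>j\<in>T. h i j * b j) = (\<Sum>j\<in>S. h i j * b j)" for i
    by (rule sum.mono_neutral_right) (use assms in auto)
  then show ?thesis
    unfolding bil_def by (simp, intro sum.mono_neutral_right) (use assms in auto)
qed

lemma psd_on_subset:
  assumes "psd_on h T" "S \<subseteq> T" "finite T"
  shows "psd_on h S"
  unfolding psd_on_def
proof
  fix a :: "'a \<Rightarrow> real"
  define b where "b = (\<lambda>i. if i \<in> S then a i else 0)"
  have "bil h S a a = bil h S b b" by (rule bil_cong) (auto simp: b_def)
  also have "\<dots> = bil h T b b"
    by (rule bil_mono_neutral[symmetric]) (use assms in \<open>auto simp: b_def\<close>)
  finally show "bil h S a a \<ge> 0" using assms(1) by (simp add: psd_on_def)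
qed

lemma pd_on_imp_psd_on: "pd_on h S \<Longrightarrow> psd_on h S"
  unfolding pd_on_def psd_on_def
proof (intro allI)
  fix a assume *: "\<forall>a. (\<exists>i\<in>S. a i \<noteq> 0) \<longrightarrow> bil h S a a > 0"
  show "bil h S a a \<ge> 0"
  proof (cases "\<exists>i\<in>S. a i \<noteq> 0")
    case False
    then have "bil h S a a = 0" by (auto simp: bil_def intro: sum.neutral)
    then show ?thesis by simp
  qed (use * in \<open>auto intro: less_imp_le\<close>)
qed

text \<open>Perturb the null vector by t times a unit vector: the form becomes 2tr + t^2 m, with r
  the entry in question. Nonnegativity for every t forces r = 0.\<close>

lemma psd_on_kernel:
  assumes psd: "psd_on h S" and sym: "\<And>i j. h i j = h j i" and "finite S"
    and zero: "bil h S a a = 0" and i: "i \<in> S"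
  shows "(\<Sum>j\<in>S. h i j * a j) = 0"
proof -
  define e where "e = (\<lambda>j. if j = i then 1 else (0::real))"
  define r where "r = bil h S e a"
  have r: "r = (\<Sum>j\<in>S. h i j * a j)"
    using i \<open>finite S\<close> by (simp add: r_def bil_def e_def if_distrib[of "\<lambda>x. x * _"] cong: if_cong)
  have "0 \<le> 2 * t * r + t\<^sup>2 * bil h S e e" for t
  proof -
    have "0 \<le> bil h S (\<lambda>i. a i + t * e i) (\<lambda>i. a i + t * e i)"
      using psd by (simp add: psd_on_def)
    also have "\<dots> = 2 * t * r + t\<^sup>2 * bil h S e e"
      using zero bil_sym[of h S a e, OF sym]
      by (simp add: bil_add_left bil_add_right bil_scale_left bil_scale_right r_def
          power2_eq_square algebra_simps)
    finally show ?thesis .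
  qed
  note ineq = this
  define m where "m = bil h S e e"
  have "m \<ge> 0" using psd by (simp add: psd_on_def m_def)
  \<comment> \<open>At t = -s the form is -s^2 (m+2). Dividing by m+1 instead of m covers m = 0 as
    well.\<close>
  define s where "s = r / (m + 1)"
  have rs: "r = s * (m + 1)" using \<open>m \<ge> 0\<close> by (simp add: s_def)
  have "0 \<le> 2 * (- s) * r + (- s)\<^sup>2 * m"
    using ineq[of "- s"] by (simp add: m_def)
  also have "\<dots> = - (s\<^sup>2 * (m + 2))"
    by (simp add: rs power2_eq_square algebra_simps)
  finally have "s = 0" using \<open>m \<ge> 0\<close> by (simp add: mult_le_0_iff)
  then have "r = 0" by (simp add: rs)
  then show ?thesis using r by simp
qed

section \<open>Bordering a form by one label\<close>

lemma bil_insert: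
  assumes "finite S" "k \<notin> S"
  shows "bil h (insert k S) a b
    = bil h S a b + (\<Sum>i\<in>S. a i * h i k) * b k + a k * (\<Sum>i\<in>S. h k i * b i) + a k * h k k * b k"
  using assms
  by (simp add: bil_def distrib_left sum.distrib sum_distrib_right sum_distrib_left algebra_simps)

text \<open>Completing the square in the new coordinate. Any solution \<open>u\<close> of the system
  with right-hand side column k serves in place of an inverse matrix, and the last factor is the
  Schur complement.\<close>

lemma border_complete_square:
  assumes S: "finite S" "k \<notin> S" and sym: "\<And>i j. h i j = h j i"
    and u: "\<And>i. i \<in> S \<Longrightarrow> (\<Sum>j\<in>S. h i j * u j) = h i k"
  shows "bil h (insert k S) a b
    = bil h S (\<lambda>i. a i + a k * u i) (\<lambda>i. b i + b k * u i)
      + a k * b k * (h k k - (\<Sum>i\<in>S. h i k * u i))"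
proof -
  have au: "bil h S a u = (\<Sum>i\<in>S. a i * h i k)" for a
    unfolding bil_def by (intro sum.cong) (auto simp: u)
  have ub: "bil h S u b = (\<Sum>i\<in>S. h k i * b i)"
    using bil_sym[of h S u b, OF sym] au[of b] sym[of k] by (simp add: mult.commute)
  have uu: "bil h S u u = (\<Sum>i\<in>S. h i k * u i)"
    using au[of u] by (simp add: mult.commute)
  show ?thesis
    unfolding bil_insert[OF S] bil_add_left bil_add_right bil_scale_left bil_scale_right au ub uu
    using au[of u] uu by (simp add: algebra_simps)
qed

text \<open>The vector (-u, 1) annihilates the square over S, so pairing with it isolates the Schur
  complement.\<close>

lemma border_witness:
  fixes h :: "'a \<Rightarrow> 'a \<Rightarrow> real"
  assumes S: "finite S" "k \<notin> S" and sym: "\<And>i j. h i j = h j i"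
    and u: "\<And>i. i \<in> S \<Longrightarrow> (\<Sum>j\<in>S. h i j * u j) = h i k"
  shows "bil h (insert k S) b (\<lambda>i. if i = k then 1 else - u i)
     = b k * (h k k - (\<Sum>i\<in>S. h i k * u i))"
proof -
  have "bil h S (\<lambda>i. b i + b k * u i)
          (\<lambda>i. (if i = k then 1 else - u i) + (if k = k then 1 else - u k) * u i)
      = bil h S (\<lambda>i. b i + b k * u i) (\<lambda>i. 0)"
    by (rule bil_cong) (use S in auto)
  also have "\<dots> = 0" by (simp add: bil_def)
  finally show ?thesis
    by (subst border_complete_square[OF S sym u]) auto
qed

lemma border_psd_iff:
  fixes h :: "'a \<Rightarrow> 'a \<Rightarrow> real"
  assumes S: "finite S" "k \<notin> S" and sym: "\<And>i j. h i j = h j i" and pd: "pd_on h S"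
    and u: "\<And>i. i \<in> S \<Longrightarrow> (\<Sum>j\<in>S. h i j * u j) = h i k"
  shows "psd_on h (insert k S) \<longleftrightarrow> (\<Sum>i\<in>S. h i k * u i) \<le> h k k"
proof
  assume "psd_on h (insert k S)"
  then have "0 \<le> bil h (insert k S) (\<lambda>i. if i = k then 1 else - u i) (\<lambda>i. if i = k then 1 else - u i)"
    by (simp add: psd_on_def)
  then show "(\<Sum>i\<in>S. h i k * u i) \<le> h k k"
    by (simp add: border_witness[OF S sym u])
next
  assume *: "(\<Sum>i\<in>S. h i k * u i) \<le> h k k"
  show "psd_on h (insert k S)"
    unfolding psd_on_def
  proof
    fix a
    have "bil h (insert k S) a a
      = bil h S (\<lambda>i. a i + a k * u i) (\<lambda>i. a i + a k * u i)
        + a k * a k * (h k k - (\<Sum>i\<in>S. h i k * u i))"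
      by (rule border_complete_square[OF S sym u])
    then show "0 \<le> bil h (insert k S) a a"
      using pd_on_imp_psd_on[OF pd] * by (auto simp: psd_on_def intro!: add_nonneg_nonneg)
  qed
qed

lemma border_pd_iff:
  fixes h :: "'a \<Rightarrow> 'a \<Rightarrow> real"
  assumes S: "finite S" "k \<notin> S" and sym: "\<And>i j. h i j = h j i" and pd: "pd_on h S"
    and u: "\<And>i. i \<in> S \<Longrightarrow> (\<Sum>j\<in>S. h i j * u j) = h i k"
  shows "pd_on h (insert k S) \<longleftrightarrow> (\<Sum>i\<in>S. h i k * u i) < h k k"
proof
  assume "pd_on h (insert k S)"
  then have "0 < bil h (insert k S) (\<lambda>i. if i = k then 1 else - u i) (\<lambda>i. if i = k then 1 else - u i)"
    by (simp add: pd_on_def)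
  then show "(\<Sum>i\<in>S. h i k * u i) < h k k"
    by (simp add: border_witness[OF S sym u])
next
  assume *: "(\<Sum>i\<in>S. h i k * u i) < h k k"
  show "pd_on h (insert k S)"
    unfolding pd_on_def
  proof (intro allI impI)
    fix a :: "'a \<Rightarrow> real" assume a: "\<exists>i\<in>insert k S. a i \<noteq> 0"
    have nonneg: "bil h S b b \<ge> 0" for b
      using pd_on_imp_psd_on[OF pd] by (simp add: psd_on_def)
    show "bil h (insert k S) a a > 0"
    proof (cases "a k = 0")
      case True
      then have "bil h S a a > 0" using a pd by (auto simp: pd_on_def)
      then show ?thesis using True by (simp add: border_complete_square[OF S sym u])
    next
      case False
      then have "a k * a k * (h k k - (\<Sum>i\<in>S. h i k * u i)) > 0"
        using * by (intro mult_pos_pos[of "a k * a k"]) (auto simp flip: power2_eq_square)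
      then show ?thesis
        using nonneg by (simp add: border_complete_square[OF S sym u] add_nonneg_pos)
    qed
  qed
qed

text \<open>Pairing a kernel vector with (-u, 1) gives its new coordinate times the Schur
  complement, and that coordinate is nonzero since the form on S is definite. Conversely, when the
  complement vanishes, (-u, 1) is a null vector of a semidefinite form. This stands in for a
  determinant formula.\<close>

lemma border_singular_iff:
  fixes h :: "'a \<Rightarrow> 'a \<Rightarrow> real"
  assumes S: "finite S" "k \<notin> S" and sym: "\<And>i j. h i j = h j i" and pd: "pd_on h S"
    and u: "\<And>i. i \<in> S \<Longrightarrow> (\<Sum>j\<in>S. h i j * u j) = h i k"
  shows "(\<exists>a. (\<exists>i\<in>insert k S. a i \<noteq> 0) \<and> (\<forall>i\<in>insert k S. (\<Sum>j\<in>insert k S. h i j * a j) = 0))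
     \<longleftrightarrow> h k k = (\<Sum>i\<in>S. h i k * u i)"
proof
  assume "\<exists>a. (\<exists>i\<in>insert k S. a i \<noteq> 0) \<and> (\<forall>i\<in>insert k S. (\<Sum>j\<in>insert k S. h i j * a j) = 0)"
  then obtain a where a: "\<exists>i\<in>insert k S. a i \<noteq> 0"
    and ker: "\<And>i. i \<in> insert k S \<Longrightarrow> (\<Sum>j\<in>insert k S. h i j * a j) = 0" by blast
  have zero: "bil h (insert k S) b a = 0" for b
    unfolding bil_def by (intro sum.neutral) (simp add: ker del: sum.insert)
  have "a k * (h k k - (\<Sum>i\<in>S. h i k * u i)) = 0"
    using border_witness[OF S sym u, of a] zero bil_sym[of h, OF sym] by metis
  moreover have "a k \<noteq> 0"
  proof
    assume "a k = 0"
    then have "bil h S a a = 0"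
      using zero[of a] by (simp add: border_complete_square[OF S sym u])
    then show False using pd a \<open>a k = 0\<close> by (force simp: pd_on_def)
  qed
  ultimately show "h k k = (\<Sum>i\<in>S. h i k * u i)" by simp
next
  assume eq: "h k k = (\<Sum>i\<in>S. h i k * u i)"
  let ?a = "\<lambda>i. if i = k then 1 else - u i"
  have "psd_on h (insert k S)" by (simp add: border_psd_iff[OF S sym pd u] eq)
  moreover have "bil h (insert k S) ?a ?a = 0" by (simp add: border_witness[OF S sym u] eq)
  ultimately have "\<forall>i\<in>insert k S. (\<Sum>j\<in>insert k S. h i j * ?a j) = 0"
    using S(1) by (intro ballI psd_on_kernel[where a = ?a, OF _ sym]) auto
  then show "\<exists>a. (\<exists>i\<in>insert k S. a i \<noteq> 0) \<and> (\<forall>i\<in>insert k S. (\<Sum>j\<in>insert k S. h i j * a j) = 0)"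
    by (intro exI[of _ ?a]) auto
qed

text \<open>Solves the system over \<open>insert k0 S\<close> from two solutions over S, as in block
  elimination. The resulting value is the closed form hidden in the expressions \<Phi> and
  \<Psi>.\<close>

lemma border_two_level:
  fixes h :: "'a \<Rightarrow> 'a \<Rightarrow> real"
  assumes S: "finite S" "k0 \<notin> S" and sym: "\<And>i j. h i j = h j i"
    and p: "\<And>i. i \<in> S \<Longrightarrow> (\<Sum>j\<in>S. h i j * p j) = h i k0"
    and y: "\<And>i. i \<in> S \<Longrightarrow> (\<Sum>j\<in>S. h i j * y j) = h i k"
    and w: "w = h k0 k0 - (\<Sum>i\<in>S. h i k0 * p i)" "w \<noteq> 0"
  obtains u where
    "\<And>i. i \<in> insert k0 S \<Longrightarrow> (\<Sum>j\<in>insert k0 S. h i j * u j) = h i k"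
    "(\<Sum>i\<in>insert k0 S. h i k * u i)
       = (\<Sum>i\<in>S. h i k * y i) + (h k0 k - (\<Sum>i\<in>S. h i k0 * y i))\<^sup>2 / w"
proof -
  define s where "s = (\<Sum>i\<in>S. h i k0 * y i)"
  \<comment> \<open>Row k0 of the system, after elimination of S, reads w x = h k0 k - s.\<close>
  define x where "x = (h k0 k - s) / w"
  define u where "u = (\<lambda>i. if i = k0 then x else y i - x * p i)"
  have u_S: "(\<Sum>j\<in>S. f j * u j) = (\<Sum>j\<in>S. f j * y j) - x * (\<Sum>j\<in>S. f j * p j)" for f
  proof -
    have "(\<Sum>j\<in>S. f j * u j) = (\<Sum>j\<in>S. f j * y j - x * (f j * p j))"
      by (rule sum.cong) (use S in \<open>auto simp: u_def algebra_simps\<close>)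
    then show ?thesis by (simp add: sum_subtractf sum_distrib_left)
  qed
  \<comment> \<open>Both sums are the value of the symmetric form at p and y.\<close>
  have "bil h S p y = (\<Sum>i\<in>S. h i k * p i)" "bil h S y p = s"
    unfolding bil_def s_def using p y by (simp_all add: mult.commute cong: sum.cong)
  then have hp: "(\<Sum>i\<in>S. h i k * p i) = s" using bil_sym[of h S p y, OF sym] by simp
  have "(\<Sum>j\<in>insert k0 S. h i j * u j) = h i k" if "i \<in> insert k0 S" for i
  proof (cases "i = k0")
    case True
    have flip: "(\<Sum>j\<in>S. h k0 j * f j) = (\<Sum>j\<in>S. h j k0 * f j)" for f
      by (intro sum.cong refl arg_cong2[where f = "(*)"] sym)
    have "(\<Sum>j\<in>S. h k0 j * y j) = s" "(\<Sum>j\<in>S. h k0 j * p j) = h k0 k0 - w"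
      using w by (simp_all add: s_def flip)
    then have "(\<Sum>j\<in>insert k0 S. h i j * u j) = h k0 k0 * x + (s - x * (h k0 k0 - w))"
      using S True by (simp add: u_S) (simp add: u_def)
    also have "\<dots> = h k0 k" using w(2) by (simp add: x_def field_simps)
    finally show ?thesis using True by simp
  next
    case False
    then have "i \<in> S" using that by simp
    then have "(\<Sum>j\<in>insert k0 S. h i j * u j) = h i k0 * x + (h i k - x * h i k0)"
      using S by (simp add: u_S p y) (simp add: u_def)
    then show ?thesis by simp
  qed
  moreover have "(\<Sum>i\<in>insert k0 S. h i k * u i) = (\<Sum>i\<in>S. h i k * y i) + (h k0 k - s)\<^sup>2 / w"
    using S by (simp add: u_S hp) (simp add: u_def x_def power2_eq_square add_divide_distrib diff_divide_distrib algebra_simps)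
  ultimately show ?thesis using that unfolding s_def by blast
qed

section \<open>Hankel matrices\<close>

lemma seg_carrier [simp]: "seg a lo hi \<in> carrier_vec (nat (hi - lo + 1))"
  by (simp add: seg_def)

text \<open>Lets a quantifier over vectors be read as one over functions on labels, which links the
  matrix notions to \<open>psd_on\<close> and \<open>pd_on\<close>.\<close>

lemma seg_surj:
  assumes "x \<in> carrier_vec (nat (hi - lo + 1))"
  obtains a where "x = seg a lo hi"
proof
  show "x = seg (\<lambda>i. x $ nat (i - lo)) lo hi"
    using assms by (intro eq_vecI) (auto simp: seg_def)
qed

lemma seg_cong: "(\<And>i. lo \<le> i \<Longrightarrow> i \<le> hi \<Longrightarrow> a i = b i) \<Longrightarrow> seg a lo hi = seg b lo hi"
  by (rule eq_vecI) (auto simp: seg_def)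

lemma seg_eq_iff: "seg a lo hi = seg b lo hi \<longleftrightarrow> (\<forall>i\<in>{lo..hi}. a i = b i)"
proof (intro iffI ballI)
  fix i assume "seg a lo hi = seg b lo hi" and i: "i \<in> {lo..hi}"
  then have "seg a lo hi $ nat (i - lo) = seg b lo hi $ nat (i - lo)" by simp
  then show "a i = b i" using i by (simp add: seg_def)
qed (auto intro: seg_cong)

lemma seg_0: "0\<^sub>v (nat (hi - lo + 1)) = seg (\<lambda>_. 0) lo hi"
  by (rule eq_vecI) (auto simp: seg_def)

lemma seg_shift: "seg g (lo + k) (hi + k) = seg (\<lambda>i. g (i + k)) lo hi"
  by (rule eq_vecI) (auto simp: seg_def algebra_simps)

lemma sum_labels: "(\<Sum>r\<in>{0..<nat (hi - lo + 1)}. f (lo + int r)) = (\<Sum>i=lo..hi. f i)"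
  by (rule sum.reindex_bij_witness[where i = "\<lambda>i. nat (i - lo)" and j = "\<lambda>r. lo + int r"]) auto

lemma scalar_prod_seg: "scalar_prod (seg a lo hi) (seg b lo hi) = (\<Sum>i=lo..hi. a i * b i)"
proof -
  have "scalar_prod (seg a lo hi) (seg b lo hi)
      = (\<Sum>r\<in>{0..<nat (hi - lo + 1)}. (\<lambda>i. a i * b i) (lo + int r))"
    unfolding scalar_prod_def by (intro sum.cong) (auto simp: seg_def)
  also have "\<dots> = (\<Sum>i=lo..hi. a i * b i)" by (rule sum_labels)
  finally show ?thesis .
qed

lemma hankel_carrier [simp]: "hankel g lo hi \<in> carrier_mat (nat (hi - lo + 1)) (nat (hi - lo + 1))"
  by (simp add: hankel_def)

lemma hankel_transpose: "transpose_mat (hankel g lo hi) = hankel g lo hi"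
  by (rule eq_matI) (auto simp: hankel_def algebra_simps)

lemma hankel_mult_seg:
  "hankel g lo hi *\<^sub>v seg a lo hi = seg (\<lambda>i. \<Sum>j=lo..hi. g (i + j) * a j) lo hi"
proof (rule eq_vecI)
  fix r assume "r < dim_vec (seg (\<lambda>i. \<Sum>j=lo..hi. g (i + j) * a j) lo hi)"
  then have r: "r < nat (hi - lo + 1)" by (simp add: seg_def)
  then have "row (hankel g lo hi) r = seg (\<lambda>j. g (lo + int r + j)) lo hi"
    by (intro eq_vecI) (auto simp: hankel_def seg_def algebra_simps)
  then show "(hankel g lo hi *\<^sub>v seg a lo hi) $ r = seg (\<lambda>i. \<Sum>j=lo..hi. g (i + j) * a j) lo hi $ r"
    using r carrier_matD[OF hankel_carrier[of g lo hi]]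
    by (simp only: index_mult_mat_vec scalar_prod_seg) (simp add: seg_def)
qed (simp add: hankel_def seg_def)

lemma hankel_form:
  "scalar_prod (seg a lo hi) (hankel g lo hi *\<^sub>v seg a lo hi) = bil (\<lambda>i j. g (i + j)) {lo..hi} a a"
  by (simp add: hankel_mult_seg scalar_prod_seg bil_def)

lemma pos_semidef_hankel_iff:
  "pos_semidef (hankel g lo hi) \<longleftrightarrow> psd_on (\<lambda>i j. g (i + j)) {lo..hi}"
proof
  assume *: "pos_semidef (hankel g lo hi)"
  show "psd_on (\<lambda>i j. g (i + j)) {lo..hi}"
    unfolding psd_on_def hankel_form[symmetric]
    using * seg_carrier carrier_matD(1)[OF hankel_carrier[of g lo hi]]
    unfolding pos_semidef_def by metis
next
  assume *: "psd_on (\<lambda>i j. g (i + j)) {lo..hi}"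
  show "pos_semidef (hankel g lo hi)"
    unfolding pos_semidef_def
  proof (intro conjI ballI)
    fix x :: "real Matrix.vec" assume "x \<in> carrier_vec (dim_row (hankel g lo hi))"
    then have "x \<in> carrier_vec (nat (hi - lo + 1))" by (simp add: hankel_def)
    then obtain a where "x = seg a lo hi" by (rule seg_surj)
    then show "0 \<le> scalar_prod x (hankel g lo hi *\<^sub>v x)"
      using * by (simp add: hankel_form psd_on_def)
  qed (simp_all add: hankel_transpose, simp add: hankel_def)
qed

lemma pos_def_hankel_iff:
  "pos_def (hankel g lo hi) \<longleftrightarrow> pd_on (\<lambda>i j. g (i + j)) {lo..hi}"
proof
  assume *: "pos_def (hankel g lo hi)"
  show "pd_on (\<lambda>i j. g (i + j)) {lo..hi}"
    unfolding pd_on_def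
  proof (intro allI impI)
    fix a :: "int \<Rightarrow> real" assume "\<exists>i\<in>{lo..hi}. a i \<noteq> 0"
    then have "seg a lo hi \<noteq> 0\<^sub>v (nat (hi - lo + 1))"
      by (simp add: seg_0 seg_eq_iff)
    then have "0 < scalar_prod (seg a lo hi) (hankel g lo hi *\<^sub>v seg a lo hi)"
      using * seg_carrier[of a lo hi] carrier_matD(1)[OF hankel_carrier[of g lo hi]]
      unfolding pos_def_def by metis
    then show "0 < bil (\<lambda>i j. g (i + j)) {lo..hi} a a" by (simp add: hankel_form)
  qed
next
  assume *: "pd_on (\<lambda>i j. g (i + j)) {lo..hi}"
  show "pos_def (hankel g lo hi)"
    unfolding pos_def_def
  proof (intro conjI ballI impI)
    fix x :: "real Matrix.vec" assume "x \<in> carrier_vec (dim_row (hankel g lo hi))" and nz: "x \<noteq> 0\<^sub>v (dim_row (hankel g lo hi))"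
    then have "x \<in> carrier_vec (nat (hi - lo + 1))" by (simp add: hankel_def)
    then obtain a where x: "x = seg a lo hi" by (rule seg_surj)
    then have "\<exists>i\<in>{lo..hi}. a i \<noteq> 0"
      using nz carrier_matD(1)[OF hankel_carrier[of g lo hi]] by (simp only: seg_0 seg_eq_iff) blast
    then show "0 < scalar_prod x (hankel g lo hi *\<^sub>v x)"
      using * by (simp add: x hankel_form pd_on_def)
  qed (simp_all add: hankel_transpose, simp add: hankel_def)
qed

text \<open>The determinant defining \<open>d\<close> is used only through this equivalence and its
  consequence for definite matrices.\<close>

lemma det_hankel_eq_0_iff:
  "Determinant.det (hankel g lo hi) = 0 \<longleftrightarrow>
     (\<exists>a. (\<exists>i\<in>{lo..hi}. a i \<noteq> 0) \<and> (\<forall>i\<in>{lo..hi}. (\<Sum>j=lo..hi. g (i + j) * a j) = 0))"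
  (is "_ \<longleftrightarrow> ?R")
proof -
  have "Determinant.det (hankel g lo hi) = 0 \<longleftrightarrow>
    (\<exists>v. v \<in> carrier_vec (nat (hi - lo + 1)) \<and> v \<noteq> 0\<^sub>v (nat (hi - lo + 1))
       \<and> hankel g lo hi *\<^sub>v v = 0\<^sub>v (nat (hi - lo + 1)))"
    by (rule det_0_iff_vec_prod_zero_field) simp
  also have "\<dots> \<longleftrightarrow> (\<exists>a. seg a lo hi \<noteq> 0\<^sub>v (nat (hi - lo + 1))
       \<and> hankel g lo hi *\<^sub>v seg a lo hi = 0\<^sub>v (nat (hi - lo + 1)))"
    by (rule iffI) (blast elim: seg_surj, blast intro: seg_carrier)
  also have "\<dots> \<longleftrightarrow> ?R"
    by (simp only: seg_0 seg_eq_iff hankel_mult_seg) blast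
  finally show ?thesis .
qed

lemma det_hankel_neq_0:
  assumes "pos_def (hankel g lo hi)"
  shows "Determinant.det (hankel g lo hi) \<noteq> 0"
proof
  assume "Determinant.det (hankel g lo hi) = 0"
  then obtain a where a: "\<exists>i\<in>{lo..hi}. a i \<noteq> 0" "\<forall>i\<in>{lo..hi}. (\<Sum>j=lo..hi. g (i + j) * a j) = 0"
    unfolding det_hankel_eq_0_iff by blast
  then have "bil (\<lambda>i j. g (i + j)) {lo..hi} a a = 0"
    by (simp add: bil_def)
  then show False
    using assms a(1) unfolding pos_def_hankel_iff pd_on_def by (metis less_irrefl)
qed

lemma satisfied_iff:
  "satisfied g lo hi i1 i2 a \<longleftrightarrow>
     lo \<le> i1 \<and> i1 < i2 \<and> i2 \<le> hi \<and> a i1 \<noteq> 0 \<and> a i2 \<noteq> 0 \<and>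
     (\<forall>k\<in>{lo..hi}. (\<Sum>i=i1..i2. a i * g (i + k)) = 0)"
proof -
  have "hankel g lo hi *\<^sub>v rel_vec lo hi i1 i2 a = 0\<^sub>v (nat (hi - lo + 1))
      \<longleftrightarrow> (\<forall>k\<in>{lo..hi}. (\<Sum>i=i1..i2. a i * g (i + k)) = 0)" if "lo \<le> i1" "i2 \<le> hi"
  proof -
    have "rel_vec lo hi i1 i2 a = seg (\<lambda>i. if i1 \<le> i \<and> i \<le> i2 then a i else 0) lo hi"
      by (rule eq_vecI) (auto simp: rel_vec_def seg_def)
    moreover have "(\<Sum>j=lo..hi. g (k + j) * (if i1 \<le> j \<and> j \<le> i2 then a j else 0))
        = (\<Sum>i=i1..i2. a i * g (i + k))" for k
    proof -
      have "(\<Sum>j=lo..hi. g (k + j) * (if i1 \<le> j \<and> j \<le> i2 then a j else 0))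
        = (\<Sum>j=i1..i2. g (k + j) * (if i1 \<le> j \<and> j \<le> i2 then a j else 0))"
        by (rule sum.mono_neutral_right) (use that in auto)
      also have "\<dots> = (\<Sum>i=i1..i2. a i * g (i + k))"
        by (rule sum.cong) (auto simp: add.commute mult.commute)
      finally show ?thesis .
    qed
    ultimately show ?thesis
      by (simp only: hankel_mult_seg seg_0 seg_eq_iff)
  qed
  then show ?thesis unfolding satisfied_def by blast
qed

text \<open>Row k of the relation shifted by j depends on k + j only, because the matrix is Hankel.
  Hence all propagated relations together say that one linear recurrence holds wherever its window
  fits into -2n..6n.\<close>

lemma propagates_iff:
  "propagates n g i1 i2 a \<longleftrightarrow>
     - int n \<le> i1 \<and> i1 < i2 \<and> i2 \<le> 3 * int n \<and> a i1 \<noteq> 0 \<and> a i2 \<noteq> 0 \<and>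
     (\<forall>k. - 2 * int n \<le> i1 + k \<and> i2 + k \<le> 6 * int n \<longrightarrow> (\<Sum>i=i1..i2. a i * g (i + k)) = 0)"
  (is "?L \<longleftrightarrow> ?R")
proof -
  have sh: "(\<Sum>i=i1 + j..i2 + j. a (i - j) * g (i + k)) = (\<Sum>i=i1..i2. a i * g (i + (k + j)))" for j k
    by (rule sum.reindex_bij_witness[where i = "\<lambda>i. i + j" and j = "\<lambda>i. i - j"])
       (auto simp: algebra_simps)
  show ?thesis
  proof
    assume R: ?R
    show ?L
      unfolding propagates_def satisfied_iff
      using R sh[where j = "- j" for j] by (auto simp: sh)
  next
    assume L: ?L
    have row: "(\<Sum>i=i1..i2. a i * g (i + (k + j))) = 0"
      if "- int n \<le> k" "k \<le> 3 * int n" "- int n \<le> i1 + j" "i2 + j \<le> 3 * int n" for j k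
    proof -
      consider "j = 0" | "j < 0" | "j > 0" by linarith
      then show ?thesis
      proof cases
        case 1
        then show ?thesis using L that by (simp add: propagates_def satisfied_iff)
      next
        case 2
        then have "- j \<in> {1..int n + i1}" using that by simp
        then have "satisfied g (- int n) (3 * int n) (i1 - (- j)) (i2 - (- j)) (\<lambda>i. a (i + (- j)))"
          using L unfolding propagates_def by blast
        then have "satisfied g (- int n) (3 * int n) (i1 + j) (i2 + j) (\<lambda>i. a (i - j))"
          by simp
        then show ?thesis using that by (simp add: satisfied_iff sh)
      next
        case 3
        then have "j \<in> {1..3 * int n - i2}" using that by simp
        then have "satisfied g (- int n) (3 * int n) (i1 + j) (i2 + j) (\<lambda>i. a (i - j))"
          using L unfolding propagates_def by blast
        then show ?thesis using that by (simp add: satisfied_iff sh)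
      qed
    qed
    have base: "- int n \<le> i1" "i1 < i2" "i2 \<le> 3 * int n" "a i1 \<noteq> 0" "a i2 \<noteq> 0"
      using L by (auto simp: propagates_def satisfied_iff)
    have "(\<Sum>i=i1..i2. a i * g (i + k)) = 0" if "- 2 * int n \<le> i1 + k" "i2 + k \<le> 6 * int n" for k
    proof -
      \<comment> \<open>The least shift that keeps the relation at or above label -n and the row k -
        j at or below 3n. The two remaining bounds then follow from those on k.\<close>
      define j where "j = max (- int n - i1) (k - 3 * int n)"
      have "(\<Sum>i=i1..i2. a i * g (i + ((k - j) + j))) = 0"
        by (rule row) (use that base in \<open>auto simp: j_def\<close>)
      then show ?thesis by simp
    qed
    then show ?R using base by blast
  qed
qed

section \<open>Inverse Hankel matrices and the bordered form\<close>

lemma the_mat_inverse_hankel: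
  assumes "pos_def (hankel g lo hi)"
  defines "Mi \<equiv> the (mat_inverse (hankel g lo hi))"
  shows "Mi \<in> carrier_mat (nat (hi - lo + 1)) (nat (hi - lo + 1))"
    and "hankel g lo hi * Mi = 1\<^sub>m (nat (hi - lo + 1))"
proof -
  have "hankel g lo hi \<in> Units (ring_mat TYPE(real) (nat (hi - lo + 1)) ())"
    by (rule det_non_zero_imp_unit[OF hankel_carrier det_hankel_neq_0[OF assms(1)]])
  then have "mat_inverse (hankel g lo hi) \<noteq> None"
    using mat_inverse(1)[OF hankel_carrier[of g lo hi], where b = "()"] by blast
  then obtain B where "mat_inverse (hankel g lo hi) = Some B" by blast
  then show "Mi \<in> carrier_mat (nat (hi - lo + 1)) (nat (hi - lo + 1))"
    and "hankel g lo hi * Mi = 1\<^sub>m (nat (hi - lo + 1))"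
    using mat_inverse(2)[OF hankel_carrier] unfolding Mi_def by auto
qed

text \<open>Trades the inverse for the solution of a linear system, the form in which the bordering
  lemmas consume it.\<close>

lemma the_mat_inverse_hankel_seg:
  assumes "pos_def (hankel g lo hi)"
  obtains p where "the (mat_inverse (hankel g lo hi)) *\<^sub>v seg c lo hi = seg p lo hi"
    "\<And>i. i \<in> {lo..hi} \<Longrightarrow> (\<Sum>j=lo..hi. g (i + j) * p j) = c i"
proof -
  note Mi = the_mat_inverse_hankel[OF assms]
  obtain p where p: "the (mat_inverse (hankel g lo hi)) *\<^sub>v seg c lo hi = seg p lo hi"
    by (rule seg_surj[of "the (mat_inverse (hankel g lo hi)) *\<^sub>v seg c lo hi" hi lo])
       (use Mi(1) in auto)
  have "hankel g lo hi *\<^sub>v seg p lo hi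
      = (hankel g lo hi * the (mat_inverse (hankel g lo hi))) *\<^sub>v seg c lo hi"
    using Mi(1) by (simp flip: p add: assoc_mult_mat_vec[OF hankel_carrier])
  also have "\<dots> = seg c lo hi" using Mi(2) by simp
  finally show ?thesis
    using p that unfolding hankel_mult_seg seg_eq_iff by blast
qed

lemma outer_prod_mult_vec:
  assumes "dim_vec u = m" "v \<in> carrier_vec m"
  shows "outer_prod c u *\<^sub>v v = (scalar_prod u v) \<cdot>\<^sub>v c"
proof (rule eq_vecI)
  fix i assume "i < dim_vec ((scalar_prod u v) \<cdot>\<^sub>v c)"
  then have i: "i < dim_vec c" by simp
  have "(outer_prod c u *\<^sub>v v) $ i = (\<Sum>j\<in>{0..<m}. c $ i * u $ j * v $ j)"
    using i assms by (simp add: outer_prod_def scalar_prod_def)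
  also have "\<dots> = (scalar_prod u v) * c $ i"
    using assms by (simp add: scalar_prod_def sum_distrib_left sum_distrib_right mult_ac)
  finally show "(outer_prod c u *\<^sub>v v) $ i = ((scalar_prod u v) \<cdot>\<^sub>v c) $ i"
    using i by simp
qed (simp add: outer_prod_def)

lemma smult_mat_mult_vec:
  fixes A :: "real mat"
  assumes "A \<in> carrier_mat n m" "v \<in> carrier_vec m"
  shows "(k \<cdot>\<^sub>m A) *\<^sub>v v = k \<cdot>\<^sub>v (A *\<^sub>v v)"
  by (rule eq_vecI) (use assms in \<open>auto simp: scalar_prod_def sum_distrib_left mult.assoc\<close>)

text \<open>With p and y the solutions for c and v, symmetry gives v.p = c.y, so the terms with
  denominator w combine into the single square (s - c.y)^2 / w. This matches
  \<open>border_two_level\<close>.\<close>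

lemma bordered_form_hankel:
  assumes pd: "pos_def (hankel g lo hi)" and w: "w \<noteq> 0"
    and p: "the (mat_inverse (hankel g lo hi)) *\<^sub>v seg c lo hi = seg p lo hi"
      "\<And>i. i \<in> {lo..hi} \<Longrightarrow> (\<Sum>j=lo..hi. g (i + j) * p j) = c i"
    and y: "the (mat_inverse (hankel g lo hi)) *\<^sub>v seg v lo hi = seg y lo hi"
      "\<And>i. i \<in> {lo..hi} \<Longrightarrow> (\<Sum>j=lo..hi. g (i + j) * y j) = v i"
  shows "bordered_form (hankel g lo hi) (seg c lo hi) w (seg v lo hi) s
    = (\<Sum>i=lo..hi. v i * y i) + (s - (\<Sum>i=lo..hi. c i * y i))\<^sup>2 / w"
proof -
  define m where "m = nat (hi - lo + 1)"
  define Mi where "Mi = the (mat_inverse (hankel g lo hi))"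
  define U where "U = outer_prod (seg c lo hi) (seg c lo hi)"
  have car: "Mi \<in> carrier_mat m m" "U \<in> carrier_mat m m"
    using the_mat_inverse_hankel(1)[OF pd] by (simp_all add: Mi_def m_def U_def outer_prod_def seg_def)
  have segc: "seg f lo hi \<in> carrier_vec m" for f by (simp add: m_def)
  have Mc: "Mi *\<^sub>v seg c lo hi = seg p lo hi" and Mv: "Mi *\<^sub>v seg v lo hi = seg y lo hi"
    using p(1) y(1) by (simp_all add: Mi_def)
  define cy where "cy = (\<Sum>i=lo..hi. c i * y i)"
  have vp: "(\<Sum>i=lo..hi. v i * p i) = cy"
  proof -
    have "bil (\<lambda>i j. g (i + j)) {lo..hi} p y = (\<Sum>i=lo..hi. v i * p i)"
         "bil (\<lambda>i j. g (i + j)) {lo..hi} y p = cy"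
      unfolding bil_def cy_def by (auto intro!: sum.cong simp: p(2) y(2))
    then show ?thesis
      using bil_sym[of "\<lambda>i j. g (i + j)" "{lo..hi}" p y] by (simp add: add.commute)
  qed
  have "(Mi * U * Mi) *\<^sub>v seg v lo hi = Mi *\<^sub>v (U *\<^sub>v seg y lo hi)"
    using car segc by (simp add: assoc_mult_mat_vec[of _ m m _ m] Mv)
  also have "U *\<^sub>v seg y lo hi = cy \<cdot>\<^sub>v seg c lo hi"
    unfolding U_def by (subst outer_prod_mult_vec[of _ m]) (simp_all add: segc[THEN carrier_vecD] segc scalar_prod_seg cy_def)
  also have "Mi *\<^sub>v \<dots> = cy \<cdot>\<^sub>v seg p lo hi"
    using car segc by (simp add: mult_mat_vec Mc)
  finally have "(Mi + (1 / w) \<cdot>\<^sub>m (Mi * U * Mi)) *\<^sub>v seg v lo hi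
      = seg y lo hi + (1 / w) \<cdot>\<^sub>v (cy \<cdot>\<^sub>v seg p lo hi)"
    using car segc by (simp add: add_mult_distrib_mat_vec[of _ m m] smult_mat_mult_vec[of _ m m] Mv)
  also have "\<dots> = seg (\<lambda>i. y i + (1 / w) * (cy * p i)) lo hi"
    by (rule eq_vecI) (auto simp: seg_def)
  finally have "bordered_form (hankel g lo hi) (seg c lo hi) w (seg v lo hi) s
      = (\<Sum>i=lo..hi. v i * (y i + (1 / w) * (cy * p i))) - 2 * s / w * cy + s\<^sup>2 / w"
    unfolding bordered_form_def Let_def Mi_def[symmetric] U_def[symmetric] Mc
    by (simp only: scalar_prod_seg vp)
  also have "(\<Sum>i=lo..hi. v i * (y i + (1 / w) * (cy * p i)))
      = (\<Sum>i=lo..hi. v i * y i) + cy / w * (\<Sum>i=lo..hi. v i * p i)"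
    by (simp add: algebra_simps sum.distrib sum_distrib_left)
  finally show ?thesis
    unfolding vp cy_def[symmetric]
    by (simp add: power2_eq_square add_divide_distrib diff_divide_distrib algebra_simps)
qed

section \<open>Schur complements\<close>

text \<open>Serves both thresholds: the block lo..hi is bordered by hi+1 and then by k, above (for
  \<Phi>) or below (for \<Psi>). \<open>B\<close> is the corner value g(2k) at which the second
  Schur complement vanishes.\<close>

lemma hankel_border_two_level:
  fixes g :: "int \<Rightarrow> real"
  assumes pd: "pos_def (hankel g lo hi)" and pd1: "pos_def (hankel g lo (hi + 1))"
    and lo: "lo \<le> hi + 1" and k: "k = hi + 2 \<or> k = lo - 1"
  defines "w \<equiv> g (2 * (hi + 1)) - scalar_prod (seg (\<lambda>i. g (i + (hi + 1))) lo hi)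
                  (the (mat_inverse (hankel g lo hi)) *\<^sub>v seg (\<lambda>i. g (i + (hi + 1))) lo hi)"
  defines "B \<equiv> bordered_form (hankel g lo hi) (seg (\<lambda>i. g (i + (hi + 1))) lo hi) w
                  (seg (\<lambda>i. g (i + k)) lo hi) (g (hi + 1 + k))"
  shows "psd_on (\<lambda>i j. g (i + j)) (insert k {lo..hi + 1}) \<longleftrightarrow> B \<le> g (2 * k)"
    and "pd_on (\<lambda>i j. g (i + j)) (insert k {lo..hi + 1}) \<longleftrightarrow> B < g (2 * k)"
proof -
  let ?h = "\<lambda>i j. g (i + j)" and ?S = "{lo..hi}" and ?k0 = "hi + 1"
  have ins: "{lo..hi + 1} = insert ?k0 ?S" using lo by auto
  have sym: "?h i j = ?h j i" for i j by (simp add: add.commute)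
  have S: "finite ?S" "?k0 \<notin> ?S" by auto
  obtain p where p: "the (mat_inverse (hankel g lo hi)) *\<^sub>v seg (\<lambda>i. g (i + ?k0)) lo hi = seg p lo hi"
    "\<And>i. i \<in> ?S \<Longrightarrow> (\<Sum>j\<in>?S. ?h i j * p j) = ?h i ?k0"
    by (rule the_mat_inverse_hankel_seg[OF pd, of "\<lambda>i. g (i + ?k0)"]) (rule that)
  obtain y where y: "the (mat_inverse (hankel g lo hi)) *\<^sub>v seg (\<lambda>i. g (i + k)) lo hi = seg y lo hi"
    "\<And>i. i \<in> ?S \<Longrightarrow> (\<Sum>j\<in>?S. ?h i j * y j) = ?h i k"
    by (rule the_mat_inverse_hankel_seg[OF pd, of "\<lambda>i. g (i + k)"]) (rule that)
  have w: "w = ?h ?k0 ?k0 - (\<Sum>i\<in>?S. ?h i ?k0 * p i)"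
    by (simp add: w_def p(1) scalar_prod_seg)
  have pdS: "pd_on ?h ?S" using pd unfolding pos_def_hankel_iff .
  have pdS1: "pd_on ?h (insert ?k0 ?S)" using pd1 unfolding pos_def_hankel_iff ins .
  have "(\<Sum>i\<in>?S. ?h i ?k0 * p i) < ?h ?k0 ?k0"
    by (rule border_pd_iff[OF S sym pdS p(2), THEN iffD1, OF _ pdS1])
  then have "w > 0" unfolding w by linarith
  then have "w \<noteq> 0" by simp
  obtain u where u: "\<And>i. i \<in> insert ?k0 ?S \<Longrightarrow> (\<Sum>j\<in>insert ?k0 ?S. ?h i j * u j) = ?h i k"
    and sigma: "(\<Sum>i\<in>insert ?k0 ?S. ?h i k * u i)
       = (\<Sum>i\<in>?S. ?h i k * y i) + (?h ?k0 k - (\<Sum>i\<in>?S. ?h i ?k0 * y i))\<^sup>2 / w"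
    by (rule border_two_level[OF S sym p(2) y(2) w \<open>w \<noteq> 0\<close>]) (assumption, assumption, rule that)
  have B: "B = (\<Sum>i\<in>insert ?k0 ?S. ?h i k * u i)"
    unfolding sigma B_def by (rule bordered_form_hankel[OF pd \<open>w \<noteq> 0\<close> p y])
  have S': "finite (insert ?k0 ?S)" "k \<notin> insert ?k0 ?S" using k lo by auto
  have g2: "g (2 * k) = ?h k k" by (simp only: mult_2)
  show "psd_on ?h (insert k {lo..hi + 1}) \<longleftrightarrow> B \<le> g (2 * k)"
    unfolding ins B g2 by (rule border_psd_iff[OF S' sym pdS1 u])
  show "pd_on ?h (insert k {lo..hi + 1}) \<longleftrightarrow> B < g (2 * k)"
    unfolding ins B g2 by (rule border_pd_iff[OF S' sym pdS1 u])
qed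

section \<open>The thresholds \<Phi> and \<Psi>, and the quadratic \<open>d\<close>\<close>

lemma C_mat_gamma1: "C_mat q \<beta> n = hankel (gamma1 q \<beta> n t) (- int n + 1) (3 * int n - 2)"
  unfolding C_mat_def by (rule eq_matI) (auto simp: hankel_def gamma1_eq_gamma0)

lemma gamma_top: "n \<ge> 1 \<Longrightarrow> gamma q \<beta> n t1 t2 t3 (6 * int n) = t3"
  "n \<ge> 1 \<Longrightarrow> gamma q \<beta> n t1 t2 t3 (6 * int n - 1) = t2"
  by (simp_all add: gamma_def Let_def)

text \<open>C is bordered by the labels 3n-1 and 3n. Among the entries involved, t3 is only the last
  corner, the one compared with the threshold.\<close>

lemma Phi_iff:
  fixes n :: nat and q :: "nat \<Rightarrow> real" and \<beta> :: "nat \<Rightarrow> nat \<Rightarrow> real" and t1 t2 t3 :: real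
  assumes n: "n \<ge> 1" and C: "pos_def (C_mat q \<beta> n)" and F1: "pos_def (F1_mat q \<beta> n t1)"
  defines "g \<equiv> gamma q \<beta> n t1 t2 t3"
  shows "pos_semidef (hankel g (- int n + 1) (3 * int n)) \<longleftrightarrow> Phi q \<beta> n t1 t2 \<le> t3"
    and "pos_def (hankel g (- int n + 1) (3 * int n)) \<longleftrightarrow> Phi q \<beta> n t1 t2 < t3"
proof -
  let ?lo = "- int n + 1" and ?hi = "3 * int n - 2"
  have hi: "?hi + 1 = 3 * int n - 1" by simp
  have C': "pos_def (hankel g ?lo ?hi)"
    using C unfolding C_mat_eq[of q \<beta> n t1 t2 t3] g_def .
  have F1': "pos_def (hankel g ?lo (?hi + 1))"
    using F1 unfolding hi F1_mat_eq[of q \<beta> n t1 t2 t3] g_def .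
  have ins: "{?lo..3 * int n} = insert (3 * int n) {?lo..?hi + 1}" using n by auto
  have c1: "seg (gamma1 q \<beta> n t1) (2 * int n) (6 * int n - 3) = seg (\<lambda>i. g (i + (?hi + 1))) ?lo ?hi"
  proof -
    have "seg (gamma1 q \<beta> n t1) (2 * int n) (6 * int n - 3) = seg g (2 * int n) (6 * int n - 3)"
      by (rule seg_cong) (simp add: g_def gamma_eq_gamma1)
    then show ?thesis
      using seg_shift[of g ?lo "?hi + 1" ?hi] by (simp add: algebra_simps)
  qed
  have v: "seg (gamma1 q \<beta> n t1) (2 * int n + 1) (6 * int n - 2) = seg (\<lambda>i. g (i + 3 * int n)) ?lo ?hi"
  proof -
    have "seg (gamma1 q \<beta> n t1) (2 * int n + 1) (6 * int n - 2) = seg g (2 * int n + 1) (6 * int n - 2)"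
      by (rule seg_cong) (simp add: g_def gamma_eq_gamma1)
    then show ?thesis
      using seg_shift[of g ?lo "3 * int n" ?hi] by (simp add: algebra_simps)
  qed
  have w: "gamma1 q \<beta> n t1 (6 * int n - 2) = g (2 * (?hi + 1))"
    using n by (simp add: g_def gamma_eq_gamma1)
  have s: "t2 = g (?hi + 1 + 3 * int n)" "t3 = g (2 * (3 * int n))"
    using gamma_top[OF n, of q \<beta> t1 t2 t3] by (simp_all add: g_def)
  have Phi: "Phi q \<beta> n t1 t2 = bordered_form (hankel g ?lo ?hi) (seg (\<lambda>i. g (i + (?hi + 1))) ?lo ?hi)
      (g (2 * (?hi + 1)) - scalar_prod (seg (\<lambda>i. g (i + (?hi + 1))) ?lo ?hi)
                  (the (mat_inverse (hankel g ?lo ?hi)) *\<^sub>v seg (\<lambda>i. g (i + (?hi + 1))) ?lo ?hi))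
                  (seg (\<lambda>i. g (i + 3 * int n)) ?lo ?hi) (g (?hi + 1 + 3 * int n))"
    unfolding Phi_def Let_def c1 v w s(1)[symmetric]
    unfolding C_mat_eq[of q \<beta> n t1 t2 t3] g_def[symmetric] ..
  have "?lo \<le> ?hi + 1" "3 * int n = ?hi + 2 \<or> 3 * int n = ?lo - 1" using n by auto
  note * = hankel_border_two_level[OF C' F1' this, folded Phi s(2) ins]
  show "pos_semidef (hankel g ?lo (3 * int n)) \<longleftrightarrow> Phi q \<beta> n t1 t2 \<le> t3"
    using *(1) by (simp only: pos_semidef_hankel_iff)
  show "pos_def (hankel g ?lo (3 * int n)) \<longleftrightarrow> Phi q \<beta> n t1 t2 < t3"
    using *(2) by (simp only: pos_def_hankel_iff)
qed

text \<open>F_1 is bordered by 3n and then by -n, so the corner is the entry -2n, while t3 has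
  become the inner corner and enters through w_2.\<close>

lemma Psi_iff:
  fixes n :: nat and q :: "nat \<Rightarrow> real" and \<beta> :: "nat \<Rightarrow> nat \<Rightarrow> real" and t1 t2 t3 :: real
  assumes n: "n \<ge> 1" and F1: "pos_def (F1_mat q \<beta> n t1)"
  defines "g \<equiv> gamma q \<beta> n t1 t2 t3"
  assumes F2: "pos_def (hankel g (- int n + 1) (3 * int n))"
  shows "pos_semidef (hankel g (- int n) (3 * int n)) \<longleftrightarrow> Psi q \<beta> n t1 t2 t3 \<le> g (- 2 * int n)"
    and "pos_def (hankel g (- int n) (3 * int n)) \<longleftrightarrow> Psi q \<beta> n t1 t2 t3 < g (- 2 * int n)"
proof -
  let ?lo = "- int n + 1" and ?hi = "3 * int n - 1"
  have F1': "pos_def (hankel g ?lo ?hi)"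
    using F1 unfolding F1_mat_eq[of q \<beta> n t1 t2 t3] g_def .
  have F2': "pos_def (hankel g ?lo (?hi + 1))" using F2 by simp
  have ins: "{- int n..3 * int n} = insert (- int n) {?lo..?hi + 1}" using n by auto
  have c2: "seg g (2 * int n + 1) (6 * int n - 1) = seg (\<lambda>i. g (i + (?hi + 1))) ?lo ?hi"
    using seg_shift[of g ?lo "?hi + 1" ?hi] by (simp add: algebra_simps)
  have z2: "seg g (- 2 * int n + 1) (2 * int n - 1) = seg (\<lambda>i. g (i + - int n)) ?lo ?hi"
    using seg_shift[of g ?lo "- int n" ?hi] by (simp add: algebra_simps)
  have s: "g (2 * int n) = g (?hi + 1 + - int n)" "t3 = g (2 * (?hi + 1))"
      "g (- 2 * int n) = g (2 * - int n)"
    using gamma_top[OF n, of q \<beta> t1 t2 t3] by (simp_all add: g_def algebra_simps)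
  have Psi: "Psi q \<beta> n t1 t2 t3 = bordered_form (hankel g ?lo ?hi) (seg (\<lambda>i. g (i + (?hi + 1))) ?lo ?hi)
      (g (2 * (?hi + 1)) - scalar_prod (seg (\<lambda>i. g (i + (?hi + 1))) ?lo ?hi)
                  (the (mat_inverse (hankel g ?lo ?hi)) *\<^sub>v seg (\<lambda>i. g (i + (?hi + 1))) ?lo ?hi))
                  (seg (\<lambda>i. g (i + - int n)) ?lo ?hi) (g (?hi + 1 + - int n))"
    unfolding Psi_def Let_def g_def[symmetric] c2 z2 s(1) s(2)[symmetric]
    unfolding F1_mat_eq[of q \<beta> n t1 t2 t3] g_def[symmetric] ..
  have "?lo \<le> ?hi + 1" "- int n = ?hi + 2 \<or> - int n = ?lo - 1" using n by auto
  note * = hankel_border_two_level[OF F1' F2' this, folded Psi s(3) ins]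
  show "pos_semidef (hankel g (- int n) (3 * int n)) \<longleftrightarrow> Psi q \<beta> n t1 t2 t3 \<le> g (- 2 * int n)"
    using *(1) by (simp only: pos_semidef_hankel_iff)
  show "pos_def (hankel g (- int n) (3 * int n)) \<longleftrightarrow> Psi q \<beta> n t1 t2 t3 < g (- 2 * int n)"
    using *(2) by (simp only: pos_def_hankel_iff)
qed

text \<open>The sum defining the entry 6n-2 runs over the entries -2n+2..6n-3 and thus avoids the
  other entry depending on t1, the one at -2n+1. Only its last summand contains t1.\<close>

lemma gamma1_last_affine:
  fixes n :: nat
  assumes n: "n \<ge> 1"
  obtains a b where "\<And>t. gamma1 q \<beta> n t (6 * int n - 2) = a + b * t"
proof -
  define c where "c = qcoeff q (2 * n - 1)"
  define r where "r = (\<Sum>\<tau> = - 2 * int n + 1..6 * int n - 5. c \<tau> * gamma0 q \<beta> n (\<tau> + 1))"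
  have "gamma1 q \<beta> n t (6 * int n - 2) = (\<beta> 1 (2 * n - 1) - r) + (- c (6 * int n - 4)) * t" for t
  proof -
    define f where "f = (\<lambda>\<tau>. if \<tau> = 6 * int n - 4 then t else gamma0 q \<beta> n (\<tau> + 1))"
    have "gamma1 q \<beta> n t (6 * int n - 2)
        = \<beta> 1 (2 * n - 1) - (\<Sum>\<tau> = - 2 * int n + 1..6 * int n - 4. c \<tau> * f \<tau>)"
      using n by (simp add: gamma1_def Let_def c_def f_def) (auto intro!: sum.cong)
    also have "{- 2 * int n + 1..6 * int n - 4} = insert (6 * int n - 4) {- 2 * int n + 1..6 * int n - 5}"
      using n by auto
    also have "(\<Sum>\<tau>\<in>\<dots>. c \<tau> * f \<tau>) = c (6 * int n - 4) * t + r"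
      by (simp add: r_def) (auto simp: f_def intro!: sum.cong)
    finally show ?thesis by simp
  qed
  then show ?thesis by (rule that)
qed

text \<open>The quadratic is the Schur complement of \<open>C\<close> in \<open>F\<^sub>1\<close>. Only the zeros of \<open>d\<close> matter, and
  these are the zeros of the Schur complement, so the determinant is never expanded.\<close>

lemma F1_quadratic:
  fixes n :: nat
  assumes n: "n \<ge> 1" and C: "pos_def (C_mat q \<beta> n)"
  obtains a b c :: real where "c > 0"
    "\<And>t. pos_semidef (F1_mat q \<beta> n t) \<longleftrightarrow> 0 \<le> a + b * t - c * t\<^sup>2"
    "\<And>t. pos_def (F1_mat q \<beta> n t) \<longleftrightarrow> 0 < a + b * t - c * t\<^sup>2"
    "\<And>t. d q \<beta> n t = 0 \<longleftrightarrow> a + b * t - c * t\<^sup>2 = 0"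
proof -
  let ?lo = "- int n + 1" and ?hi = "3 * int n - 2" and ?k = "3 * int n - 1"
  let ?S = "{?lo..?hi}"
  define g where "g = gamma0 q \<beta> n"
  have Cg: "C_mat q \<beta> n = hankel g ?lo ?hi" by (simp add: C_mat_def g_def)
  have pd: "pos_def (hankel g ?lo ?hi)" using C by (simp add: Cg)
  \<comment> \<open>The column of label 3n-1 is f + t e: its last entry is t, the others come from
    \<open>\<beta>\<close> alone. So the system is solved by u + t y, and the Schur complement is
    quadratic in t.\<close>
  define f where "f = (\<lambda>i. if i = ?hi then 0 else g (i + ?k))"
  define e where "e = (\<lambda>i. if i = ?hi then 1 else (0::real))"
  obtain u where u: "\<And>i. i \<in> ?S \<Longrightarrow> (\<Sum>j\<in>?S. g (i + j) * u j) = f i"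
    by (rule the_mat_inverse_hankel_seg[OF pd, of f]) blast
  obtain y where y: "\<And>i. i \<in> ?S \<Longrightarrow> (\<Sum>j\<in>?S. g (i + j) * y j) = e i"
    by (rule the_mat_inverse_hankel_seg[OF pd, of e]) blast
  obtain a0 b0 where last: "\<And>t. gamma1 q \<beta> n t (6 * int n - 2) = a0 + b0 * t"
    using gamma1_last_affine[OF n] by blast
  define a where "a = a0 - (\<Sum>i\<in>?S. f i * u i)"
  define b where "b = b0 - (\<Sum>i\<in>?S. e i * u i) - (\<Sum>i\<in>?S. f i * y i)"
  define c where "c = (\<Sum>i\<in>?S. e i * y i)"
  \<comment> \<open>c is e^T C^(-1) e, the value of the form of C at y, hence positive.\<close>
  have "c = bil (\<lambda>i j. g (i + j)) ?S y y"
    unfolding bil_def c_def by (intro sum.cong refl) (metis mult.commute y)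
  moreover have "\<exists>i\<in>?S. y i \<noteq> 0"
  proof (rule ccontr)
    assume "\<not> (\<exists>i\<in>?S. y i \<noteq> 0)"
    then have "(\<Sum>j\<in>?S. g (?hi + j) * y j) = 0" by (intro sum.neutral) auto
    then show False using y[of ?hi] n by (simp add: e_def)
  qed
  ultimately have c: "c > 0" using pd by (simp add: pos_def_hankel_iff pd_on_def)
  have *: "(pos_semidef (F1_mat q \<beta> n t) \<longleftrightarrow> 0 \<le> a + b * t - c * t\<^sup>2) \<and>
    (pos_def (F1_mat q \<beta> n t) \<longleftrightarrow> 0 < a + b * t - c * t\<^sup>2) \<and>
    (d q \<beta> n t = 0 \<longleftrightarrow> a + b * t - c * t\<^sup>2 = 0)" for t
  proof -
    define G where "G = gamma1 q \<beta> n t"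
    let ?h = "\<lambda>i j. G (i + j)"
    have S: "finite ?S" "?k \<notin> ?S" by auto
    have ins: "{?lo..?k} = insert ?k ?S" using n by auto
    have sym: "?h i j = ?h j i" for i j by (simp add: add.commute)
    have Gg: "G i = g i" if "- 2 * int n + 2 \<le> i" "i \<le> 6 * int n - 4" for i
      using that by (simp add: G_def g_def gamma1_eq_gamma0)
    have col: "?h i ?k = f i + t * e i" if "i \<in> ?S" for i
    proof (cases "i = ?hi")
      case True
      then show ?thesis using n by (simp add: f_def e_def G_def gamma1_def Let_def)
    next
      case False
      then show ?thesis using that by (simp add: f_def e_def Gg)
    qed
    have pdG: "pd_on ?h ?S"
      using C unfolding C_mat_gamma1[of q \<beta> n t] G_def by (simp add: pos_def_hankel_iff)
    have sol: "(\<Sum>j\<in>?S. ?h i j * (u j + t * y j)) = ?h i ?k" if i: "i \<in> ?S" for i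
    proof -
      have "(\<Sum>j\<in>?S. ?h i j * (u j + t * y j)) = (\<Sum>j\<in>?S. g (i + j) * u j + t * (g (i + j) * y j))"
        by (rule sum.cong) (use i in \<open>auto simp: Gg algebra_simps\<close>)
      also have "\<dots> = f i + t * e i"
        by (simp only: sum.distrib u[OF i] y[OF i] flip: sum_distrib_left)
      finally show ?thesis by (simp only: col[OF i])
    qed
    have "(\<Sum>i\<in>?S. ?h i ?k * (u i + t * y i))
        = (\<Sum>i\<in>?S. f i * u i + t * (e i * u i) + t * (f i * y i) + t\<^sup>2 * (e i * y i))"
      by (intro sum.cong refl) (simp only: col, simp add: power2_eq_square algebra_simps)
    also have "\<dots> = (\<Sum>i\<in>?S. f i * u i) + t * (\<Sum>i\<in>?S. e i * u i)
        + t * (\<Sum>i\<in>?S. f i * y i) + t\<^sup>2 * c"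
      unfolding c_def by (simp only: sum.distrib sum_distrib_left)
    finally have sigma: "(\<Sum>i\<in>?S. ?h i ?k * (u i + t * y i)) = \<dots>" .
    have "?h ?k ?k = a0 + b0 * t" using last[of t] by (simp add: G_def)
    then have eq: "a + b * t - c * t\<^sup>2 = ?h ?k ?k - (\<Sum>i\<in>?S. ?h i ?k * (u i + t * y i))"
      unfolding sigma a_def b_def by (simp only:) (simp add: algebra_simps)
    have F1: "F1_mat q \<beta> n t = hankel G ?lo ?k" by (simp add: F1_mat_def G_def)
    let ?\<sigma> = "\<Sum>i\<in>?S. ?h i ?k * (u i + t * y i)"
    have border: "psd_on ?h (insert ?k ?S) \<longleftrightarrow> ?\<sigma> \<le> ?h ?k ?k"
      "pd_on ?h (insert ?k ?S) \<longleftrightarrow> ?\<sigma> < ?h ?k ?k"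
      "(\<exists>a. (\<exists>i\<in>insert ?k ?S. a i \<noteq> 0) \<and>
          (\<forall>i\<in>insert ?k ?S. (\<Sum>j\<in>insert ?k ?S. ?h i j * a j) = 0)) \<longleftrightarrow> ?h ?k ?k = ?\<sigma>"
      by (rule border_psd_iff[OF S sym pdG sol] border_pd_iff[OF S sym pdG sol]
            border_singular_iff[OF S sym pdG sol]; assumption)+
    show ?thesis
      unfolding d_def F1 pos_semidef_hankel_iff pos_def_hankel_iff det_hankel_eq_0_iff ins eq
      unfolding border
      by (intro conjI iffI; linarith)
  qed
  show ?thesis by (rule that[OF c]) (use * in auto)
qed

text \<open>\<open>Min\<close> and \<open>Max\<close> are meaningful only once the zero set is known
  to be finite and nonempty; a nonnegative value somewhere supplies a real zero.\<close>

lemma concave_quadratic_roots: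
  fixes a b c :: real
  assumes "c > 0"
  defines "Z \<equiv> {t. a + b * t - c * t\<^sup>2 = 0}"
  shows "0 \<le> a + b * t - c * t\<^sup>2 \<Longrightarrow> Z \<noteq> {} \<and> Min Z \<le> t \<and> t \<le> Max Z"
    and "Z \<noteq> {} \<Longrightarrow> Min Z \<in> Z \<and> Max Z \<in> Z"
    and "Z \<noteq> {} \<Longrightarrow> Min Z < t \<Longrightarrow> t < Max Z \<Longrightarrow> 0 < a + b * t - c * t\<^sup>2"
proof -
  have factor: "\<exists>r'. (\<forall>t. a + b * t - c * t\<^sup>2 = - c * ((t - r) * (t - r'))) \<and> Z = {r, r'}" if "r \<in> Z" for r
  proof (intro exI conjI allI)
    \<comment> \<open>By Vieta the second root is b/c - r.\<close>
    define m where "m = b / c"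
    have b: "b = c * m" using \<open>c > 0\<close> by (simp add: m_def)
    have r: "a = c * r\<^sup>2 - b * r" using that by (simp add: Z_def algebra_simps)
    show eq: "a + b * t - c * t\<^sup>2 = - c * ((t - r) * (t - (b / c - r)))" for t
      unfolding m_def[symmetric] by (simp add: r b power2_eq_square algebra_simps)
    show "Z = {r, b / c - r}"
      unfolding Z_def eq using \<open>c > 0\<close> by auto
  qed
  show "Min Z \<in> Z \<and> Max Z \<in> Z" if Z: "Z \<noteq> {}"
  proof -
    obtain r where "r \<in> Z" using Z by blast
    then obtain r' where "Z = {r, r'}" using factor by blast
    then have "finite Z" by simp
    then show ?thesis using Z by simp
  qed
  show "0 < a + b * t - c * t\<^sup>2" if Z: "Z \<noteq> {}" and t: "Min Z < t" "t < Max Z"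
  proof -
    obtain r where "r \<in> Z" using Z by blast
    then obtain r' where r: "\<And>t. a + b * t - c * t\<^sup>2 = - c * ((t - r) * (t - r'))" "Z = {r, r'}"
      using factor by blast
    have "(t - r) * (t - r') < 0"
      using t unfolding r(2) by (auto simp: min_def max_def mult_less_0_iff split: if_splits)
    then show ?thesis unfolding r(1) using \<open>c > 0\<close> by (simp add: mult_less_0_iff)
  qed
  show "Z \<noteq> {} \<and> Min Z \<le> t \<and> t \<le> Max Z" if t: "0 \<le> a + b * t - c * t\<^sup>2"
  proof -
    \<comment> \<open>The discriminant: 4c times the quadratic at t is D - (b - 2ct)^2.\<close>
    define D where "D = b\<^sup>2 + 4 * a * c"
    have "0 \<le> 4 * c * (a + b * t - c * t\<^sup>2)" using t \<open>c > 0\<close> by simp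
    also have "\<dots> = D - (b - 2 * c * t)\<^sup>2"
      by (simp add: D_def power2_eq_square algebra_simps)
    finally have "D \<ge> 0" using zero_le_power2[of "b - 2 * c * t"] by linarith
    define s where "s = (b + sqrt D) / (2 * c)"
    have "2 * c * s - b = sqrt D" using \<open>c > 0\<close> by (simp add: s_def)
    then have "(2 * c * s - b)\<^sup>2 = D" using \<open>D \<ge> 0\<close> by simp
    then have "4 * c * (a + b * s - c * s\<^sup>2) = 0"
      by (simp add: D_def power2_eq_square algebra_simps)
    then have "s \<in> Z" using \<open>c > 0\<close> by (simp add: Z_def)
    then obtain r' where r: "\<And>t. a + b * t - c * t\<^sup>2 = - c * ((t - s) * (t - r'))" "Z = {s, r'}"
      using factor by blast
    have "(t - s) * (t - r') \<le> 0"
      using t \<open>c > 0\<close> unfolding r(1) by (simp add: mult_le_0_iff zero_le_mult_iff)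
    then show ?thesis
      unfolding r(2) by (auto simp: min_def max_def mult_le_0_iff)
  qed
qed

text \<open>That \<open>d\<close> has a real zero, part of (ii) to (v), follows as soon as F_1 is
  positive semidefinite for one t.\<close>

lemma
  fixes n :: nat
  assumes n: "n \<ge> 1" and C: "pos_def (C_mat q \<beta> n)"
  shows F1_psd_bounds: "pos_semidef (F1_mat q \<beta> n t) \<Longrightarrow>
          (\<exists>t. d q \<beta> n t = 0) \<and> t1_minus q \<beta> n \<le> t \<and> t \<le> t1_plus q \<beta> n"
    and d_endpoints: "(\<exists>t. d q \<beta> n t = 0) \<Longrightarrow> d q \<beta> n (t1_minus q \<beta> n) = 0 \<and> d q \<beta> n (t1_plus q \<beta> n) = 0"
    and F1_pd_between: "(\<exists>t. d q \<beta> n t = 0) \<Longrightarrow> t1_minus q \<beta> n < t \<Longrightarrow> t < t1_plus q \<beta> n \<Longrightarrow>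
          pos_def (F1_mat q \<beta> n t)"
proof -
  obtain a b c :: real where c: "c > 0" and F1:
    "\<And>t. pos_semidef (F1_mat q \<beta> n t) \<longleftrightarrow> 0 \<le> a + b * t - c * t\<^sup>2"
    "\<And>t. pos_def (F1_mat q \<beta> n t) \<longleftrightarrow> 0 < a + b * t - c * t\<^sup>2"
    and d: "\<And>t. d q \<beta> n t = 0 \<longleftrightarrow> a + b * t - c * t\<^sup>2 = 0"
    by (rule F1_quadratic[OF n C]) (rule that)
  note Z = concave_quadratic_roots[OF c, of a b]
  show "pos_semidef (F1_mat q \<beta> n t) \<Longrightarrow>
          (\<exists>t. d q \<beta> n t = 0) \<and> t1_minus q \<beta> n \<le> t \<and> t \<le> t1_plus q \<beta> n"
    using Z(1)[of t] unfolding F1 d t1_minus_def t1_plus_def by simp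
  show "(\<exists>t. d q \<beta> n t = 0) \<Longrightarrow> d q \<beta> n (t1_minus q \<beta> n) = 0 \<and> d q \<beta> n (t1_plus q \<beta> n) = 0"
    using Z(2) unfolding d t1_minus_def t1_plus_def by simp
  show "(\<exists>t. d q \<beta> n t = 0) \<Longrightarrow> t1_minus q \<beta> n < t \<Longrightarrow> t < t1_plus q \<beta> n \<Longrightarrow>
          pos_def (F1_mat q \<beta> n t)"
    using Z(3)[of t] unfolding F1 d t1_minus_def t1_plus_def by simp
qed

section \<open>Moments of representing measures\<close>

text \<open>Off the support every point has an open null neighbourhood. By second countability,
  countably many open null sets already cover the complement.\<close>

lemma AE_in_closed_support:
  fixes M :: "'a::second_countable_topology measure"
  assumes "sets M = sets borel" and supp: "measure_support M \<subseteq> T"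
  shows "AE z in M. z \<in> T"
proof -
  let ?F = "{U. open U \<and> emeasure M U = 0}"
  obtain F' where F': "F' \<subseteq> ?F" "countable F'" "\<Union>F' = \<Union>?F"
    by (rule Lindelof[of ?F]) auto
  have "(\<Union>U\<in>F'. U) \<in> null_sets M"
    by (rule null_sets_UN') (use F' assms(1) in \<open>auto simp: null_sets_def\<close>)
  then have "\<Union>?F \<in> null_sets M" using F'(3) by simp
  then have "AE z in M. z \<notin> \<Union>?F" by (rule AE_not_in)
  then show ?thesis
  proof (rule eventually_mono)
    fix z assume "z \<notin> \<Union>?F"
    then have "z \<in> measure_support M"
      by (auto simp: measure_support_def zero_less_iff_neq_zero)
    then show "z \<in> T" using supp by blast
  qed
qed

text \<open>At x = 0 the equation would read q_0 = 0, so the curve is a graph over the punctured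
  line.\<close>

lemma curve_iff:
  assumes "q 0 \<noteq> 0"
  shows "(x, y) \<in> curve q \<longleftrightarrow> x \<noteq> 0 \<and> y = (\<Sum>s=0..4. q s * x powi (int s - 1))"
proof (cases "x = 0")
  case True
  then show ?thesis using assms by (simp add: curve_def sum_0_4)
next
  case False
  have "x * (\<Sum>s=0..4. q s * x powi (int s - 1)) = (\<Sum>s=0..4. q s * x ^ s)"
    unfolding sum_distrib_left
  proof (rule sum.cong)
    fix s :: nat
    have "x * x powi (int s - 1) = x ^ s"
      using power_int_add_1'[of x "int s - 1"] False by simp
    then show "x * (q s * x powi (int s - 1)) = q s * x ^ s"
      by (subst mult.left_commute) (rule arg_cong)
  qed simp
  then have "x * y - (\<Sum>s=0..4. q s * x ^ s)
      = x * (y - (\<Sum>s=0..4. q s * x powi (int s - 1)))"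
    by (simp only: right_diff_distrib)
  then have "(x, y) \<in> curve q \<longleftrightarrow> x * (y - (\<Sum>s=0..4. q s * x powi (int s - 1))) = 0"
    by (simp only: curve_def mem_Collect_eq case_prod_conv)
  then show ?thesis using False by simp
qed

text \<open>The case of a unit mass at x; integrating it against a measure, or summing it over
  atoms, gives the general one.\<close>

lemma curve_moment_powers:
  assumes "x \<noteq> 0"
  shows "curve_moment q (\<lambda>k. x powi k) i j = x powi i * (\<Sum>s=0..4. q s * x powi (int s - 1)) ^ j"
proof (induction j arbitrary: i)
  case (Suc j)
  let ?y = "\<Sum>s=0..4. q s * x powi (int s - 1)"
  have "curve_moment q (\<lambda>k. x powi k) i (Suc j)
      = (\<Sum>s=0..4. q s * (x powi (i - 1 + int s) * ?y ^ j))"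
    by (simp only: curve_moment_Suc Suc)
  also have "\<dots> = (\<Sum>s=0..4. (x powi i * ?y ^ j) * (q s * x powi (int s - 1)))"
  proof (rule sum.cong)
    fix s :: nat
    have eq: "i - 1 + int s = i + (int s - 1)" by simp
    have "x powi (i - 1 + int s) = x powi i * x powi (int s - 1)"
      unfolding eq by (rule power_int_add) (use assms in simp)
    then show "q s * (x powi (i - 1 + int s) * ?y ^ j) = (x powi i * ?y ^ j) * (q s * x powi (int s - 1))"
      by (simp only: mult_ac)
  qed simp
  also have "\<dots> = x powi i * ?y ^ Suc j"
    by (simp only: sum_distrib_left[symmetric]) simp
  finally show ?case .
qed simp

section \<open>Integrability of the powers of x\<close>

lemma power_sum_le: "0 \<le> a \<Longrightarrow> 0 \<le> b \<Longrightarrow> (a + b) ^ m \<le> 2 ^ m * (a ^ m + b ^ m)" for a b :: real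
proof -
  assume ab: "0 \<le> a" "0 \<le> b"
  have "(a + b) ^ m \<le> (2 * max a b) ^ m" by (rule power_mono) (use ab in auto)
  also have "\<dots> = 2 ^ m * max a b ^ m" by (simp add: power_mult_distrib)
  also have "\<dots> \<le> 2 ^ m * (a ^ m + b ^ m)"
    using ab by (intro mult_left_mono) (auto simp: max_def)
  finally show ?thesis .
qed

text \<open>Along the curve, 1/|x| near 0 and |x|^3 near infinity are at most a constant plus a
  multiple of |y|. Raised to the power 2n this covers the exponents -2n and 6n, and with them all
  between.\<close>

lemma curve_powers_bounded:
  fixes n :: nat
  assumes q0: "q 0 \<noteq> 0" and q4: "q 4 = 1"
  obtains A B where "\<And>x y k. (x, y) \<in> curve q \<Longrightarrow> - 2 * int n \<le> k \<Longrightarrow> k \<le> 6 * int n \<Longrightarrow>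
    \<bar>x powi k\<bar> \<le> A + B * y ^ (2 * n)" "0 \<le> A" "0 \<le> B"
proof -
  \<comment> \<open>K bounds the sum of all |q_s|, the 1 being the leading coefficient. The
    constants add up the bounds on three ranges of u = |x|: u at most 1 (1 + c K^m in A, c in B), u
    between 1 and 2K (the last term of A), and u above 2K (2^m in B).\<close>
  define K where "K = \<bar>q 0\<bar> + \<bar>q 1\<bar> + \<bar>q 2\<bar> + \<bar>q 3\<bar> + 1"
  have K: "K \<ge> 1" by (simp add: K_def)
  define m where "m = 2 * n"
  define c where "c = (2 / \<bar>q 0\<bar>) ^ m"
  define A where "A = 1 + c * K ^ m + (2 * K) ^ (3 * m)"
  define B where "B = c + 2 ^ m"
  have c: "c \<ge> 0" by (simp add: c_def)
  have A0: "A \<ge> 0" using c K by (simp add: A_def)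
  have B0: "B \<ge> 0" using c by (simp add: B_def)
  have even: "y ^ m = \<bar>y\<bar> ^ m" for y :: real by (simp add: m_def power_even_abs)
  have "\<bar>x powi k\<bar> \<le> A + B * y ^ m"
    if xy: "(x, y) \<in> curve q" and k: "- int m \<le> k" "k \<le> 3 * int m" for x y k
  proof -
    have x: "x \<noteq> 0" using xy curve_iff[where q = q, OF q0] by blast
    have eq: "x * y = q 0 + q 1 * x + q 2 * x ^ 2 + q 3 * x ^ 3 + x ^ 4"
      using xy q4 by (simp add: curve_def sum_0_4)
    define u where "u = \<bar>x\<bar>"
    have u: "u > 0" using x by (simp add: u_def)
    have abs_eq: "\<bar>x powi k\<bar> = u powi k" by (simp add: u_def power_int_abs)
    have y0: "0 \<le> \<bar>y\<bar> ^ m" by simp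
    show ?thesis
    proof (cases "u \<le> 1")
      case True
      have le1: "u ^ i \<le> 1" for i using True u by (simp add: power_le_one)
      \<comment> \<open>Near 0 the equation of the curve is solved for q_0, which bounds 1/u by a
        multiple of |y| + K.\<close>
      have "\<bar>q 0\<bar> = \<bar>x * (y - (q 1 + q 2 * x + q 3 * x ^ 2 + x ^ 3))\<bar>"
        using eq by (simp add: algebra_simps power2_eq_square power3_eq_cube power4_eq_xxxx)
      also have "\<dots> = u * \<bar>y - (q 1 + q 2 * x + q 3 * x ^ 2 + x ^ 3)\<bar>"
        by (simp add: abs_mult u_def)
      also have "\<dots> \<le> u * (\<bar>y\<bar> + K)"
      proof (rule mult_left_mono)
        have "\<bar>q 2 * x\<bar> \<le> \<bar>q 2\<bar>" "\<bar>q 3 * x ^ 2\<bar> \<le> \<bar>q 3\<bar>" "\<bar>x ^ 3\<bar> \<le> 1"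
          using le1[of 1] le1[of 2] le1[of 3]
          by (simp_all add: abs_mult power_abs mult_left_le flip: u_def)
        then show "\<bar>y - (q 1 + q 2 * x + q 3 * x ^ 2 + x ^ 3)\<bar> \<le> \<bar>y\<bar> + K"
          unfolding K_def by linarith
      qed (use u in simp)
      finally have "\<bar>q 0\<bar> \<le> u * (\<bar>y\<bar> + K)" .
      then have inv: "inverse u \<le> (\<bar>y\<bar> + K) / \<bar>q 0\<bar>"
        using u q0 by (simp add: field_simps)
      have "u powi k \<le> 1 + inverse u ^ m"
      proof (cases "k \<ge> 0")
        case True
        then show ?thesis using le1[of "nat k"] u by (simp add: power_int_def add_increasing2)
      next
        case False
        then have "u powi k = inverse u ^ nat (- k)" by (simp add: power_int_def)
        also have "\<dots> \<le> inverse u ^ m"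
          by (rule power_increasing) (use k \<open>u \<le> 1\<close> u in \<open>auto simp: one_le_inverse_iff\<close>)
        finally show ?thesis by simp
      qed
      also have "inverse u ^ m \<le> ((\<bar>y\<bar> + K) / \<bar>q 0\<bar>) ^ m"
        by (rule power_mono[OF inv]) (use u in simp)
      also have "\<dots> = (\<bar>y\<bar> + K) ^ m / \<bar>q 0\<bar> ^ m" by (simp add: power_divide)
      also have "\<dots> \<le> 2 ^ m * (\<bar>y\<bar> ^ m + K ^ m) / \<bar>q 0\<bar> ^ m"
        by (rule divide_right_mono[OF power_sum_le]) (use K in auto)
      also have "\<dots> = c * (\<bar>y\<bar> ^ m + K ^ m)" by (simp add: c_def power_divide)
      finally have "u powi k \<le> 1 + c * K ^ m + c * \<bar>y\<bar> ^ m" by (simp add: algebra_simps)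
      also have "\<dots> \<le> A + B * \<bar>y\<bar> ^ m"
        using K by (simp add: A_def B_def algebra_simps)
      finally show ?thesis by (simp add: abs_eq even[of y])
    next
      case False
      then have u1: "u > 1" by simp
      have "u powi k \<le> u powi (3 * int m)"
        by (rule power_int_increasing) (use u1 k in auto)
      also have "\<dots> = (u ^ 3) ^ m"
        by (simp add: power_int_def nat_mult_distrib power_mult)
      finally have le: "u powi k \<le> (u ^ 3) ^ m" .
      show ?thesis
      proof (cases "u \<le> 2 * K")
        case True
        have "(u ^ 3) ^ m \<le> (2 * K) ^ (3 * m)"
          unfolding power_mult[symmetric] by (rule power_mono) (use True u in auto)
        also have "\<dots> \<le> A + B * \<bar>y\<bar> ^ m"
          using c K B0 y0 by (simp add: A_def add_increasing2 add_increasing)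
        finally show ?thesis using le by (simp add: abs_eq even[of y])
      next
        case False
        have "u ^ 4 = \<bar>x * y - (q 0 + q 1 * x + q 2 * x ^ 2 + q 3 * x ^ 3)\<bar>"
          using eq by (simp add: u_def power_abs)
        also have "\<dots> \<le> u * \<bar>y\<bar> + (\<bar>q 0\<bar> + \<bar>q 1\<bar> * u + \<bar>q 2\<bar> * u ^ 2 + \<bar>q 3\<bar> * u ^ 3)"
        proof -
          let ?s = "q 0 + q 1 * x + q 2 * x ^ 2 + q 3 * x ^ 3"
          have "\<bar>x * y - ?s\<bar> \<le> \<bar>x * y\<bar> + \<bar>?s\<bar>" by (rule abs_triangle_ineq4)
          also have "\<bar>?s\<bar> \<le> \<bar>q 0\<bar> + \<bar>q 1 * x\<bar> + \<bar>q 2 * x ^ 2\<bar> + \<bar>q 3 * x ^ 3\<bar>"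
            by (intro order_trans[OF abs_triangle_ineq] add_right_mono order_refl)
          finally show ?thesis by (simp add: u_def abs_mult power_abs)
        qed
        also have "\<dots> \<le> u * \<bar>y\<bar> + K * u ^ 3"
        proof -
          have "\<bar>q 0\<bar> * 1 \<le> \<bar>q 0\<bar> * u ^ 3" "\<bar>q 1\<bar> * u ^ 1 \<le> \<bar>q 1\<bar> * u ^ 3" "\<bar>q 2\<bar> * u ^ 2 \<le> \<bar>q 2\<bar> * u ^ 3"
            using u1 by (intro mult_left_mono power_increasing one_le_power; simp)+
          moreover have "0 \<le> u ^ 3" using u by simp
          ultimately show ?thesis unfolding K_def distrib_right power_one_right by linarith
        qed
        finally have "u * u ^ 3 \<le> u * (\<bar>y\<bar> + K * u ^ 2)"
          by (simp add: algebra_simps power2_eq_square power3_eq_cube power4_eq_xxxx)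
        then have "u ^ 3 \<le> \<bar>y\<bar> + K * u ^ 2" using u by simp
        \<comment> \<open>Beyond 2K the lower-order terms use up at most half of u^3, so the other
          half is bounded by |y|.\<close>
        moreover have "2 * K * u ^ 2 \<le> u * u ^ 2" using False by (intro mult_right_mono) auto
        ultimately have "u ^ 3 \<le> 2 * \<bar>y\<bar>" by (simp add: power2_eq_square power3_eq_cube)
        then have "(u ^ 3) ^ m \<le> (2 * \<bar>y\<bar>) ^ m" using u by (intro power_mono) auto
        also have "\<dots> = 2 ^ m * \<bar>y\<bar> ^ m" by (simp add: power_mult_distrib)
        also have "\<dots> \<le> A + B * \<bar>y\<bar> ^ m"
          using c A0 by (simp add: B_def distrib_right add_increasing)
        finally show ?thesis using le by (simp add: abs_eq even[of y])
      qed
    qed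
  qed
  then show ?thesis
    by (intro that[of A B] A0 B0) (auto simp: m_def)
qed

lemma
  fixes n :: nat
  assumes q0: "q 0 \<noteq> 0" and q4: "q 4 = 1" and M: "representing_measure q n \<beta> M"
  defines "m \<equiv> (\<lambda>k. integral\<^sup>L M (\<lambda>z. fst z powi k))"
  shows AE_fst_neq_0: "AE z in M. fst z \<noteq> 0"
    and integrable_fst_powi: "\<And>k. - 2 * int n \<le> k \<Longrightarrow> k \<le> 6 * int n \<Longrightarrow> integrable M (\<lambda>z. fst z powi k)"
    and representing_curve_moment: "\<And>i j. i + j \<le> 2 * n \<Longrightarrow> curve_moment q m (int i) j = \<beta> i j"
proof -
  have sets: "sets M = sets borel" and supp: "measure_support M \<subseteq> curve q"
    and int: "\<And>i j. i + j \<le> 2 * n \<Longrightarrow> integrable M (\<lambda>(x, y). x ^ i * y ^ j)"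
    and beta: "\<And>i j. i + j \<le> 2 * n \<Longrightarrow> \<beta> i j = integral\<^sup>L M (\<lambda>(x, y). x ^ i * y ^ j)"
    using M by (auto simp: representing_measure_def)
  have AE: "AE z in M. z \<in> curve q" by (rule AE_in_closed_support[OF sets supp])
  show "AE z in M. fst z \<noteq> 0"
    using AE by (rule eventually_mono) (use curve_iff[where q = q, OF q0] in auto)
  have fst_meas: "(\<lambda>z. fst z) \<in> borel_measurable M"
    unfolding measurable_cong_sets[OF sets refl]
    by (intro borel_measurable_continuous_onI continuous_intros)
  show integ: "integrable M (\<lambda>z. fst z powi k)" if k: "- 2 * int n \<le> k" "k \<le> 6 * int n" for k
  proof -
    obtain A B where AB: "\<And>x y k. (x, y) \<in> curve q \<Longrightarrow> - 2 * int n \<le> k \<Longrightarrow> k \<le> 6 * int n \<Longrightarrow>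
      \<bar>x powi k\<bar> \<le> A + B * y ^ (2 * n)" "0 \<le> A" "0 \<le> B"
      by (rule curve_powers_bounded[OF q0 q4, of n]) (rule that)
    \<comment> \<open>The dominating function combines two monomials of degree at most 2n, written
      with exponents 0 so that the assumed integrability applies literally.\<close>
    have "integrable M (\<lambda>z. A * (\<lambda>(x, y). x ^ 0 * y ^ 0) z + B * (\<lambda>(x, y). x ^ 0 * y ^ (2 * n)) z)"
      by (intro Bochner_Integration.integrable_add integrable_mult_right int) auto
    then show ?thesis
    proof (rule Bochner_Integration.integrable_bound)
      show "(\<lambda>z. fst z powi k) \<in> borel_measurable M"
        unfolding power_int_def using fst_meas by measurable
      show "AE z in M. norm (fst z powi k)
          \<le> norm (A * (\<lambda>(x, y). x ^ 0 * y ^ 0) z + B * (\<lambda>(x, y). x ^ 0 * y ^ (2 * n)) z)"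
        using AE
      proof (rule eventually_mono)
        fix z assume "z \<in> curve q"
        then have "(fst z, snd z) \<in> curve q" by simp
        then have "\<bar>fst z powi k\<bar> \<le> A + B * snd z ^ (2 * n)" using AB(1) k by blast
        then show "norm (fst z powi k)
          \<le> norm (A * (\<lambda>(x, y). x ^ 0 * y ^ 0) z + B * (\<lambda>(x, y). x ^ 0 * y ^ (2 * n)) z)"
          by (simp add: case_prod_unfold)
      qed
    qed
  qed
  show "curve_moment q m (int i) j = \<beta> i j" if ij: "i + j \<le> 2 * n" for i j
  proof -
    have "curve_moment q m (int i) j
        = (\<Sum>t=- int j..3 * int j. integral\<^sup>L M (\<lambda>z. qcoeff q j t * fst z powi (t + int i)))"
      by (simp add: curve_moment_def m_def)
    also have "\<dots> = integral\<^sup>L M (\<lambda>z. \<Sum>t=- int j..3 * int j. qcoeff q j t * fst z powi (t + int i))"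
      by (rule Bochner_Integration.integral_sum[symmetric])
         (use ij in \<open>auto intro!: integrable_mult_right integ\<close>)
    also have "\<dots> = integral\<^sup>L M (\<lambda>(x, y). x ^ i * y ^ j)"
    proof (rule integral_cong_AE)
      show "(\<lambda>z. \<Sum>t=- int j..3 * int j. qcoeff q j t * fst z powi (t + int i)) \<in> borel_measurable M"
        using fst_meas unfolding power_int_def by measurable
      show "(\<lambda>(x, y). x ^ i * y ^ j) \<in> borel_measurable M"
        using int[OF ij] by (rule borel_measurable_integrable)
      show "AE z in M. (\<Sum>t=- int j..3 * int j. qcoeff q j t * fst z powi (t + int i))
          = (\<lambda>(x, y). x ^ i * y ^ j) z"
        using AE
      proof (rule eventually_mono)
        fix z assume "z \<in> curve q"
        then have x: "fst z \<noteq> 0" and y: "snd z = (\<Sum>s=0..4. q s * fst z powi (int s - 1))"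
          using curve_iff[where q = q, OF q0, of "fst z" "snd z"] by auto
        show "(\<Sum>t=- int j..3 * int j. qcoeff q j t * fst z powi (t + int i))
          = (\<lambda>(x, y). x ^ i * y ^ j) z"
          using curve_moment_powers[OF x, of q "int i" j] y
          by (simp add: curve_moment_def case_prod_unfold)
      qed
    qed
    finally show ?thesis using beta[OF ij] by simp
  qed
qed

text \<open>The Hankel form at a is the integral of the squared Laurent polynomial with coefficients
  a. Labels in -n..3n keep i + j within the integrable range. Splitting x^(i+j) needs x nonzero,
  which holds almost everywhere.\<close>

lemma representing_bil:
  fixes n :: nat and m :: "int \<Rightarrow> real"
  assumes q0: "q 0 \<noteq> 0" and q4: "q 4 = 1" and M: "representing_measure q n \<beta> M"
    and m: "\<And>k. - 2 * int n \<le> k \<Longrightarrow> k \<le> 6 * int n \<Longrightarrow> m k = integral\<^sup>L M (\<lambda>z. fst z powi k)"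
    and S: "S \<subseteq> {- int n..3 * int n}"
  shows "integrable M (\<lambda>z. (\<Sum>i\<in>S. a i * fst z powi i)\<^sup>2)"
    and "bil (\<lambda>i j. m (i + j)) S a a = integral\<^sup>L M (\<lambda>z. (\<Sum>i\<in>S. a i * fst z powi i)\<^sup>2)"
proof -
  note mom = AE_fst_neq_0[OF q0 q4 M] integrable_fst_powi[OF q0 q4 M]
    representing_curve_moment[OF q0 q4 M]
  have b: "- int n \<le> i" "i \<le> 3 * int n" if "i \<in> S" for i using that S by auto
  let ?f = "\<lambda>z. \<Sum>i\<in>S. \<Sum>j\<in>S. a i * a j * fst z powi (i + j)"
  have sq: "(\<Sum>i\<in>S. a i * x powi i)\<^sup>2 = (\<Sum>i\<in>S. \<Sum>j\<in>S. a i * a j * x powi (i + j))" if "x \<noteq> 0" for x :: real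
    unfolding power2_eq_square sum_product
    by (intro sum.cong refl) (use that in \<open>simp add: power_int_add\<close>)
  have AE: "AE z in M. ?f z = (\<Sum>i\<in>S. a i * fst z powi i)\<^sup>2"
    using mom(1) by (rule eventually_mono) (simp add: sq)
  have int1: "integrable M (\<lambda>z. a i * a j * fst z powi (i + j))" if "i \<in> S" "j \<in> S" for i j
    using b[OF that(1)] b[OF that(2)] by (intro integrable_mult_right mom(2)) auto
  have int: "integrable M ?f"
    by (intro Bochner_Integration.integrable_sum int1)
  have sets: "sets M = sets borel" using M by (simp add: representing_measure_def)
  have "(\<lambda>z. fst z) \<in> borel_measurable M"
    unfolding measurable_cong_sets[OF sets refl]
    by (intro borel_measurable_continuous_onI continuous_intros)
  then have meas: "(\<lambda>z. (\<Sum>i\<in>S. a i * fst z powi i)\<^sup>2) \<in> borel_measurable M"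
    unfolding power_int_def by measurable
  show "integrable M (\<lambda>z. (\<Sum>i\<in>S. a i * fst z powi i)\<^sup>2)"
    using int by (rule integrable_cong_AE_imp[OF _ meas]) (use AE in \<open>simp add: eq_commute\<close>)
  have "bil (\<lambda>i j. m (i + j)) S a a
      = (\<Sum>i\<in>S. \<Sum>j\<in>S. integral\<^sup>L M (\<lambda>z. a i * a j * fst z powi (i + j)))"
    unfolding bil_def sum_distrib_left
  proof (intro sum.cong refl)
    fix i j assume "i \<in> S" "j \<in> S"
    then have "m (i + j) = integral\<^sup>L M (\<lambda>z. fst z powi (i + j))"
      using b[of i] b[of j] by (intro m) auto
    then show "a i * (m (i + j) * a j) = integral\<^sup>L M (\<lambda>z. a i * a j * fst z powi (i + j))"
      by simp
  qed
  also have "\<dots> = (\<Sum>i\<in>S. integral\<^sup>L M (\<lambda>z. \<Sum>j\<in>S. a i * a j * fst z powi (i + j)))"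
    by (intro sum.cong refl Bochner_Integration.integral_sum[symmetric] int1)
  also have "\<dots> = integral\<^sup>L M ?f"
    by (intro Bochner_Integration.integral_sum[symmetric] Bochner_Integration.integrable_sum int1)
  also have "\<dots> = integral\<^sup>L M (\<lambda>z. (\<Sum>i\<in>S. a i * fst z powi i)\<^sup>2)"
    by (rule integral_cong_AE[OF _ meas AE]) (use int in \<open>rule borel_measurable_integrable\<close>)
  finally show "bil (\<lambda>i j. m (i + j)) S a a = \<dots>" .
qed

lemma representing_psd:
  fixes n :: nat and m :: "int \<Rightarrow> real"
  assumes q0: "q 0 \<noteq> 0" and q4: "q 4 = 1" and M: "representing_measure q n \<beta> M"
    and m: "\<And>k. - 2 * int n \<le> k \<Longrightarrow> k \<le> 6 * int n \<Longrightarrow> m k = integral\<^sup>L M (\<lambda>z. fst z powi k)"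
    and S: "S \<subseteq> {- int n..3 * int n}"
  shows "psd_on (\<lambda>i j. m (i + j)) S"
  unfolding psd_on_def
proof
  fix a :: "int \<Rightarrow> real"
  have "bil (\<lambda>i j. m (i + j)) S a a = integral\<^sup>L M (\<lambda>z. (\<Sum>i\<in>S. a i * fst z powi i)\<^sup>2)"
    by (rule representing_bil(2)[OF q0 q4 M m S])
  then show "0 \<le> bil (\<lambda>i j. m (i + j)) S a a" by simp
qed

lemma representing_not_pd:
  fixes n :: nat and m :: "int \<Rightarrow> real"
  assumes q0: "q 0 \<noteq> 0" and q4: "q 4 = 1" and M: "representing_measure q n \<beta> M"
    and m: "\<And>k. - 2 * int n \<le> k \<Longrightarrow> k \<le> 6 * int n \<Longrightarrow> m k = integral\<^sup>L M (\<lambda>z. fst z powi k)"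
    and S: "S \<subseteq> {- int n..3 * int n}" and not_pd: "\<not> pd_on (\<lambda>i j. m (i + j)) S"
  shows "\<exists>a. (\<exists>i\<in>S. a i \<noteq> 0) \<and> (AE z in M. (\<Sum>i\<in>S. a i * fst z powi i) = 0)"
proof -
  obtain a where a: "\<exists>i\<in>S. a i \<noteq> 0" and le: "bil (\<lambda>i j. m (i + j)) S a a \<le> 0"
    using not_pd by (auto simp: pd_on_def not_less)
  have "psd_on (\<lambda>i j. m (i + j)) S" by (rule representing_psd[OF q0 q4 M m S])
  then have "bil (\<lambda>i j. m (i + j)) S a a = 0"
    using le by (simp add: psd_on_def order_antisym)
  moreover have "bil (\<lambda>i j. m (i + j)) S a a = integral\<^sup>L M (\<lambda>z. (\<Sum>i\<in>S. a i * fst z powi i)\<^sup>2)"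
    by (rule representing_bil(2)[OF q0 q4 M m S])
  moreover have "integrable M (\<lambda>z. (\<Sum>i\<in>S. a i * fst z powi i)\<^sup>2)"
    by (rule representing_bil(1)[OF q0 q4 M m S])
  ultimately have "AE z in M. (\<Sum>i\<in>S. a i * fst z powi i)\<^sup>2 = 0"
    by (simp add: integral_nonneg_eq_0_iff_AE)
  then show ?thesis using a by auto
qed

text \<open>A Laurent polynomial that vanishes almost everywhere still does so after multiplication
  by x^k. The bounds on k only ensure that all powers are integrable.\<close>

lemma representing_recurrence:
  fixes n :: nat and m :: "int \<Rightarrow> real"
  assumes q0: "q 0 \<noteq> 0" and q4: "q 4 = 1" and M: "representing_measure q n \<beta> M"
    and m: "\<And>k. - 2 * int n \<le> k \<Longrightarrow> k \<le> 6 * int n \<Longrightarrow> m k = integral\<^sup>L M (\<lambda>z. fst z powi k)"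
    and AE: "AE z in M. (\<Sum>i=i1..i2. a i * fst z powi i) = 0"
    and k: "- 2 * int n \<le> i1 + k" "i2 + k \<le> 6 * int n"
  shows "(\<Sum>i=i1..i2. a i * m (i + k)) = 0"
proof -
  have "(\<Sum>i=i1..i2. a i * m (i + k)) = (\<Sum>i=i1..i2. integral\<^sup>L M (\<lambda>z. a i * fst z powi (i + k)))"
    by (rule sum.cong) (use k in \<open>auto simp: m\<close>)
  also have "\<dots> = integral\<^sup>L M (\<lambda>z. \<Sum>i=i1..i2. a i * fst z powi (i + k))"
    by (rule Bochner_Integration.integral_sum[symmetric])
       (use k in \<open>auto intro!: integrable_mult_right integrable_fst_powi[OF q0 q4 M]\<close>)
  also have "\<dots> = 0"
  proof (rule integral_eq_zero_AE)
    show "AE z in M. (\<Sum>i=i1..i2. a i * fst z powi (i + k)) = 0"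
      using eventually_conj[OF AE AE_fst_neq_0[OF q0 q4 M]]
    proof (rule eventually_mono)
      fix z assume z: "(\<Sum>i=i1..i2. a i * fst z powi i) = 0 \<and> fst z \<noteq> 0"
      have "(\<Sum>i=i1..i2. a i * fst z powi (i + k)) = fst z powi k * (\<Sum>i=i1..i2. a i * fst z powi i)"
        unfolding sum_distrib_left
        by (intro sum.cong refl) (use z in \<open>simp add: power_int_add\<close>)
      then show "(\<Sum>i=i1..i2. a i * fst z powi (i + k)) = 0" using z by simp
    qed
  qed
  finally show ?thesis .
qed

text \<open>The null vector is cut down to its support, which makes both end coefficients nonzero as
  a relation demands.\<close>

lemma representing_kernel:
  fixes n :: nat and m :: "int \<Rightarrow> real"
  assumes q0: "q 0 \<noteq> 0" and q4: "q 4 = 1" and M: "representing_measure q n \<beta> M"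
    and m: "\<And>k. - 2 * int n \<le> k \<Longrightarrow> k \<le> 6 * int n \<Longrightarrow> m k = integral\<^sup>L M (\<lambda>z. fst z powi k)"
    and beta00: "\<beta> 0 0 > 0"
    and S: "S \<subseteq> {- int n..3 * int n}" "finite S" and not_pd: "\<not> pd_on (\<lambda>i j. m (i + j)) S"
  shows "\<exists>a i1 i2. i1 < i2 \<and> i1 \<in> S \<and> i2 \<in> S \<and> a i1 \<noteq> 0 \<and> a i2 \<noteq> 0 \<and>
    (\<forall>k. - 2 * int n \<le> i1 + k \<and> i2 + k \<le> 6 * int n \<longrightarrow> (\<Sum>i=i1..i2. a i * m (i + k)) = 0)"
proof -
  have "\<exists>a. (\<exists>i\<in>S. a i \<noteq> 0) \<and> (AE z in M. (\<Sum>i\<in>S. a i * fst z powi i) = 0)"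
    by (rule representing_not_pd[OF q0 q4 M m S(1) not_pd])
  then obtain a0 where a0: "\<exists>i\<in>S. a0 i \<noteq> 0"
    and AE0: "AE z in M. (\<Sum>i\<in>S. a0 i * fst z powi i) = 0" by blast
  define a where "a = (\<lambda>i. if i \<in> S then a0 i else 0)"
  define T where "T = {i\<in>S. a0 i \<noteq> 0}"
  have T: "finite T" "T \<noteq> {}" "T \<subseteq> S" using S a0 by (auto simp: T_def)
  define i1 where "i1 = Min T"
  define i2 where "i2 = Max T"
  have mem: "i1 \<in> T" "i2 \<in> T" using T by (simp_all add: i1_def i2_def)
  have bnd: "i1 \<le> i \<and> i \<le> i2" if "i \<in> T" for i
    using that T by (simp add: i1_def i2_def)
  have "(\<Sum>i=i1..i2. a i * x powi i) = (\<Sum>i\<in>S. a0 i * x powi i)" for x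
  proof -
    have "(\<Sum>i=i1..i2. a i * x powi i) = (\<Sum>i\<in>T. a i * x powi i)"
      by (rule sum.mono_neutral_right) (use bnd in \<open>auto simp: a_def T_def\<close>)
    also have "\<dots> = (\<Sum>i\<in>S. a i * x powi i)"
      by (rule sum.mono_neutral_left) (use S in \<open>auto simp: a_def T_def\<close>)
    finally show ?thesis by (simp add: a_def)
  qed
  then have AE: "AE z in M. (\<Sum>i=i1..i2. a i * fst z powi i) = 0" using AE0 by simp
  have rec: "(\<Sum>i=i1..i2. a i * m (i + k)) = 0"
    if "- 2 * int n \<le> i1 + k" "i2 + k \<le> 6 * int n" for k
    by (rule representing_recurrence[OF q0 q4 M m AE that])
  have nz: "i1 \<in> S" "i2 \<in> S" "a i1 \<noteq> 0" "a i2 \<noteq> 0" using mem by (auto simp: a_def T_def)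
  \<comment> \<open>A single monomial vanishing almost everywhere would, shifted to exponent 0, make
    the total mass \<open>\<beta> 0 0\<close> zero.\<close>
  have "i1 \<noteq> i2"
  proof
    assume "i1 = i2"
    then have "a i1 * m 0 = 0" using rec[of "- i1"] by simp
    moreover have "m 0 = \<beta> 0 0"
      using m[of 0] representing_curve_moment[OF q0 q4 M, of 0 0] by simp
    ultimately show False using beta00 nz by simp
  qed
  then have "i1 < i2" using bnd[OF mem(1)] by simp
  then show ?thesis using nz rec by blast
qed

text \<open>Each atom x is lifted to the unique point of the curve above it. The curve is closed, so
  its complement is an open null set and contains no point of the support.\<close>

lemma atomic_representing_measure:
  fixes X :: "real set" and w :: "real \<Rightarrow> real"
  assumes q0: "q 0 \<noteq> 0" and X: "finite X" "0 \<notin> X" and w: "\<And>x. x \<in> X \<Longrightarrow> w x \<ge> 0"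
    and g: "\<And>k. - 2 * int n \<le> k \<Longrightarrow> k \<le> 6 * int n \<Longrightarrow> g k = (\<Sum>x\<in>X. w x * x powi k)"
    and beta: "\<And>i j. i + j \<le> 2 * n \<Longrightarrow> curve_moment q g (int i) j = \<beta> i j"
  shows "\<exists>\<mu>. representing_measure q n \<beta> \<mu>"
proof -
  define Y where "Y = (\<lambda>x. \<Sum>s=0..4. q s * x powi (int s - 1))"
  define P where "P = point_measure X w"
  define f where "f = (\<lambda>x. (x, Y x))"
  define \<mu> where "\<mu> = distr P borel f"
  have f: "f \<in> measurable P borel" by (simp add: P_def)
  have meas: "(\<lambda>(x, y). x ^ i * y ^ j :: real) \<in> borel_measurable borel" for i j
    unfolding case_prod_unfold
    by (intro borel_measurable_continuous_onI continuous_intros)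
  have cl: "closed (curve q)"
  proof -
    have "curve q = (\<lambda>z. fst z * snd z - (\<Sum>s=0..4. q s * fst z ^ s)) -` {0}"
      by (auto simp: curve_def)
    also have "closed \<dots>"
      by (intro closed_vimage continuous_intros)
    finally show ?thesis .
  qed
  have fX: "f x \<in> curve q" if "x \<in> X" for x
    using that X curve_iff[where q = q, OF q0, of x "Y x"] by (auto simp: f_def Y_def)
  have "representing_measure q n \<beta> \<mu>"
    unfolding representing_measure_def
  proof (intro conjI allI impI)
    show "sets \<mu> = sets borel" by (simp add: \<mu>_def)
    show "measure_support \<mu> \<subseteq> curve q"
    proof
      fix z assume z: "z \<in> measure_support \<mu>"
      show "z \<in> curve q"
      proof (rule ccontr)
        assume "z \<notin> curve q"
        then have "emeasure \<mu> (- curve q) > 0"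
          using z cl by (auto simp: measure_support_def)
        moreover have "emeasure \<mu> (- curve q) = emeasure P (f -` (- curve q) \<inter> space P)"
          unfolding \<mu>_def by (rule emeasure_distr[OF f]) (use cl in auto)
        moreover have "f -` (- curve q) \<inter> space P = {}"
          using fX unfolding P_def space_point_measure by blast
        ultimately show False by simp
      qed
    qed
    fix i j assume ij: "i + j \<le> 2 * n"
    show "integrable \<mu> (\<lambda>(x, y). x ^ i * y ^ j)"
      unfolding \<mu>_def integrable_distr_eq[OF f meas] unfolding P_def
      by (rule integrable_point_measure_finite[OF X(1)])
    have "integral\<^sup>L \<mu> (\<lambda>(x, y). x ^ i * y ^ j) = (\<Sum>x\<in>X. w x * (x ^ i * Y x ^ j))"
      unfolding \<mu>_def integral_distr[OF f meas] unfolding P_def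
      by (subst lebesgue_integral_point_measure_finite[OF X(1) w]) (auto simp: f_def)
    also have "\<dots> = (\<Sum>x\<in>X. w x * curve_moment q (\<lambda>k. x powi k) (int i) j)"
    proof (intro sum.cong refl)
      fix x assume "x \<in> X"
      then have "x \<noteq> 0" using X by metis
      then show "w x * (x ^ i * Y x ^ j) = w x * curve_moment q (\<lambda>k. x powi k) (int i) j"
        by (simp add: curve_moment_powers[OF \<open>x \<noteq> 0\<close>] Y_def)
    qed
    also have "\<dots> = (\<Sum>t=- int j..3 * int j. qcoeff q j t * (\<Sum>x\<in>X. w x * x powi (t + int i)))"
      unfolding curve_moment_def sum_distrib_left
      by (subst sum.swap) (simp only: mult.left_commute)
    also have "\<dots> = curve_moment q g (int i) j"
      unfolding curve_moment_def by (intro sum.cong refl) (use ij in \<open>auto simp: g\<close>)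
    finally show "\<beta> i j = integral\<^sup>L \<mu> (\<lambda>(x, y). x ^ i * y ^ j)"
      using beta[OF ij] by simp
  qed
  then show ?thesis by blast
qed

section \<open>Gauss quadrature\<close>

lemma map_poly_of_real_mult:
  "map_poly complex_of_real (p * q) = map_poly complex_of_real p * map_poly complex_of_real q"
  by (rule poly_eqI) (simp add: coeff_map_poly coeff_mult)

lemma map_poly_of_real_add:
  "map_poly complex_of_real (p + q) = map_poly complex_of_real p + map_poly complex_of_real q"
  by (rule poly_eqI) (simp add: coeff_map_poly)

text \<open>The divisor is (X - z)(X - conj z). The remainder is real of degree at most 1 and
  vanishes at a non-real point, hence is zero.\<close>

lemma real_quadratic_dvd:
  fixes P :: "real poly"
  assumes root: "poly (map_poly complex_of_real P) z = 0" and im: "Im z \<noteq> 0"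
  shows "[:(Re z)\<^sup>2 + (Im z)\<^sup>2, - 2 * Re z, 1:] dvd P"
proof -
  define Q where "Q = [:(Re z)\<^sup>2 + (Im z)\<^sup>2, - 2 * Re z, 1:]"
  have Q0: "Q \<noteq> 0" "degree Q = 2" by (simp_all add: Q_def)
  have Qz: "poly (map_poly complex_of_real Q) z = 0"
    by (simp add: Q_def map_poly_pCons complex_eq_iff power2_eq_square algebra_simps)
  define R where "R = P mod Q"
  have deg: "degree R \<le> 1" using degree_mod_less[OF Q0(1), of P] Q0(2) by (auto simp: R_def)
  have "P = P div Q * Q + R" by (simp add: R_def)
  then have "poly (map_poly complex_of_real (P div Q * Q + R)) z = 0" using root by simp
  then have Rz: "poly (map_poly complex_of_real R) z = 0"
    by (simp add: map_poly_of_real_add map_poly_of_real_mult Qz)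
  have R: "R = [:poly.coeff R 0, poly.coeff R 1:]"
  proof (rule poly_eqI)
    fix i
    show "poly.coeff R i = poly.coeff [:poly.coeff R 0, poly.coeff R 1:] i"
      using deg coeff_eq_0[of R i] by (auto simp: coeff_pCons split: nat.splits)
  qed
  have "poly (map_poly complex_of_real [:poly.coeff R 0, poly.coeff R 1:]) z = 0"
    using Rz R by metis
  then have "complex_of_real (poly.coeff R 0) + z * complex_of_real (poly.coeff R 1) = 0"
    by (simp add: map_poly_pCons)
  then have "poly.coeff R 0 + Re z * poly.coeff R 1 = 0" "Im z * poly.coeff R 1 = 0"
    by (simp_all add: complex_eq_iff)
  then have "R = 0" using im by (subst R) simp
  then show ?thesis by (simp add: R_def Q_def dvd_eq_mod_eq_0)
qed

text \<open>The forbidden divisors are (X - \<alpha>)^2 + \<beta>^2: nonzero \<beta> excludes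
  conjugate pairs and \<beta> = 0 excludes double roots, so one condition makes the roots both real
  and simple.\<close>

lemma real_rooted_card:
  fixes P :: "real poly"
  assumes "P \<noteq> 0" and no_quad: "\<And>\<alpha> \<beta>. \<not> [:\<alpha>\<^sup>2 + \<beta>\<^sup>2, - 2 * \<alpha>, 1:] dvd P"
  shows "card {x. poly P x = 0} = degree P"
  using assms
proof (induction "degree P" arbitrary: P)
  case 0
  then obtain c where "P = [:c:]" "c \<noteq> 0" by (metis degree_eq_zeroE pCons_eq_0_iff)
  then show ?case using 0 by simp
next
  case (Suc k)
  have "degree (map_poly complex_of_real P) \<noteq> 0"
    using Suc.hyps(2) by (simp add: degree_map_poly)
  then have "\<not> constant (poly (map_poly complex_of_real P))"
    by (simp add: constant_degree)
  from fundamental_theorem_of_algebra[OF this]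
  obtain z where z: "poly (map_poly complex_of_real P) z = 0" by blast
  have "Im z = 0" using real_quadratic_dvd[OF z] Suc.prems(2) by blast
  then have "z = complex_of_real (Re z)" by (simp add: complex_eq_iff)
  moreover have "poly (map_poly complex_of_real P) (complex_of_real t) = complex_of_real (poly P t)" for t
    by (induction P) (simp_all add: map_poly_pCons)
  ultimately have "complex_of_real (poly P (Re z)) = 0" using z by metis
  then have "poly P (Re z) = 0" by simp
  then obtain P' where P': "P = [:- Re z, 1:] * P'" by (metis dvdE poly_eq_0_iff_dvd)
  define x where "x = Re z"
  have nz: "P' \<noteq> 0" using Suc.prems(1) P' by auto
  have deg: "degree P = Suc (degree P')"
    unfolding P' by (subst degree_mult_eq) (use nz in auto)
  have card: "card {x. poly P' x = 0} = degree P'"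
  proof (rule Suc.hyps(1))
    show "k = degree P'" using deg Suc.hyps(2) by simp
    show "\<not> [:\<alpha>\<^sup>2 + \<beta>\<^sup>2, - 2 * \<alpha>, 1:] dvd P'" for \<alpha> \<beta>
      using Suc.prems(2) P' dvd_mult by blast
  qed (rule nz)
  have "poly P' x \<noteq> 0"
  proof
    assume "poly P' x = 0"
    then have "[:- x, 1:] dvd P'" by (simp add: poly_eq_0_iff_dvd)
    then have "[:- x, 1:] * [:- x, 1:] dvd P"
      unfolding P' x_def[symmetric] by (rule mult_dvd_mono[OF dvd_refl])
    moreover have "[:- x, 1:] * [:- x, 1:] = [:x\<^sup>2 + 0\<^sup>2, - 2 * x, 1:]"
      by (simp add: power2_eq_square)
    ultimately show False using Suc.prems(2) by metis
  qed
  moreover have "{y. poly P y = 0} = insert x {y. poly P' y = 0}"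
    unfolding P' x_def by auto
  ultimately show ?case
    using card deg poly_roots_finite[OF nz] by simp
qed

text \<open>The functional sending X^s to f s. Coefficients beyond N are dropped, so it is total and
  linear, but it means what it should only up to degree N.\<close>

definition coeff_functional :: "nat \<Rightarrow> (nat \<Rightarrow> real) \<Rightarrow> real poly \<Rightarrow> real" where
  "coeff_functional N f p = (\<Sum>s\<le>N. poly.coeff p s * f s)"

lemma coeff_functional_add:
  "coeff_functional N f (p + r) = coeff_functional N f p + coeff_functional N f r"
  by (simp add: coeff_functional_def distrib_right sum.distrib)

lemma coeff_functional_diff:
  "coeff_functional N f (p - r) = coeff_functional N f p - coeff_functional N f r"
  by (simp add: coeff_functional_def left_diff_distrib sum_subtractf)

lemma coeff_functional_smult: "coeff_functional N f (Polynomial.smult c p) = c * coeff_functional N f p"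
  by (simp add: coeff_functional_def sum_distrib_left mult.assoc)

lemma coeff_functional_0: "coeff_functional N f 0 = 0"
  by (simp add: coeff_functional_def)

lemma coeff_functional_sum:
  "coeff_functional N f (\<Sum>i\<in>I. p i) = (\<Sum>i\<in>I. coeff_functional N f (p i))"
  by (induction I rule: infinite_finite_induct) (simp_all add: coeff_functional_add coeff_functional_0)

lemma coeff_functional_monom: "s \<le> N \<Longrightarrow> coeff_functional N f (monom c s) = c * f s"
  by (simp add: coeff_functional_def if_distrib[of "\<lambda>x. x * _"] cong: if_cong)

text \<open>Expresses the functional on a product through the Hankel entries f(u + v). Separate
  degree bounds serve both squares and products with the longer relation polynomial.\<close>

lemma coeff_functional_mult:
  assumes "degree p \<le> a" "degree r \<le> b" "a + b \<le> N"
  shows "coeff_functional N f (p * r) = (\<Sum>u\<le>a. poly.coeff p u * (\<Sum>v\<le>b. poly.coeff r v * f (u + v)))"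
proof -
  have "p * r = (\<Sum>u\<le>a. monom (poly.coeff p u) u) * (\<Sum>v\<le>b. monom (poly.coeff r v) v)"
    using assms by (simp only: poly_as_sum_of_monoms')
  also have "\<dots> = (\<Sum>u\<le>a. \<Sum>v\<le>b. monom (poly.coeff p u * poly.coeff r v) (u + v))"
    by (simp only: sum_product mult_monom)
  finally have "coeff_functional N f (p * r)
      = (\<Sum>u\<le>a. \<Sum>v\<le>b. coeff_functional N f (monom (poly.coeff p u * poly.coeff r v) (u + v)))"
    by (simp only: coeff_functional_sum)
  also have "\<dots> = (\<Sum>u\<le>a. \<Sum>v\<le>b. poly.coeff p u * (poly.coeff r v * f (u + v)))"
    using assms(3) by (intro sum.cong refl) (simp add: coeff_functional_monom mult.assoc)
  finally show ?thesis by (simp only: sum_distrib_left)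
qed

lemma lagrange_basis:
  fixes X :: "real set"
  assumes X: "finite X" and x: "x \<in> X"
  obtains l where "degree l < card X" "poly l x = 1" "\<And>y. y \<in> X \<Longrightarrow> y \<noteq> x \<Longrightarrow> poly l y = 0"
proof
  define l where "l = (\<Prod>y\<in>X - {x}. Polynomial.smult (1 / (x - y)) [:- y, 1:])"
  have "degree l \<le> sum (degree \<circ> (\<lambda>y. Polynomial.smult (1 / (x - y)) [:- y, 1:])) (X - {x})"
    unfolding l_def by (rule degree_prod_sum_le) (use X in simp)
  also have "\<dots> \<le> (\<Sum>y\<in>X - {x}. 1)" by (rule sum_mono) simp
  also have "\<dots> < card X" using card_Diff1_less[OF X x] by simp
  finally show "degree l < card X" .
  show "poly l x = 1" unfolding l_def poly_prod by (rule prod.neutral) (auto simp flip: diff_divide_distrib)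
  show "poly l y = 0" if "y \<in> X" "y \<noteq> x" for y
    unfolding l_def poly_prod using X that by (intro prod_zero) auto
qed

text \<open>\<open>P\<close> plays the role of the orthogonal polynomial. Multiplying \<open>P\<close> by the
  cofactor of a real quadratic divisor without sign changes would produce a nonzero sum of two squares
  on which the functional vanishes, so the roots of \<open>P\<close> are real and simple.\<close>

lemma gauss_quadrature:
  fixes f :: "nat \<Rightarrow> real" and P :: "real poly"
  assumes degP: "degree P = n" and n: "n \<ge> 1"
    and orth: "\<And>r. degree r < n \<Longrightarrow> coeff_functional (2 * n - 1) f (P * r) = 0"
    and pos: "\<And>r. degree r < n \<Longrightarrow> r \<noteq> 0 \<Longrightarrow> coeff_functional (2 * n - 1) f (r * r) > 0"
  obtains w where "\<And>x. w x \<ge> 0"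
    "\<And>s. s < n \<Longrightarrow> f s = (\<Sum>x\<in>{x. poly P x = 0}. w x * x ^ s)"
proof -
  let ?L = "coeff_functional (2 * n - 1) f"
  define X where "X = {x. poly P x = 0}"
  have P0: "P \<noteq> 0" using degP n by auto
  have finX: "finite X" unfolding X_def by (rule poly_roots_finite[OF P0])
  have nonneg: "?L (r * r) \<ge> 0" if "degree r < n" for r
    using pos[OF that] by (cases "r = 0") (auto simp: coeff_functional_0)
  have "\<not> [:\<alpha>\<^sup>2 + \<beta>\<^sup>2, - 2 * \<alpha>, 1:] dvd P" for \<alpha> \<beta>
  proof
    assume "[:\<alpha>\<^sup>2 + \<beta>\<^sup>2, - 2 * \<alpha>, 1:] dvd P"
    then obtain r where r: "P = [:\<alpha>\<^sup>2 + \<beta>\<^sup>2, - 2 * \<alpha>, 1:] * r" by (rule dvdE)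
    have r0: "r \<noteq> 0" using P0 r by auto
    have "degree P = 2 + degree r"
      unfolding r by (subst degree_mult_eq) (use r0 in auto)
    then have deg: "degree r + 1 < n" using degP by simp
    define s where "s = [:- \<alpha>, 1:] * r"
    have degs: "degree s < n"
      unfolding s_def by (subst degree_mult_eq) (use r0 deg in auto)
    have "s \<noteq> 0" using r0 unfolding s_def by (simp only: mult_eq_0_iff) simp
    have "[:\<alpha>\<^sup>2 + \<beta>\<^sup>2, - 2 * \<alpha>, 1:] = [:- \<alpha>, 1:] * [:- \<alpha>, 1:] + [:\<beta>\<^sup>2:]"
      by (simp add: power2_eq_square)
    then have "P * r = ([:- \<alpha>, 1:] * [:- \<alpha>, 1:] + [:\<beta>\<^sup>2:]) * r * r" using r by metis
    also have "\<dots> = s * s + [:\<beta>\<^sup>2:] * (r * r)"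
      unfolding s_def by (simp only: distrib_left distrib_right mult_ac)
    also have "[:\<beta>\<^sup>2:] * (r * r) = Polynomial.smult (\<beta>\<^sup>2) (r * r)" by simp
    finally have "?L (P * r) = ?L (s * s) + \<beta>\<^sup>2 * ?L (r * r)"
      by (simp add: coeff_functional_add coeff_functional_smult)
    moreover have "?L (s * s) > 0" by (rule pos[OF degs \<open>s \<noteq> 0\<close>])
    moreover have "\<beta>\<^sup>2 * ?L (r * r) \<ge> 0" using nonneg[of r] deg by simp
    ultimately show False using orth[of r] deg by simp
  qed
  then have card: "card X = n"
    unfolding X_def degP[symmetric] by (rule real_rooted_card[OF P0])
  have "\<exists>l. degree l < n \<and> poly l x = 1 \<and> (\<forall>y\<in>X. y \<noteq> x \<longrightarrow> poly l y = 0)" if x: "x \<in> X" for x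
    using lagrange_basis[OF finX x] unfolding card by metis
  then obtain l where l: "\<And>x. x \<in> X \<Longrightarrow> degree (l x) < n" "\<And>x. x \<in> X \<Longrightarrow> poly (l x) x = 1"
    "\<And>x y. x \<in> X \<Longrightarrow> y \<in> X \<Longrightarrow> y \<noteq> x \<Longrightarrow> poly (l x) y = 0" by metis
  \<comment> \<open>A polynomial vanishing at the n simple roots is a multiple of P. Up to degree
    2n-2 the cofactor has degree below n, where orthogonality applies.\<close>
  have vanish: "?L h = 0" if deg: "degree h \<le> 2 * n - 2" and h: "\<And>x. x \<in> X \<Longrightarrow> poly h x = 0" for h
  proof -
    have "h mod P = 0"
    proof (rule poly_eqI_degree[of X])
      fix x assume x: "x \<in> X"
      have "poly h x = poly (h div P * P + h mod P) x" by simp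
      then have "poly h x = poly (h div P) x * poly P x + poly (h mod P) x"
        by (simp only: poly_add poly_mult)
      then show "poly (h mod P) x = poly 0 x" using h[OF x] x by (simp add: X_def)
    next
      show "degree (h mod P) < card X"
        using degree_mod_less[OF P0, of h] degP n card by auto
    qed (use card n in simp)
    then have hP: "h = P * (h div P)" by (metis mult.commute add_0_right div_mult_mod_eq)
    show "?L h = 0"
    proof (cases "h div P = 0")
      case True
      then have "h = 0" using hP by simp
      then show ?thesis by (simp add: coeff_functional_0)
    next
      case False
      then have "degree h = n + degree (h div P)"
        using degree_mult_eq[OF P0 False] hP degP by simp
      then have "degree (h div P) < n" using deg n by linarith
      then have "?L (P * (h div P)) = 0" by (rule orth)
      then show ?thesis using hP by simp
    qed
  qed
  \<comment> \<open>Defining the weights by squares makes them nonnegative. They agree with the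
    usual L(l_x) because l_x^2 - l_x vanishes at all nodes.\<close>
  define w where "w = (\<lambda>x. if x \<in> X then ?L (l x * l x) else 0)"
  have Ll: "?L (l x) = w x" if x: "x \<in> X" for x
  proof -
    have "?L (l x * l x - l x) = 0"
    proof (rule vanish)
      have "degree (l x * l x) \<le> 2 * n - 2"
        using degree_mult_le[of "l x" "l x"] l(1)[OF x] by linarith
      then show "degree (l x * l x - l x) \<le> 2 * n - 2"
        using l(1)[OF x] n by (intro degree_diff_le) auto
      show "poly (l x * l x - l x) y = 0" if "y \<in> X" for y
        using l(2,3) x that by (cases "y = x") auto
    qed
    then show ?thesis using x by (simp add: w_def coeff_functional_diff)
  qed
  have "f s = (\<Sum>x\<in>X. w x * x ^ s)" if s: "s < n" for s
  proof -
    have "monom 1 s = (\<Sum>x\<in>X. Polynomial.smult (x ^ s) (l x))"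
    proof (rule poly_eqI_degree[of X])
      fix y assume y: "y \<in> X"
      have "poly (\<Sum>x\<in>X. Polynomial.smult (x ^ s) (l x)) y = (\<Sum>x\<in>X. x ^ s * poly (l x) y)"
        by (simp add: poly_sum)
      also have "\<dots> = (\<Sum>x\<in>X. if x = y then y ^ s else 0)"
        using l(2,3) y by (intro sum.cong refl) auto
      also have "\<dots> = y ^ s" using finX y by simp
      finally show "poly (monom 1 s) y = poly (\<Sum>x\<in>X. Polynomial.smult (x ^ s) (l x)) y"
        by (simp add: poly_monom)
    next
      show "degree (monom (1::real) s) < card X" using s card by (simp add: degree_monom_eq)
      have "degree (\<Sum>x\<in>X. Polynomial.smult (x ^ s) (l x)) \<le> n - 1"
        by (rule degree_sum_le[OF finX]) (use l(1) n degree_smult_le in \<open>fastforce intro: order_trans[OF degree_smult_le]\<close>)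
      then show "degree (\<Sum>x\<in>X. Polynomial.smult (x ^ s) (l x)) < card X" using card n by simp
    qed
    then have "?L (monom 1 s) = (\<Sum>x\<in>X. x ^ s * ?L (l x))"
      by (simp add: coeff_functional_sum coeff_functional_smult)
    also have "\<dots> = (\<Sum>x\<in>X. w x * x ^ s)"
      by (intro sum.cong refl) (metis Ll mult.commute)
    finally show ?thesis
      using s by (simp add: coeff_functional_monom)
  qed
  moreover have "w x \<ge> 0" for x
    using nonneg l(1) by (simp add: w_def)
  ultimately show ?thesis using that unfolding X_def by blast
qed

text \<open>Since both end coefficients are nonzero, the recurrence can be run upwards and
  downwards, and i2 - i1 consecutive zeros spread over L..H.\<close>

lemma recurrence_zero:
  fixes h :: "int \<Rightarrow> real"
  assumes a: "a i1 \<noteq> 0" "a i2 \<noteq> 0" and i: "i1 < i2"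
    and rec: "\<And>k. L \<le> i1 + k \<Longrightarrow> i2 + k \<le> H \<Longrightarrow> (\<Sum>i=i1..i2. a i * h (i + k)) = 0"
    and zero: "\<And>k. lo \<le> k \<Longrightarrow> k < lo + (i2 - i1) \<Longrightarrow> h k = 0"
    and lo: "L \<le> lo" "lo + (i2 - i1) \<le> H + 1"
    and k: "L \<le> k" "k \<le> H"
  shows "h k = 0"
proof -
  have up: "\<forall>k. lo \<le> k \<and> k < lo + (i2 - i1) + int m \<and> k \<le> H \<longrightarrow> h k = 0" for m
  proof (induction m)
    case 0
    then show ?case using zero by auto
  next
    case (Suc m)
    define e where "e = lo + (i2 - i1) + int m"
    have "h e = 0" if "e \<le> H"
    proof -
      have "0 = (\<Sum>i=i1..i2. a i * h (i + (e - i2)))"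
        by (rule rec[symmetric]) (use that lo in \<open>auto simp: e_def\<close>)
      also have "\<dots> = (\<Sum>i\<in>{i2}. a i * h (i + (e - i2)))"
      proof (rule sum.mono_neutral_right)
        show "\<forall>i\<in>{i1..i2} - {i2}. a i * h (i + (e - i2)) = 0"
        proof
          fix i assume "i \<in> {i1..i2} - {i2}"
          then have "lo \<le> i + (e - i2)" "i + (e - i2) < e" by (auto simp: e_def)
          then show "a i * h (i + (e - i2)) = 0" using Suc that by (simp add: e_def)
        qed
      qed (use i in auto)
      finally show ?thesis using a(2) by simp
    qed
    moreover have "k = e \<or> k < e" if "k < lo + (i2 - i1) + int (Suc m)" for k
      using that by (auto simp: e_def)
    ultimately show ?case using Suc unfolding e_def by blast
  qed
  have up': "h k = 0" if "lo \<le> k" "k \<le> H" for k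
    using up[of "nat (k - lo + 1)"] that i by auto
  have down: "\<forall>k. lo - int m \<le> k \<and> L \<le> k \<and> k \<le> H \<longrightarrow> h k = 0" for m
  proof (induction m)
    case 0
    then show ?case using up' by auto
  next
    case (Suc m)
    define e where "e = lo - int m - 1"
    have "h e = 0" if "L \<le> e"
    proof -
      have "0 = (\<Sum>i=i1..i2. a i * h (i + (e - i1)))"
        by (rule rec[symmetric]) (use that lo in \<open>auto simp: e_def\<close>)
      also have "\<dots> = (\<Sum>i\<in>{i1}. a i * h (i + (e - i1)))"
      proof (rule sum.mono_neutral_right)
        show "\<forall>i\<in>{i1..i2} - {i1}. a i * h (i + (e - i1)) = 0"
        proof
          fix i assume "i \<in> {i1..i2} - {i1}"
          then have "lo - int m \<le> i + (e - i1)" "i + (e - i1) \<le> H" "L \<le> i + (e - i1)"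
            using lo that by (auto simp: e_def)
          then show "a i * h (i + (e - i1)) = 0" using Suc by simp
        qed
      qed (use i in auto)
      finally show ?thesis using a(1) by simp
    qed
    moreover have "k = e \<or> lo - int m \<le> k" if "lo - int (Suc m) \<le> k" for k
      using that by (auto simp: e_def)
    ultimately show ?case using Suc by blast
  qed
  show ?thesis using down[of "nat (lo - k)"] up' k by (cases "k \<ge> lo") auto
qed

text \<open>Induction on the length of the relation. If the window form is definite, the polynomial
  of the relation is orthogonal for it and Gauss quadrature applies. Otherwise a null vector of the
  window yields a shorter relation valid on all of L..H. The nonzero value g z prevents the length
  from dropping to 0.\<close>

lemma psd_recurrence_atoms:
  fixes g :: "int \<Rightarrow> real"
  assumes "i1 < i2" "a i1 \<noteq> 0" "a i2 \<noteq> 0"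
    and "\<And>k. L \<le> i1 + k \<Longrightarrow> i2 + k \<le> H \<Longrightarrow> (\<Sum>i=i1..i2. a i * g (i + k)) = 0"
    and "psd_on (\<lambda>i j. g (i + j)) {lo..lo + (i2 - i1) - 1}"
    and "L \<le> 2 * lo" "2 * lo + 2 * (i2 - i1) - 1 \<le> H"
    and z: "L \<le> z" "z \<le> H" "g z \<noteq> 0"
  shows "\<exists>X w. finite X \<and> 0 \<notin> X \<and> (\<forall>x\<in>X. w x \<ge> 0) \<and>
    (\<forall>k. L \<le> k \<and> k \<le> H \<longrightarrow> g k = (\<Sum>x\<in>X. w x * x powi k))"
  using assms(1-7)
proof (induction "nat (i2 - i1)" arbitrary: i1 i2 a rule: less_induct)
  case less
  define D where "D = nat (i2 - i1)"
  have D: "int D = i2 - i1" "D \<ge> 1" using less.prems(1) by (auto simp: D_def)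
  let ?h = "\<lambda>i j. g (i + j)" and ?S = "{lo..lo + (i2 - i1) - 1}"
  have sym: "?h i j = ?h j i" for i j by (simp add: add.commute)
  note rec = less.prems(4)
  show ?case
  proof (cases "pd_on ?h ?S")
    case False
    then obtain b0 where b0: "\<exists>i\<in>?S. b0 i \<noteq> 0" and "bil ?h ?S b0 b0 \<le> 0"
      by (auto simp: pd_on_def not_less)
    then have "bil ?h ?S b0 b0 = 0"
      using less.prems(5) by (simp add: psd_on_def order_antisym)
    then have ker: "(\<Sum>j\<in>?S. g (i + j) * b0 j) = 0" if "i \<in> ?S" for i
      by (intro psd_on_kernel[of ?h] less.prems(5) that sym) auto
    define b where "b = (\<lambda>i. if i \<in> ?S then b0 i else 0)"
    define T where "T = {i\<in>?S. b0 i \<noteq> 0}"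
    have "finite T" by (rule finite_subset[of _ ?S]) (auto simp: T_def)
    moreover have "T \<noteq> {}" using b0 by (auto simp: T_def)
    ultimately have T: "finite T" "T \<noteq> {}" .
    define j1 where "j1 = Min T"
    define j2 where "j2 = Max T"
    have j1T: "j1 \<in> T" and j2T: "j2 \<in> T" using T by (simp_all add: j1_def j2_def)
    have bnd: "j1 \<le> i \<and> i \<le> j2" if "i \<in> T" for i
      using that T by (simp add: j1_def j2_def)
    have j: "lo \<le> j1" "j1 \<le> j2" "j2 \<le> lo + (i2 - i1) - 1"
      using j1T j2T bnd[OF j1T] by (auto simp: T_def)
    have bj: "b j1 \<noteq> 0" "b j2 \<noteq> 0" using j1T j2T by (auto simp: b_def T_def)
    \<comment> \<open>h is the new relation applied to g. Applying two relations commutes, so h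
      obeys the old recurrence, and the null vector gives D consecutive zeros of h; hence h vanishes
      wherever it is defined by entries in L..H.\<close>
    define h where "h = (\<lambda>k. \<Sum>j=j1..j2. b j * g (j + k))"
    have h0: "h k = 0" if k: "L - j1 \<le> k" "k \<le> H - j2" for k
    proof (rule recurrence_zero[OF less.prems(2,3,1), where L = "L - j1" and H = "H - j2" and lo = lo])
      fix k assume k: "L - j1 \<le> i1 + k" "i2 + k \<le> H - j2"
      have "(\<Sum>i=i1..i2. a i * h (i + k)) = (\<Sum>j=j1..j2. b j * (\<Sum>i=i1..i2. a i * g (i + (j + k))))"
        unfolding h_def sum_distrib_left
        by (subst sum.swap) (simp add: add.left_commute mult.left_commute)
      also have "\<dots> = 0" by (rule sum.neutral) (use k in \<open>auto intro!: rec\<close>)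
      finally show "(\<Sum>i=i1..i2. a i * h (i + k)) = 0" .
    next
      fix k assume k: "lo \<le> k" "k < lo + (i2 - i1)"
      have "h k = (\<Sum>j\<in>T. b j * g (j + k))"
        unfolding h_def by (rule sum.mono_neutral_right) (use bnd in \<open>auto simp: b_def T_def\<close>)
      also have "\<dots> = (\<Sum>j\<in>?S. b j * g (j + k))"
        by (rule sum.mono_neutral_left) (auto simp: b_def T_def)
      also have "\<dots> = (\<Sum>j\<in>?S. g (k + j) * b0 j)"
        by (rule sum.cong) (auto simp: b_def add.commute mult.commute)
      also have "\<dots> = 0" by (rule ker) (use k in auto)
      finally show "h k = 0" .
    qed (use k j less.prems(6,7) in auto)
    have "j1 \<noteq> j2"
    proof
      assume "j1 = j2"
      then have "b j1 * g z = 0" using h0[of "z - j1"] z by (simp add: h_def)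
      then show False using bj z by simp
    qed
    then have j12: "j1 < j2" using j by simp
    show ?thesis
    proof (rule less.hyps[of j2 j1 b])
      show "psd_on ?h {lo..lo + (j2 - j1) - 1}"
        by (rule psd_on_subset[OF less.prems(5)]) (use j in auto)
      show "(\<Sum>i=j1..j2. b i * g (i + k)) = 0" if "L \<le> j1 + k" "j2 + k \<le> H" for k
        using h0[of k] that by (simp add: h_def)
      show "nat (j2 - j1) < nat (i2 - i1)" using j j12 by simp
      show "2 * lo + 2 * (j2 - j1) - 1 \<le> H" using j less.prems(7) by simp
    qed (rule j12 bj less.prems(6))+
  next
    case True
    \<comment> \<open>Dividing the Laurent polynomials of the window by x^lo gives ordinary
      polynomials of degree below D, whose products see the moments from 2lo on.\<close>
    define f where "f = (\<lambda>s. g (2 * lo + int s))"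
    define P where "P = (\<Sum>s\<le>D. monom (a (i1 + int s)) s)"
    have coeffP: "poly.coeff P s = (if s \<le> D then a (i1 + int s) else 0)" for s
      unfolding P_def coeff_sum by (simp add: if_distrib cong: if_cong)
    have degP: "degree P = D"
    proof (rule antisym)
      show "degree P \<le> D" by (rule degree_le) (simp add: coeffP)
      show "D \<le> degree P" by (rule le_degree) (use D less.prems(3) in \<open>simp add: coeffP\<close>)
    qed
    have polyP: "poly P x = (\<Sum>s\<le>D. a (i1 + int s) * x ^ s)" for x
      by (simp add: P_def poly_sum poly_monom)
    have reindex: "(\<Sum>s\<le>D. \<phi> (i1 + int s)) = (\<Sum>i=i1..i2. \<phi> i)" for \<phi> :: "int \<Rightarrow> real"
      by (rule sum.reindex_bij_witness[where i = "\<lambda>i. nat (i - i1)" and j = "\<lambda>s. i1 + int s"])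
         (use D in auto)
    have reindexS: "(\<Sum>s\<le>D - 1. \<phi> (lo + int s)) = (\<Sum>i\<in>?S. \<phi> i)" for \<phi> :: "int \<Rightarrow> real"
      by (rule sum.reindex_bij_witness[where i = "\<lambda>i. nat (i - lo)" and j = "\<lambda>s. lo + int s"])
         (use D in auto)
    have orth: "coeff_functional (2 * D - 1) f (P * r) = 0" if r: "degree r < D" for r
    proof -
      have "coeff_functional (2 * D - 1) f (r * P)
          = (\<Sum>u\<le>D - 1. poly.coeff r u * (\<Sum>v\<le>D. poly.coeff P v * f (u + v)))"
        by (rule coeff_functional_mult) (use r degP D in auto)
      also have "\<dots> = 0"
      proof (rule sum.neutral, intro ballI)
        fix u assume u: "u \<in> {..D - 1}"
        have "(\<Sum>v\<le>D. poly.coeff P v * f (u + v))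
            = (\<Sum>v\<le>D. (\<lambda>i. a i * g (i + (2 * lo + int u - i1))) (i1 + int v))"
          by (rule sum.cong) (auto simp: coeffP f_def algebra_simps)
        also have "\<dots> = (\<Sum>i=i1..i2. a i * g (i + (2 * lo + int u - i1)))" by (rule reindex)
        also have "\<dots> = 0"
          \<comment> \<open>The largest index reached, for u = D-1, is 2lo + 2D - 1; this is the
            upper bound in the hypotheses.\<close>
          by (rule rec) (use u D less.prems(6,7) in auto)
        finally show "poly.coeff r u * (\<Sum>v\<le>D. poly.coeff P v * f (u + v)) = 0" by simp
      qed
      finally show ?thesis by (simp add: mult.commute)
    qed
    have pos: "coeff_functional (2 * D - 1) f (r * r) > 0" if r: "degree r < D" "r \<noteq> 0" for r
    proof -
      define c where "c = (\<lambda>i. poly.coeff r (nat (i - lo)))"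
      have "coeff_functional (2 * D - 1) f (r * r)
          = (\<Sum>u\<le>D - 1. poly.coeff r u * (\<Sum>v\<le>D - 1. poly.coeff r v * f (u + v)))"
        by (rule coeff_functional_mult) (use r in auto)
      also have "\<dots> = (\<Sum>u\<le>D - 1. (\<lambda>i. c i * (\<Sum>j\<in>?S. g (i + j) * c j)) (lo + int u))"
      proof (intro sum.cong refl)
        fix u
        have "(\<Sum>v\<le>D - 1. poly.coeff r v * f (u + v))
            = (\<Sum>v\<le>D - 1. (\<lambda>j. g (lo + int u + j) * c j) (lo + int v))"
          by (intro sum.cong refl) (simp add: c_def f_def algebra_simps)
        also have "\<dots> = (\<Sum>j\<in>?S. g (lo + int u + j) * c j)" by (rule reindexS)
        finally show "poly.coeff r u * (\<Sum>v\<le>D - 1. poly.coeff r v * f (u + v))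
            = (\<lambda>i. c i * (\<Sum>j\<in>?S. g (i + j) * c j)) (lo + int u)"
          by (simp add: c_def)
      qed
      also have "\<dots> = bil ?h ?S c c"
        unfolding bil_def by (rule reindexS)
      finally have eq: "coeff_functional (2 * D - 1) f (r * r) = bil ?h ?S c c" .
      have "c (lo + int (degree r)) \<noteq> 0" using r by (simp add: c_def)
      moreover have "lo + int (degree r) \<in> ?S" using r D by auto
      ultimately show ?thesis unfolding eq using True unfolding pd_on_def by blast
    qed
    obtain w where w: "\<And>x. w x \<ge> 0" "\<And>s. s < D \<Longrightarrow> f s = (\<Sum>x\<in>{x. poly P x = 0}. w x * x ^ s)"
      by (rule gauss_quadrature[OF degP D(2) orth pos]) (assumption, assumption, assumption, rule that)
    define X where "X = {x. poly P x = 0}"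
    have "P \<noteq> 0" using degP D by auto
    then have finX: "finite X" unfolding X_def by (rule poly_roots_finite)
    have "poly P 0 = a i1" by (simp add: poly_0_coeff_0 coeffP)
    then have X0: "0 \<notin> X" using less.prems(2) by (simp add: X_def)
    then have nz: "x \<noteq> 0" if "x \<in> X" for x using that by metis
    \<comment> \<open>Undoes the shift by 2lo. The exponent is even, so the weights stay nonnegative
      at negative atoms too.\<close>
    define w' where "w' = (\<lambda>x. w x * x powi (- 2 * lo))"
    have w'0: "w' x \<ge> 0" for x
    proof -
      have "x powi (- 2 * lo) = (x powi (- lo))\<^sup>2"
        using power_int_mult[of x "- lo" 2] by (simp add: mult.commute)
      then show ?thesis using w(1) by (simp add: w'_def)
    qed
    \<comment> \<open>Quadrature matches D consecutive values; both sequences satisfy the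
      recurrence, so they agree on all of L..H.\<close>
    have "g k - (\<Sum>x\<in>X. w' x * x powi k) = 0" if k: "L \<le> k" "k \<le> H" for k
    proof (rule recurrence_zero[OF less.prems(2,3,1), where L = L and H = H and lo = "2 * lo"
          and h = "\<lambda>k. g k - (\<Sum>x\<in>X. w' x * x powi k)"])
      fix k assume k: "L \<le> i1 + k" "i2 + k \<le> H"
      have "(\<Sum>i=i1..i2. a i * x powi (i + k)) = 0" if x: "x \<in> X" for x
      proof -
        have "(\<Sum>i=i1..i2. a i * x powi (i + k)) = (\<Sum>s\<le>D. (\<lambda>i. a i * x powi (i + k)) (i1 + int s))"
          by (rule reindex[symmetric])
        also have "\<dots> = (\<Sum>s\<le>D. x powi (i1 + k) * (a (i1 + int s) * x ^ s))"
        proof (rule sum.cong)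
          fix s
          have "i1 + int s + k = (i1 + k) + int s" by simp
          then have "x powi (i1 + int s + k) = x powi (i1 + k) * x ^ s"
            using nz[OF x] by (simp only: power_int_add power_int_of_nat simp_thms)
          then show "(\<lambda>i. a i * x powi (i + k)) (i1 + int s) = x powi (i1 + k) * (a (i1 + int s) * x ^ s)"
            by simp
        qed simp
        also have "\<dots> = x powi (i1 + k) * poly P x" by (simp add: polyP sum_distrib_left)
        finally show ?thesis using x by (simp add: X_def)
      qed
      then have "(\<Sum>x\<in>X. w' x * (\<Sum>i=i1..i2. a i * x powi (i + k))) = 0" by simp
      moreover have "(\<Sum>i=i1..i2. a i * (\<Sum>x\<in>X. w' x * x powi (i + k)))
          = (\<Sum>x\<in>X. w' x * (\<Sum>i=i1..i2. a i * x powi (i + k)))"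
        unfolding sum_distrib_left by (subst sum.swap) (simp only: mult.left_commute)
      ultimately show "(\<Sum>i=i1..i2. a i * (g (i + k) - (\<Sum>x\<in>X. w' x * x powi (i + k)))) = 0"
        using rec[OF k] by (simp add: right_diff_distrib sum_subtractf)
    next
      fix k assume k: "2 * lo \<le> k" "k < 2 * lo + (i2 - i1)"
      define s where "s = nat (k - 2 * lo)"
      have s: "k = 2 * lo + int s" "s < D" using k D by (auto simp: s_def)
      have "g k = (\<Sum>x\<in>X. w x * x ^ s)" using w(2)[OF s(2)] s(1) by (simp add: f_def X_def)
      also have "\<dots> = (\<Sum>x\<in>X. w' x * x powi k)"
      proof (rule sum.cong)
        fix x assume x: "x \<in> X"
        have "x powi (- 2 * lo) * x powi k = x powi (- 2 * lo + k)"
          by (rule power_int_add[symmetric]) (use nz[OF x] in simp)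
        also have "- 2 * lo + k = int s" using s by simp
        finally show "w x * x ^ s = w' x * x powi k" by (simp add: w'_def mult.assoc)
      qed simp
      finally show "g k - (\<Sum>x\<in>X. w' x * x powi k) = 0" by simp
    qed (use k less.prems in auto)
    then show ?thesis
      using finX X0 w'0 by (intro exI[of _ X] exI[of _ w']) auto
  qed
qed

section \<open>The main theorem\<close>

lemma satisfied_hankel_cong:
  "hankel f lo hi = hankel g lo hi \<Longrightarrow> satisfied f lo hi i1 i2 a \<longleftrightarrow> satisfied g lo hi i1 i2 a"
  by (simp add: satisfied_def)

text \<open>A propagated relation allows every Laurent polynomial to be reduced to any window of
  \<open>i2 - i1\<close> consecutive exponents, so positivity on one such window suffices.\<close>

lemma propagates_imp_representing_measure:
  fixes n :: nat
  assumes q0: "q 0 \<noteq> 0" and q4: "q 4 = 1" and n: "n \<ge> 1" and beta00: "\<beta> 0 0 > 0"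
    and beta_rec: "\<And>i j. i \<ge> 1 \<Longrightarrow> j \<ge> 1 \<Longrightarrow> i + j \<le> 2 * n - 2 \<Longrightarrow>
          \<beta> i j = (\<Sum>s=0..4. q s * \<beta> (i - 1 + s) (j - 1))"
    and rel: "propagates n (gamma q \<beta> n t1 t2 t3) i1 i2 a"
    and psd: "pos_semidef (hankel (gamma q \<beta> n t1 t2 t3) lo hi)"
    and lo: "- int n \<le> lo" "lo + (i2 - i1) \<le> hi + 1" "lo + (i2 - i1) \<le> 3 * int n"
  shows "\<exists>\<mu>. representing_measure q n \<beta> \<mu>"
proof -
  define g where "g = gamma q \<beta> n t1 t2 t3"
  have mom: "curve_moment q g (int i) j = \<beta> i j" if "i + j \<le> 2 * n" for i j
    unfolding g_def by (rule gamma_moments[OF q0 q4 n _ that]) (rule beta_rec)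
  have P: "- int n \<le> i1" "i1 < i2" "i2 \<le> 3 * int n" "a i1 \<noteq> 0" "a i2 \<noteq> 0"
    "\<And>k. - 2 * int n \<le> i1 + k \<Longrightarrow> i2 + k \<le> 6 * int n \<Longrightarrow> (\<Sum>i=i1..i2. a i * g (i + k)) = 0"
    using rel unfolding propagates_iff g_def[symmetric] by blast+
  have "psd_on (\<lambda>i j. g (i + j)) {lo..lo + (i2 - i1) - 1}"
    using psd unfolding pos_semidef_hankel_iff g_def[symmetric]
    by (rule psd_on_subset) (use lo in auto)
  moreover have "g 0 \<noteq> 0" using mom[of 0 0] beta00 by simp
  ultimately have "\<exists>X w. finite X \<and> 0 \<notin> X \<and> (\<forall>x\<in>X. w x \<ge> 0) \<and>
      (\<forall>k. - 2 * int n \<le> k \<and> k \<le> 6 * int n \<longrightarrow> g k = (\<Sum>x\<in>X. w x * x powi k))"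
    by (intro psd_recurrence_atoms[of i1 i2 a "- 2 * int n" "6 * int n" g lo 0] P) (use lo in auto)
  then obtain X w where X: "finite X" "0 \<notin> X" "\<And>x. x \<in> X \<Longrightarrow> w x \<ge> 0"
    "\<And>k. - 2 * int n \<le> k \<Longrightarrow> k \<le> 6 * int n \<Longrightarrow> g k = (\<Sum>x\<in>X. w x * x powi k)"
    by blast
  show ?thesis
    by (rule atomic_representing_measure[OF q0 X mom])
qed

text \<open>The difference of the two sequences satisfies the recurrence and vanishes on the 8n-5
  entries determined by \<open>\<beta>\<close> alone. These are at least 4n-2, the greatest length
  of a relation in F_1, so the difference is zero.\<close>

lemma propagates_unique:
  fixes n :: nat
  assumes n: "n \<ge> 1" and D: "i2 - i1 \<le> 4 * int n - 2"
    and t: "propagates n (gamma q \<beta> n t1 t2 t3) i1 i2 a"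
    and s: "propagates n (gamma q \<beta> n s1 s2 s3) i1 i2 a"
  shows "s1 = t1 \<and> s2 = t2 \<and> s3 = t3"
proof -
  define h where "h = (\<lambda>k. gamma q \<beta> n s1 s2 s3 k - gamma q \<beta> n t1 t2 t3 k)"
  have P: "i1 < i2" "a i1 \<noteq> 0" "a i2 \<noteq> 0" using t by (auto simp: propagates_iff)
  have "h k = 0" if "- 2 * int n \<le> k" "k \<le> 6 * int n" for k
  proof (rule recurrence_zero[OF P(2,3,1), where L = "- 2 * int n" and H = "6 * int n"
        and lo = "- 2 * int n + 2" and h = h])
    show "(\<Sum>i=i1..i2. a i * h (i + k)) = 0"
      if k: "- 2 * int n \<le> i1 + k" "i2 + k \<le> 6 * int n" for k
    proof -
      have "(\<Sum>i=i1..i2. a i * gamma q \<beta> n s1 s2 s3 (i + k)) = 0"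
        using s k unfolding propagates_iff by blast
      moreover have "(\<Sum>i=i1..i2. a i * gamma q \<beta> n t1 t2 t3 (i + k)) = 0"
        using t k unfolding propagates_iff by blast
      ultimately show ?thesis
        unfolding h_def right_diff_distrib sum_subtractf by (simp only: diff_self)
    qed
    show "h k = 0" if "- 2 * int n + 2 \<le> k" "k < - 2 * int n + 2 + (i2 - i1)" for k
      using that D n by (simp add: h_def gamma_eq_gamma1 gamma1_eq_gamma0)
    show "- 2 * int n + 2 + (i2 - i1) \<le> 6 * int n + 1" using n D by linarith
    show "- 2 * int n \<le> - 2 * int n + 2" by simp
  qed (rule that)+
  from this[of "6 * int n - 3"] this[of "6 * int n - 1"] this[of "6 * int n"] show ?thesis
    using n by (simp add: h_def gamma_def gamma1_def Let_def)
qed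

text \<open>If the relation did not use both extreme labels, it or its shift by one would be a relation in
  \<open>F\<^sub>2\<close>.\<close>

lemma kernel_extreme_labels:
  fixes n :: nat and g :: "int \<Rightarrow> real"
  assumes pd: "pos_def (hankel g (- int n + 1) (3 * int n))"
    and rel: "propagates n g i1 i2 a"
  shows "i1 = - int n \<and> i2 = 3 * int n"
proof (rule ccontr)
  assume neg: "\<not> (i1 = - int n \<and> i2 = 3 * int n)"
  have P: "- int n \<le> i1" "i1 < i2" "i2 \<le> 3 * int n" "a i1 \<noteq> 0"
    "\<And>k. - 2 * int n \<le> i1 + k \<Longrightarrow> i2 + k \<le> 6 * int n \<Longrightarrow> (\<Sum>i=i1..i2. a i * g (i + k)) = 0"
    using rel unfolding propagates_iff by blast+
  \<comment> \<open>A relation starting at -n ends below 3n, so it can be moved up by one; any other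
    already avoids the label -n.\<close>
  define \<delta> :: int where "\<delta> = (if i1 = - int n then 1 else 0)"
  have \<delta>: "- int n + 1 \<le> i1 + \<delta>" "i2 + \<delta> \<le> 3 * int n"
    using P neg by (auto simp: \<delta>_def)
  let ?S = "{- int n + 1..3 * int n}"
  define b where "b = (\<lambda>i. if i1 + \<delta> \<le> i \<and> i \<le> i2 + \<delta> then a (i - \<delta>) else 0)"
  have "(\<Sum>j\<in>?S. g (i + j) * b j) = 0" if i: "i \<in> ?S" for i
  proof -
    have "(\<Sum>j\<in>?S. g (i + j) * b j) = (\<Sum>j=i1 + \<delta>..i2 + \<delta>. g (i + j) * b j)"
      by (rule sum.mono_neutral_right) (use \<delta> in \<open>auto simp: b_def\<close>)
    also have "\<dots> = (\<Sum>j=i1..i2. a j * g (j + (i + \<delta>)))"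
      by (rule sum.reindex_bij_witness[where i = "\<lambda>j. j + \<delta>" and j = "\<lambda>j. j - \<delta>"])
         (auto simp: b_def algebra_simps)
    also have "\<dots> = 0" by (rule P(5)) (use i \<delta> in auto)
    finally show ?thesis .
  qed
  then have "bil (\<lambda>i j. g (i + j)) ?S b b = 0" by (simp add: bil_def)
  moreover have "b (i1 + \<delta>) \<noteq> 0" "i1 + \<delta> \<in> ?S" using P \<delta> by (auto simp: b_def)
  ultimately show False
    using pd unfolding pos_def_hankel_iff pd_on_def by (metis less_irrefl)
qed

theorem theorem4p2:
  fixes q :: "nat \<Rightarrow> real" and \<beta> :: "nat \<Rightarrow> nat \<Rightarrow> real" and n :: nat
  assumes q0: "q 0 \<noteq> 0" and q4: "q 4 = 1"
    and n: "n \<ge> 1"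
    and beta00: "\<beta> 0 0 > 0"
    and beta_rec: "\<And>i j. i \<ge> 1 \<Longrightarrow> j \<ge> 1 \<Longrightarrow> i + j \<le> 2 * n - 2 \<Longrightarrow>
          \<beta> i j = (\<Sum>s=0..4. q s * \<beta> (i - 1 + s) (j - 1))"
    and excluded: "\<not> (pos_def (C_mat q \<beta> n) \<and> (\<exists>t. d q \<beta> n t = 0) \<and>
          (\<exists>t1 t2 t3. t1 \<in> {t1_minus q \<beta> n<..<t1_plus q \<beta> n} \<and>
             t3 > Phi q \<beta> n t1 t2 \<and>
             gamma q \<beta> n t1 t2 t3 (- 2 * int n) > Psi q \<beta> n t1 t2 t3))"
  shows "(\<exists>\<mu>. representing_measure q n \<beta> \<mu>) \<longleftrightarrow>
    \<comment> \<open>(i)\<close>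
    (pos_semidef (C_mat q \<beta> n) \<and> \<not> pos_def (C_mat q \<beta> n) \<and>
      (\<exists>i1 i2 a. satisfied (gamma0 q \<beta> n) (- int n + 1) (3 * int n - 2) i1 i2 a \<and>
        (\<exists>!t. case t of (t1, t2, t3) \<Rightarrow> propagates n (gamma q \<beta> n t1 t2 t3) i1 i2 a))) \<or>
    \<comment> \<open>(ii)\<close>
    (pos_def (C_mat q \<beta> n) \<and> (\<exists>t. d q \<beta> n t = 0) \<and>
      (\<exists>i1 i2 a. satisfied (gamma1 q \<beta> n (t1_minus q \<beta> n))
                    (- int n + 1) (3 * int n - 1) i1 i2 a \<and>
        (\<exists>!t. case t of (t2, t3) \<Rightarrow>
           propagates n (gamma q \<beta> n (t1_minus q \<beta> n) t2 t3) i1 i2 a))) \<or>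
    \<comment> \<open>(iii)\<close>
    (pos_def (C_mat q \<beta> n) \<and> (\<exists>t. d q \<beta> n t = 0) \<and>
      (\<exists>i1 i2 a. satisfied (gamma1 q \<beta> n (t1_plus q \<beta> n))
                    (- int n + 1) (3 * int n - 1) i1 i2 a \<and>
        (\<exists>!t. case t of (t2, t3) \<Rightarrow>
           propagates n (gamma q \<beta> n (t1_plus q \<beta> n) t2 t3) i1 i2 a))) \<or>
    \<comment> \<open>(iv)\<close>
    (pos_def (C_mat q \<beta> n) \<and> (\<exists>t. d q \<beta> n t = 0) \<and>
      (\<exists>t1 t2 t3. t1 \<in> {t1_minus q \<beta> n<..<t1_plus q \<beta> n} \<and> t3 = Phi q \<beta> n t1 t2 \<and>
        (\<exists>i1 i2 a.
           satisfied (gamma q \<beta> n t1 t2 t3) (- int n + 1) (3 * int n) i1 i2 a \<and>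
           propagates n (gamma q \<beta> n t1 t2 t3) i1 i2 a))) \<or>
    \<comment> \<open>(v)\<close>
    (pos_def (C_mat q \<beta> n) \<and> (\<exists>t. d q \<beta> n t = 0) \<and>
      (\<exists>t1 t2 t3. t1 \<in> {t1_minus q \<beta> n<..<t1_plus q \<beta> n} \<and> t3 > Phi q \<beta> n t1 t2 \<and>
        gamma q \<beta> n t1 t2 t3 (- 2 * int n) = Psi q \<beta> n t1 t2 t3 \<and>
        (\<exists>i1 i2 a. satisfied (gamma q \<beta> n t1 t2 t3) (- int n) (3 * int n) i1 i2 a \<and>
           i1 = - int n \<and> i2 = 3 * int n)))"
  (is "?M \<longleftrightarrow> ?i \<or> ?ii \<or> ?iii \<or> ?iv \<or> ?v")
proof
  have measureI: ?M if "propagates n (gamma q \<beta> n t1 t2 t3) i1 i2 a"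
    "pos_semidef (hankel (gamma q \<beta> n t1 t2 t3) lo hi)"
    "- int n \<le> lo" "lo + (i2 - i1) \<le> hi + 1" "lo + (i2 - i1) \<le> 3 * int n" for t1 t2 t3 i1 i2 a lo hi
    by (rule propagates_imp_representing_measure[OF q0 q4 n beta00 _ that]) (rule beta_rec)
  have pd_psd: "pos_semidef (hankel g lo hi)" if "pos_def (hankel g lo hi)" for g lo hi
    using that unfolding pos_def_hankel_iff pos_semidef_hankel_iff by (rule pd_on_imp_psd_on)
  \<comment> \<open>A relation within -n+1..3n-1 has length at most 4n-2, so the labels of C already
    contain a full window. This settles (i) to (iii) together.\<close>
  have from_C: ?M if "pos_semidef (C_mat q \<beta> n)" "- int n + 1 \<le> i1" "i2 \<le> 3 * int n - 1"
    and rel: "propagates n (gamma q \<beta> n t1 t2 t3) i1 i2 a" for t1 t2 t3 i1 i2 a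
  proof (rule measureI)
    show "propagates n (gamma q \<beta> n t1 t2 t3) i1 i2 a" by (rule rel)
    show "pos_semidef (hankel (gamma q \<beta> n t1 t2 t3) (- int n + 1) (3 * int n - 2))"
      using that(1) unfolding C_mat_eq[of q \<beta> n t1 t2 t3] .
  qed (use that in auto)
  assume "?i \<or> ?ii \<or> ?iii \<or> ?iv \<or> ?v"
  then consider ?i | ?ii | ?iii | ?iv | ?v by blast
  then show ?M
  proof cases
    case 1
    then obtain i1 i2 a t1 t2 t3 where "pos_semidef (C_mat q \<beta> n)"
      "satisfied (gamma0 q \<beta> n) (- int n + 1) (3 * int n - 2) i1 i2 a"
      "propagates n (gamma q \<beta> n t1 t2 t3) i1 i2 a" by auto
    then show ?thesis by (intro from_C) (auto simp: satisfied_iff)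
  next
    case 2
    then obtain i1 i2 a t2 t3 where *: "pos_def (C_mat q \<beta> n)"
      "satisfied (gamma1 q \<beta> n (t1_minus q \<beta> n)) (- int n + 1) (3 * int n - 1) i1 i2 a"
      "propagates n (gamma q \<beta> n (t1_minus q \<beta> n) t2 t3) i1 i2 a" by auto
    have "pos_semidef (C_mat q \<beta> n)" using *(1) unfolding C_mat_def by (rule pd_psd)
    then show ?thesis using * by (intro from_C) (auto simp: satisfied_iff)
  next
    case 3
    then obtain i1 i2 a t2 t3 where *: "pos_def (C_mat q \<beta> n)"
      "satisfied (gamma1 q \<beta> n (t1_plus q \<beta> n)) (- int n + 1) (3 * int n - 1) i1 i2 a"
      "propagates n (gamma q \<beta> n (t1_plus q \<beta> n) t2 t3) i1 i2 a" by auto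
    have "pos_semidef (C_mat q \<beta> n)" using *(1) unfolding C_mat_def by (rule pd_psd)
    then show ?thesis using * by (intro from_C) (auto simp: satisfied_iff)
  next
    case 4
    then obtain t1 t2 t3 i1 i2 a where C: "pos_def (C_mat q \<beta> n)" and d: "\<exists>t. d q \<beta> n t = 0"
      and t1: "t1_minus q \<beta> n < t1" "t1 < t1_plus q \<beta> n"
      and sat: "satisfied (gamma q \<beta> n t1 t2 t3) (- int n + 1) (3 * int n) i1 i2 a"
      and rel: "propagates n (gamma q \<beta> n t1 t2 t3) i1 i2 a" by auto
    \<comment> \<open>The relation lies in F_2, so its length is at most 4n-1, the number of labels
      of F_1.\<close>
    have "pos_def (F1_mat q \<beta> n t1)" by (rule F1_pd_between[OF n C d t1])
    then have "pos_semidef (hankel (gamma q \<beta> n t1 t2 t3) (- int n + 1) (3 * int n - 1))"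
      unfolding F1_mat_eq[of q \<beta> n t1 t2 t3] by (rule pd_psd)
    then show ?thesis
      by (rule measureI[OF rel]) (use sat in \<open>auto simp: satisfied_iff\<close>)
  next
    case 5
    then obtain t1 t2 t3 a where C: "pos_def (C_mat q \<beta> n)" and d: "\<exists>t. d q \<beta> n t = 0"
      and t1: "t1_minus q \<beta> n < t1" "t1 < t1_plus q \<beta> n"
      and t3: "Phi q \<beta> n t1 t2 < t3"
      and Psi: "gamma q \<beta> n t1 t2 t3 (- 2 * int n) = Psi q \<beta> n t1 t2 t3"
      and sat: "satisfied (gamma q \<beta> n t1 t2 t3) (- int n) (3 * int n) (- int n) (3 * int n) a"
      by auto
    have F1: "pos_def (F1_mat q \<beta> n t1)" by (rule F1_pd_between[OF n C d t1])
    have F2: "pos_def (hankel (gamma q \<beta> n t1 t2 t3) (- int n + 1) (3 * int n))"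
      using t3 unfolding Phi_iff(2)[OF n C F1] .
    have A: "pos_semidef (hankel (gamma q \<beta> n t1 t2 t3) (- int n) (3 * int n))"
      unfolding Psi_iff(1)[OF n F1 F2] using Psi by simp
    \<comment> \<open>A relation using both extreme labels has no room to shift, so being satisfied
      is already propagation.\<close>
    have rel: "propagates n (gamma q \<beta> n t1 t2 t3) (- int n) (3 * int n) a"
      using sat by (simp add: propagates_def)
    show ?thesis by (rule measureI[OF rel A]) auto
  qed
next
  assume ?M
  then obtain M where M: "representing_measure q n \<beta> M" by blast
  define m where "m = (\<lambda>k. integral\<^sup>L M (\<lambda>z. fst z powi k))"
  \<comment> \<open>The three free entries are read off from the measure;
    \<open>gamma_unique\<close> then identifies the remaining moments.\<close>
  define t1 where "t1 = m (6 * int n - 3)"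
  define t2 where "t2 = m (6 * int n - 1)"
  define t3 where "t3 = m (6 * int n)"
  define g where "g = gamma q \<beta> n t1 t2 t3"
  have g: "g k = integral\<^sup>L M (\<lambda>z. fst z powi k)" if "- 2 * int n \<le> k" "k \<le> 6 * int n" for k
  proof -
    have mom: "curve_moment q m (int i) j = \<beta> i j" if "i + j \<le> 2 * n" for i j
      unfolding m_def by (rule representing_curve_moment[OF q0 q4 M that])
    have "g k = m k"
      unfolding g_def t1_def t2_def t3_def
      by (rule gamma_unique[OF q0 q4 n _ _ that]) (rule beta_rec, assumption+, rule mom)
    then show ?thesis by (simp add: m_def)
  qed
  have psd: "pos_semidef (hankel g lo hi)" if "- int n \<le> lo" "hi \<le> 3 * int n" for lo hi
    unfolding pos_semidef_hankel_iff
    by (rule representing_psd[OF q0 q4 M g]) (use that in auto)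
  have kernel: "\<exists>i1 i2 a. satisfied g lo hi i1 i2 a \<and> propagates n g i1 i2 a"
    if lohi: "- int n \<le> lo" "hi \<le> 3 * int n" and npd: "\<not> pos_def (hankel g lo hi)" for lo hi
  proof -
    have S: "{lo..hi} \<subseteq> {- int n..3 * int n}" "finite {lo..hi}" using lohi by auto
    have "\<exists>a i1 i2. i1 < i2 \<and> i1 \<in> {lo..hi} \<and> i2 \<in> {lo..hi} \<and> a i1 \<noteq> 0 \<and> a i2 \<noteq> 0 \<and>
      (\<forall>k. - 2 * int n \<le> i1 + k \<and> i2 + k \<le> 6 * int n \<longrightarrow> (\<Sum>i=i1..i2. a i * g (i + k)) = 0)"
      by (rule representing_kernel[OF q0 q4 M g beta00 S npd[unfolded pos_def_hankel_iff]])
    then obtain a i1 i2 where "i1 < i2" "i1 \<in> {lo..hi}" "i2 \<in> {lo..hi}" "a i1 \<noteq> 0" "a i2 \<noteq> 0"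
      "\<And>k. - 2 * int n \<le> i1 + k \<Longrightarrow> i2 + k \<le> 6 * int n \<Longrightarrow> (\<Sum>i=i1..i2. a i * g (i + k)) = 0"
      by blast
    then have "satisfied g lo hi i1 i2 a" "propagates n g i1 i2 a"
      using lohi by (auto simp: satisfied_iff propagates_iff)
    then show ?thesis by blast
  qed
  have C: "C_mat q \<beta> n = hankel g (- int n + 1) (3 * int n - 2)"
    unfolding g_def by (rule C_mat_eq)
  have F1: "F1_mat q \<beta> n t1 = hankel g (- int n + 1) (3 * int n - 1)"
    unfolding g_def by (rule F1_mat_eq)
  show "?i \<or> ?ii \<or> ?iii \<or> ?iv \<or> ?v"
  proof (cases "pos_def (C_mat q \<beta> n)")
    case False
    then obtain i1 i2 a where sat: "satisfied g (- int n + 1) (3 * int n - 2) i1 i2 a"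
      and rel: "propagates n g i1 i2 a"
      using kernel[of "- int n + 1" "3 * int n - 2"] n unfolding C by auto
    have "pos_semidef (C_mat q \<beta> n)" unfolding C by (rule psd) auto
    moreover have "satisfied (gamma0 q \<beta> n) (- int n + 1) (3 * int n - 2) i1 i2 a"
      using sat satisfied_hankel_cong[OF C[unfolded C_mat_def]] by blast
    moreover have "\<exists>!t. case t of (t1, t2, t3) \<Rightarrow> propagates n (gamma q \<beta> n t1 t2 t3) i1 i2 a"
    proof (rule ex1I[of _ "(t1, t2, t3)"])
      show "case (t1, t2, t3) of (t1, t2, t3) \<Rightarrow> propagates n (gamma q \<beta> n t1 t2 t3) i1 i2 a"
        using rel by (simp add: g_def)
      show "s = (t1, t2, t3)"
        if "case s of (t1, t2, t3) \<Rightarrow> propagates n (gamma q \<beta> n t1 t2 t3) i1 i2 a" for s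
        using that propagates_unique[OF n _ rel[unfolded g_def], of "fst s" "fst (snd s)" "snd (snd s)"]
          sat by (auto simp: satisfied_iff)
    qed
    ultimately have ?i using False by blast
    then show ?thesis by blast
  next
    case pdC: True
    have "pos_semidef (F1_mat q \<beta> n t1)" unfolding F1 by (rule psd) auto
    from F1_psd_bounds[OF n pdC this]
    have d: "\<exists>t. d q \<beta> n t = 0" and t1: "t1_minus q \<beta> n \<le> t1" "t1 \<le> t1_plus q \<beta> n" by auto
    \<comment> \<open>Shared by the two endpoints, where F_1 is singular: its relation has length at
      most 4n-2, so \<open>propagates_unique\<close> gives the uniqueness of (t2, t3).\<close>
    have singular: "\<exists>i1 i2 a. satisfied (gamma1 q \<beta> n t1) (- int n + 1) (3 * int n - 1) i1 i2 a \<and>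
        (\<exists>!t. case t of (t2, t3) \<Rightarrow> propagates n (gamma q \<beta> n t1 t2 t3) i1 i2 a)"
      if "d q \<beta> n t1 = 0"
    proof -
      have "\<not> pos_def (hankel g (- int n + 1) (3 * int n - 1))"
        using that det_hankel_neq_0 unfolding d_def F1 by blast
      then obtain i1 i2 a where sat: "satisfied g (- int n + 1) (3 * int n - 1) i1 i2 a"
        and rel: "propagates n g i1 i2 a"
        using kernel[of "- int n + 1" "3 * int n - 1"] by auto
      have "satisfied (gamma1 q \<beta> n t1) (- int n + 1) (3 * int n - 1) i1 i2 a"
        using sat satisfied_hankel_cong[OF F1[unfolded F1_mat_def]] by blast
      moreover have "\<exists>!t. case t of (t2, t3) \<Rightarrow> propagates n (gamma q \<beta> n t1 t2 t3) i1 i2 a"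
      proof (rule ex1I[of _ "(t2, t3)"])
        show "case (t2, t3) of (t2, t3) \<Rightarrow> propagates n (gamma q \<beta> n t1 t2 t3) i1 i2 a"
          using rel by (simp add: g_def)
        show "s = (t2, t3)"
          if "case s of (t2, t3) \<Rightarrow> propagates n (gamma q \<beta> n t1 t2 t3) i1 i2 a" for s
          using that propagates_unique[OF n _ rel[unfolded g_def], of t1 "fst s" "snd s"]
            sat by (auto simp: satisfied_iff)
      qed
      ultimately show ?thesis by blast
    qed
    consider "t1 = t1_minus q \<beta> n" | "t1 = t1_plus q \<beta> n"
      | "t1_minus q \<beta> n < t1" "t1 < t1_plus q \<beta> n"
      using t1 by linarith
    then show ?thesis
    proof cases
      case 1
      then have ?ii using singular d_endpoints[OF n pdC d] pdC d by auto
      then show ?thesis by blast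
    next
      case 2
      then have ?iii using singular d_endpoints[OF n pdC d] pdC d by auto
      then show ?thesis by blast
    next
      case 3
      then have in_t1: "t1 \<in> {t1_minus q \<beta> n<..<t1_plus q \<beta> n}" by simp
      have pdF1: "pos_def (F1_mat q \<beta> n t1)" by (rule F1_pd_between[OF n pdC d 3])
      note Phi = Phi_iff[OF n pdC pdF1, of t2 t3, folded g_def]
      have "pos_semidef (hankel g (- int n + 1) (3 * int n))" by (rule psd) auto
      then have "Phi q \<beta> n t1 t2 \<le> t3" unfolding Phi(1) .
      show ?thesis
      proof (cases "pos_def (hankel g (- int n + 1) (3 * int n))")
        case False
        then have t3: "t3 = Phi q \<beta> n t1 t2"
          using \<open>Phi q \<beta> n t1 t2 \<le> t3\<close> unfolding Phi(2) by linarith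
        have "\<exists>i1 i2 a. satisfied g (- int n + 1) (3 * int n) i1 i2 a \<and> propagates n g i1 i2 a"
          by (rule kernel) (use False in auto)
        then have ?iv using pdC d in_t1 t3 unfolding g_def by blast
        then show ?thesis by blast
      next
        case pdF2: True
        then have t3: "Phi q \<beta> n t1 t2 < t3" unfolding Phi(2) .
        note Psi = Psi_iff[OF n pdF1 pdF2[unfolded g_def], folded g_def]
        have "pos_semidef (hankel g (- int n) (3 * int n))" by (rule psd) auto
        then have "Psi q \<beta> n t1 t2 t3 \<le> g (- 2 * int n)" unfolding Psi(1) .
        \<comment> \<open>A strict inequality here would produce precisely the excluded
          triple.\<close>
        moreover have "\<not> Psi q \<beta> n t1 t2 t3 < g (- 2 * int n)"
          using excluded pdC d in_t1 t3 unfolding g_def by blast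
        ultimately have eq: "g (- 2 * int n) = Psi q \<beta> n t1 t2 t3"
          and "\<not> pos_def (hankel g (- int n) (3 * int n))" unfolding Psi(2) by linarith+
        then obtain i1 i2 a where sat: "satisfied g (- int n) (3 * int n) i1 i2 a"
          and rel: "propagates n g i1 i2 a"
          using kernel[of "- int n" "3 * int n"] by auto
        have "i1 = - int n \<and> i2 = 3 * int n" by (rule kernel_extreme_labels[OF pdF2 rel])
        then have ?v using pdC d in_t1 t3 eq sat unfolding g_def by blast
        then show ?thesis by blast
      qed
    qed
  qed
qed

end
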